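(* Let ${\bf k}$ be a field which is a finite extension of its prime subfield. Then every recursively presented Lie algebra over ${\bf k}$ can be embedded into a recursively presented Lie algebra over ${\bf k}$ whose defining relations consist of equalities of (nonassociative) words in the generators together with the relation $\alpha+\beta-\gamma=0$, where $\alpha,\beta,\gamma$ are generators.
   Context: A Lie algebra over ${\bf k}$ is called recursively presented if it can be given by a finite set of generators and a recursively enumerable set of defining relations (relations being elements of the free Lie algebra over ${\bf k}$ on the generators). The prime subfield (called "simple subfield" in the source) is the smallest subfield of ${\bf k}$, i.e. $\mathbb{Q}$ or $\mathbb{F}_p$. A nonassociative word in the generators is a Lie monomial, i.e. an iterated Lie bracket of generators; an equality of words is a relation of the form $v=w$ with $v,w$ nonassociative words in the generators. Embedding means an injective homomorphism of Lie algebras over ${\bf k}$. *)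

theory Defs
  imports "HOL-Algebra.Algebra" "HOL-Library.Nat_Bijection"
begin

section \<open>Recursively enumerable sets of natural numbers\<close>

datatype recf = Zr | Sc | Pj nat | Cn recf "recf list" | Pr recf recf | Mn recf

text \<open>
  Kleene's partial recursive functions: \<open>rec_eval f xs y\<close> says that \<open>f\<close> is defined at the
  argument tuple \<open>xs\<close> with value \<open>y\<close>. Arities are not tracked. Recursion and minimisation
  act on the first argument.
\<close>

inductive rec_eval :: "recf \<Rightarrow> nat list \<Rightarrow> nat \<Rightarrow> bool" where
  zero: "rec_eval Zr xs 0"
| succ: "rec_eval Sc (x # xs) (Suc x)"
| proj: "i < length xs \<Longrightarrow> rec_eval (Pj i) xs (xs ! i)"
| comp: "list_all2 (\<lambda>g y. rec_eval g xs y) gs ys \<Longrightarrow> rec_eval f ys z \<Longrightarrow> rec_eval (Cn f gs) xs z"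
| prim_0: "rec_eval f xs y \<Longrightarrow> rec_eval (Pr f g) (0 # xs) y"
| prim_Suc: "rec_eval (Pr f g) (k # xs) r \<Longrightarrow> rec_eval g (k # r # xs) y
    \<Longrightarrow> rec_eval (Pr f g) (Suc k # xs) y"
| mu: "rec_eval f (k # xs) 0 \<Longrightarrow> (\<And>j. j < k \<Longrightarrow> \<exists>r. rec_eval f (j # xs) (Suc r))
    \<Longrightarrow> rec_eval (Mn f) xs k"

definition re_set :: "nat set \<Rightarrow> bool" where
  "re_set A \<longleftrightarrow> (\<exists>f. A = {x. \<exists>y. rec_eval f [x] y})"


section \<open>Lie algebras over a field\<close>

text \<open>The components \<open>mult\<close> and \<open>one\<close> inherited from \<open>module\<close> play no role.\<close>

record ('a, 'b) lie_algebra = "('a, 'b) module" +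
  bracket :: "'b \<Rightarrow> 'b \<Rightarrow> 'b"

locale lie_algebra = K?: field K + L?: module K L
  for K :: "('a, 'r) ring_scheme" (structure) and L :: "('a, 'b, 'm) lie_algebra_scheme" (structure) +
  assumes bracket_closed: "\<lbrakk>x \<in> carrier L; y \<in> carrier L\<rbrakk> \<Longrightarrow> bracket L x y \<in> carrier L"
    and bracket_add_left: "\<lbrakk>x \<in> carrier L; y \<in> carrier L; z \<in> carrier L\<rbrakk>
      \<Longrightarrow> bracket L (x \<oplus>\<^bsub>L\<^esub> y) z = bracket L x z \<oplus>\<^bsub>L\<^esub> bracket L y z"
    and bracket_add_right: "\<lbrakk>x \<in> carrier L; y \<in> carrier L; z \<in> carrier L\<rbrakk>
      \<Longrightarrow> bracket L x (y \<oplus>\<^bsub>L\<^esub> z) = bracket L x y \<oplus>\<^bsub>L\<^esub> bracket L x z"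
    and bracket_smult_left: "\<lbrakk>c \<in> carrier K; x \<in> carrier L; y \<in> carrier L\<rbrakk>
      \<Longrightarrow> bracket L (c \<odot>\<^bsub>L\<^esub> x) y = c \<odot>\<^bsub>L\<^esub> bracket L x y"
    and bracket_smult_right: "\<lbrakk>c \<in> carrier K; x \<in> carrier L; y \<in> carrier L\<rbrakk>
      \<Longrightarrow> bracket L x (c \<odot>\<^bsub>L\<^esub> y) = c \<odot>\<^bsub>L\<^esub> bracket L x y"
    and bracket_self: "x \<in> carrier L \<Longrightarrow> bracket L x x = \<zero>\<^bsub>L\<^esub>"
    and jacobi: "\<lbrakk>x \<in> carrier L; y \<in> carrier L; z \<in> carrier L\<rbrakk>
      \<Longrightarrow> bracket L x (bracket L y z) \<oplus>\<^bsub>L\<^esub> (bracket L y (bracket L z x)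
            \<oplus>\<^bsub>L\<^esub> bracket L z (bracket L x y)) = \<zero>\<^bsub>L\<^esub>"

definition lie_hom :: "('k, 'r) ring_scheme \<Rightarrow> ('k, 'a, 'm) lie_algebra_scheme
    \<Rightarrow> ('k, 'b, 'n) lie_algebra_scheme \<Rightarrow> ('a \<Rightarrow> 'b) set" where
  "lie_hom K L M = {\<phi> \<in> carrier L \<rightarrow> carrier M.
     (\<forall>x\<in>carrier L. \<forall>y\<in>carrier L. \<phi> (x \<oplus>\<^bsub>L\<^esub> y) = \<phi> x \<oplus>\<^bsub>M\<^esub> \<phi> y) \<and>
     (\<forall>c\<in>carrier K. \<forall>x\<in>carrier L. \<phi> (c \<odot>\<^bsub>L\<^esub> x) = c \<odot>\<^bsub>M\<^esub> \<phi> x) \<and>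
     (\<forall>x\<in>carrier L. \<forall>y\<in>carrier L. \<phi> (bracket L x y) = bracket M (\<phi> x) (\<phi> y))}"

definition lie_ideal :: "'a set \<Rightarrow> ('k, 'r) ring_scheme \<Rightarrow> ('k, 'a, 'm) lie_algebra_scheme \<Rightarrow> bool"
  where "lie_ideal I K L \<longleftrightarrow>
    submodule I K L \<and> (\<forall>x\<in>carrier L. \<forall>y\<in>I. bracket L x y \<in> I)"

definition gen_lie_ideal :: "('k, 'r) ring_scheme \<Rightarrow> ('k, 'a, 'm) lie_algebra_scheme
    \<Rightarrow> 'a set \<Rightarrow> 'a set" where
  "gen_lie_ideal K L S = \<Inter>{I. lie_ideal I K L \<and> S \<subseteq> I}"

definition lie_quot :: "('k, 'a, 'm) lie_algebra_scheme \<Rightarrow> 'a set \<Rightarrow> ('k, 'a set) lie_algebra"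
  where "lie_quot L I =
    \<lparr>carrier = a_rcosets\<^bsub>L\<^esub> I, monoid.mult = undefined, one = undefined, ring.zero = I,
     ring.add = set_add L,
     smult = (\<lambda>c A. \<Union>x\<in>A. I +>\<^bsub>L\<^esub> (c \<odot>\<^bsub>L\<^esub> x)),
     bracket = (\<lambda>A B. \<Union>x\<in>A. \<Union>y\<in>B. I +>\<^bsub>L\<^esub> bracket L x y)\<rparr>"

inductive_set lie_words :: "('k, 'a, 'm) lie_algebra_scheme \<Rightarrow> 'a set \<Rightarrow> 'a set"
  for L and G where
  gen: "x \<in> G \<Longrightarrow> x \<in> lie_words L G"
| bracket: "\<lbrakk>v \<in> lie_words L G; w \<in> lie_words L G\<rbrakk> \<Longrightarrow> bracket L v w \<in> lie_words L G"


section \<open>Free Lie algebras and presentations\<close>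

text \<open>
  The free Lie algebra on \<open>n\<close> generators is the set of all formal expressions in the
  generators, modulo the least congruence enforcing the axioms of a Lie algebra over \<open>K\<close>.
\<close>

datatype 'k lie_term = Gen nat | Zero | Add "'k lie_term" "'k lie_term"
  | Smult 'k "'k lie_term" | Brk "'k lie_term" "'k lie_term"

inductive_set lie_terms :: "('k, 'r) ring_scheme \<Rightarrow> nat \<Rightarrow> 'k lie_term set" for K and n where
  "i < n \<Longrightarrow> Gen i \<in> lie_terms K n"
| "Zero \<in> lie_terms K n"
| "\<lbrakk>s \<in> lie_terms K n; t \<in> lie_terms K n\<rbrakk> \<Longrightarrow> Add s t \<in> lie_terms K n"
| "\<lbrakk>c \<in> carrier K; t \<in> lie_terms K n\<rbrakk> \<Longrightarrow> Smult c t \<in> lie_terms K n"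
| "\<lbrakk>s \<in> lie_terms K n; t \<in> lie_terms K n\<rbrakk> \<Longrightarrow> Brk s t \<in> lie_terms K n"

inductive_set lie_cong :: "('k, 'r) ring_scheme \<Rightarrow> nat \<Rightarrow> ('k lie_term \<times> 'k lie_term) set"
  for K and n where
  refl: "s \<in> lie_terms K n \<Longrightarrow> (s, s) \<in> lie_cong K n"
| sym: "(s, t) \<in> lie_cong K n \<Longrightarrow> (t, s) \<in> lie_cong K n"
| trans: "\<lbrakk>(s, t) \<in> lie_cong K n; (t, u) \<in> lie_cong K n\<rbrakk> \<Longrightarrow> (s, u) \<in> lie_cong K n"
| cong_add: "\<lbrakk>(s, s') \<in> lie_cong K n; (t, t') \<in> lie_cong K n\<rbrakk>
    \<Longrightarrow> (Add s t, Add s' t') \<in> lie_cong K n"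
| cong_smult: "\<lbrakk>c \<in> carrier K; (s, s') \<in> lie_cong K n\<rbrakk>
    \<Longrightarrow> (Smult c s, Smult c s') \<in> lie_cong K n"
| cong_brk: "\<lbrakk>(s, s') \<in> lie_cong K n; (t, t') \<in> lie_cong K n\<rbrakk>
    \<Longrightarrow> (Brk s t, Brk s' t') \<in> lie_cong K n"
| add_assoc: "\<lbrakk>s \<in> lie_terms K n; t \<in> lie_terms K n; u \<in> lie_terms K n\<rbrakk>
    \<Longrightarrow> (Add (Add s t) u, Add s (Add t u)) \<in> lie_cong K n"
| add_comm: "\<lbrakk>s \<in> lie_terms K n; t \<in> lie_terms K n\<rbrakk> \<Longrightarrow> (Add s t, Add t s) \<in> lie_cong K n"
| add_zero: "s \<in> lie_terms K n \<Longrightarrow> (Add Zero s, s) \<in> lie_cong K n"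
| add_neg: "s \<in> lie_terms K n \<Longrightarrow> (Add (Smult (\<ominus>\<^bsub>K\<^esub> \<one>\<^bsub>K\<^esub>) s) s, Zero) \<in> lie_cong K n"
| smult_add: "\<lbrakk>c \<in> carrier K; s \<in> lie_terms K n; t \<in> lie_terms K n\<rbrakk>
    \<Longrightarrow> (Smult c (Add s t), Add (Smult c s) (Smult c t)) \<in> lie_cong K n"
| add_smult: "\<lbrakk>c \<in> carrier K; d \<in> carrier K; s \<in> lie_terms K n\<rbrakk>
    \<Longrightarrow> (Smult (c \<oplus>\<^bsub>K\<^esub> d) s, Add (Smult c s) (Smult d s)) \<in> lie_cong K n"
| smult_smult: "\<lbrakk>c \<in> carrier K; d \<in> carrier K; s \<in> lie_terms K n\<rbrakk>
    \<Longrightarrow> (Smult (c \<otimes>\<^bsub>K\<^esub> d) s, Smult c (Smult d s)) \<in> lie_cong K n"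
| smult_one: "s \<in> lie_terms K n \<Longrightarrow> (Smult \<one>\<^bsub>K\<^esub> s, s) \<in> lie_cong K n"
| brk_add_left: "\<lbrakk>s \<in> lie_terms K n; t \<in> lie_terms K n; u \<in> lie_terms K n\<rbrakk>
    \<Longrightarrow> (Brk (Add s t) u, Add (Brk s u) (Brk t u)) \<in> lie_cong K n"
| brk_add_right: "\<lbrakk>s \<in> lie_terms K n; t \<in> lie_terms K n; u \<in> lie_terms K n\<rbrakk>
    \<Longrightarrow> (Brk s (Add t u), Add (Brk s t) (Brk s u)) \<in> lie_cong K n"
| brk_smult_left: "\<lbrakk>c \<in> carrier K; s \<in> lie_terms K n; t \<in> lie_terms K n\<rbrakk>
    \<Longrightarrow> (Brk (Smult c s) t, Smult c (Brk s t)) \<in> lie_cong K n"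
| brk_smult_right: "\<lbrakk>c \<in> carrier K; s \<in> lie_terms K n; t \<in> lie_terms K n\<rbrakk>
    \<Longrightarrow> (Brk s (Smult c t), Smult c (Brk s t)) \<in> lie_cong K n"
| brk_self: "s \<in> lie_terms K n \<Longrightarrow> (Brk s s, Zero) \<in> lie_cong K n"
| jacobi: "\<lbrakk>s \<in> lie_terms K n; t \<in> lie_terms K n; u \<in> lie_terms K n\<rbrakk>
    \<Longrightarrow> (Add (Brk s (Brk t u)) (Add (Brk t (Brk u s)) (Brk u (Brk s t))), Zero) \<in> lie_cong K n"

definition lie_class :: "('k, 'r) ring_scheme \<Rightarrow> nat \<Rightarrow> 'k lie_term \<Rightarrow> 'k lie_term set" where
  "lie_class K n t = lie_cong K n `` {t}"

definition free_lie :: "('k, 'r) ring_scheme \<Rightarrow> nat \<Rightarrow> ('k, 'k lie_term set) lie_algebra" where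
  "free_lie K n =
    \<lparr>carrier = lie_terms K n // lie_cong K n, monoid.mult = undefined, one = undefined,
     ring.zero = lie_class K n Zero,
     ring.add = (\<lambda>A B. \<Union>s\<in>A. \<Union>t\<in>B. lie_class K n (Add s t)),
     smult = (\<lambda>c A. \<Union>s\<in>A. lie_class K n (Smult c s)),
     bracket = (\<lambda>A B. \<Union>s\<in>A. \<Union>t\<in>B. lie_class K n (Brk s t))\<rparr>"

definition free_gens :: "('k, 'r) ring_scheme \<Rightarrow> nat \<Rightarrow> 'k lie_term set set" where
  "free_gens K n = (\<lambda>i. lie_class K n (Gen i)) ` {..<n}"

definition presented_lie :: "('k, 'r) ring_scheme \<Rightarrow> nat \<Rightarrow> 'k lie_term set set
    \<Rightarrow> ('k, 'k lie_term set set) lie_algebra" where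
  "presented_lie K n R = lie_quot (free_lie K n) (gen_lie_ideal K (free_lie K n) R)"


section \<open>Recursive presentations\<close>

definition prime_subfield :: "('k, 'r) ring_scheme \<Rightarrow> 'k set" where
  "prime_subfield K = \<Inter>{F. subfield F K}"

text \<open>
  Codes for scalars: the pair \<open>(a, b)\<close> of an integer and a natural number stands for
  \<open>a / (b + 1)\<close> in the prime subfield (for \<open>0\<close>, if \<open>b + 1\<close> vanishes in \<open>K\<close>), and a list of
  such pairs stands for the linear combination of \<open>bs\<close> with these coefficients.
\<close>

definition prime_decode :: "('k, 'r) ring_scheme \<Rightarrow> nat \<Rightarrow> 'k" where
  "prime_decode K c = (case prod_decode c of (a, b) \<Rightarrow>
     let d = [Suc b] \<cdot>\<^bsub>K\<^esub> \<one>\<^bsub>K\<^esub> in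
     if d = \<zero>\<^bsub>K\<^esub> then \<zero>\<^bsub>K\<^esub> else ([int_decode a] \<cdot>\<^bsub>K\<^esub> \<one>\<^bsub>K\<^esub>) \<otimes>\<^bsub>K\<^esub> inv\<^bsub>K\<^esub> d)"

definition scalar_decode :: "('k, 'r) ring_scheme \<Rightarrow> 'k list \<Rightarrow> nat \<Rightarrow> 'k" where
  "scalar_decode K bs c = ring.combine K (map (prime_decode K) (list_decode c)) bs"

primrec term_encode :: "nat lie_term \<Rightarrow> nat" where
  "term_encode (Gen i) = prod_encode (0, i)"
| "term_encode Zero = prod_encode (1, 0)"
| "term_encode (Add s t) = prod_encode (2, prod_encode (term_encode s, term_encode t))"
| "term_encode (Smult c t) = prod_encode (3, prod_encode (c, term_encode t))"
| "term_encode (Brk s t) = prod_encode (4, prod_encode (term_encode s, term_encode t))"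

text \<open>
  A set \<open>R\<close> of elements of the free Lie algebra is recursively enumerable if some
  recursively enumerable set \<open>T\<close> of expressions, with scalars written in coordinates over the
  prime subfield, represents exactly the elements of \<open>R\<close>. The choice of the spanning list
  \<open>bs\<close> is immaterial: changing it is a linear, hence computable, change of coordinates.
\<close>

definition re_relations :: "('k, 'r) ring_scheme \<Rightarrow> nat \<Rightarrow> 'k lie_term set set \<Rightarrow> bool" where
  "re_relations K n R \<longleftrightarrow>
    (\<exists>bs T. set bs \<subseteq> carrier K \<and> ring.Span K (prime_subfield K) bs = carrier K \<and>
       re_set (term_encode ` T) \<and>
       map_lie_term (scalar_decode K bs) ` T \<subseteq> lie_terms K n \<and>
       R = (\<lambda>t. lie_class K n (map_lie_term (scalar_decode K bs) t)) ` T)"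

definition recursively_presented :: "('k, 'r) ring_scheme
    \<Rightarrow> ('k, 'a, 'm) lie_algebra_scheme \<Rightarrow> bool" where
  "recursively_presented K L \<longleftrightarrow>
    (\<exists>n R. re_relations K n R \<and>
       (\<exists>\<phi> \<in> lie_hom K L (presented_lie K n R).
          bij_betw \<phi> (carrier L) (carrier (presented_lie K n R))))"

end

(*
  Every scalar multiple of an element of the given algebra L receives as name a Lie monomial
  [alpha, Z_i], where Z_i = (ad b)^i f. If moreover [beta, Z_i] is the name of a second element,
  then alpha + beta = gamma turns [gamma, Z_i] into their sum, so that all relations of L,
  resolved into single additions, brackets and scalar multiplications, become equalities of
  monomials.

  Equalities of monomials and additions say nothing about how the new algebra multiplies by
  scalars: the map from L to it is so far only additive, although it remembers which name belongs
  to which scalar multiple. It is made K-linear by averaging with a separability idempotent of K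
  over its prime subfield. The idempotent comes from integer polynomials f_j with f_j(b_j) = 0 and
  f_j'(b_j) nonzero, where the b_j generate K; they exist because the prime subfield is perfect.

  For injectivity, the new algebra is mapped to the semidirect product of a Lie algebra of
  functions on words with its derivations. There b, alpha and beta act by shifting words, and f is
  the function whose values at the words b^i alpha and b^i beta are the prescribed elements; no
  basis theorem for free Lie algebras is needed.
*)

theory Submission
  imports Defs "HOL-Computational_Algebra.Polynomial"
begin


section \<open>Lie algebras over a field\<close>

text \<open>The obstacle is that the new relations may not mention scalars, while the algebra they
  present carries a scalar action that knows nothing of the names. A name is a number
  \<open>pe m x\<close>, read as the scalar \<open>\<kappa> m\<close> times the expression coded by
  \<open>x\<close>, where \<kappa> is a homomorphism from the multiplicative monoid of natural
  numbers to the field; it can take any prescribed values on distinct primes. Multiplicativity lets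
  the bracket of two names be a name again, with \<open>m * m'\<close>. This is why the averaged map
  respects brackets: averaging both arguments averages the bracket twice, and the second average
  does nothing because the first has already produced a linear family and the weight is 1. The
  equations \<open>f_j(b_j) = 0\<close>, which the idempotent needs, must hold among names in the
  new algebra, so they are imposed as relations, with negative coefficients moved to the other side.
  In the model the names are linear in their scalars from the start; there the averaging is
  invisible, and composing with the map to the model recovers an injection.\<close>

lemma lie_algebraI:
  fixes K (structure) and L (structure)
  assumes "field K" "abelian_group L"
    and "\<And>c x. \<lbrakk>c \<in> carrier K; x \<in> carrier L\<rbrakk> \<Longrightarrow> c \<odot>\<^bsub>L\<^esub> x \<in> carrier L"
    and "\<And>c d x. \<lbrakk>c \<in> carrier K; d \<in> carrier K; x \<in> carrier L\<rbrakk>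
      \<Longrightarrow> (c \<oplus>\<^bsub>K\<^esub> d) \<odot>\<^bsub>L\<^esub> x = c \<odot>\<^bsub>L\<^esub> x \<oplus>\<^bsub>L\<^esub> d \<odot>\<^bsub>L\<^esub> x"
    and "\<And>c x y. \<lbrakk>c \<in> carrier K; x \<in> carrier L; y \<in> carrier L\<rbrakk>
      \<Longrightarrow> c \<odot>\<^bsub>L\<^esub> (x \<oplus>\<^bsub>L\<^esub> y) = c \<odot>\<^bsub>L\<^esub> x \<oplus>\<^bsub>L\<^esub> c \<odot>\<^bsub>L\<^esub> y"
    and "\<And>c d x. \<lbrakk>c \<in> carrier K; d \<in> carrier K; x \<in> carrier L\<rbrakk>
      \<Longrightarrow> (c \<otimes>\<^bsub>K\<^esub> d) \<odot>\<^bsub>L\<^esub> x = c \<odot>\<^bsub>L\<^esub> (d \<odot>\<^bsub>L\<^esub> x)"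
    and "\<And>x. x \<in> carrier L \<Longrightarrow> \<one>\<^bsub>K\<^esub> \<odot>\<^bsub>L\<^esub> x = x"
    and "lie_algebra_axioms K L"
  shows "lie_algebra K L"
proof -
  have cr: "cring K" using assms(1) by (simp add: field_def domain_def)
  have "module K L"
    by (rule moduleI) (use assms cr in auto)
  then show ?thesis using assms(1,8) by (simp add: lie_algebra_def)
qed

context lie_algebra
begin

lemma bracket_zero_left [simp]: "x \<in> carrier L \<Longrightarrow> bracket L \<zero>\<^bsub>L\<^esub> x = \<zero>\<^bsub>L\<^esub>"
  using bracket_smult_left[of "\<zero>\<^bsub>K\<^esub>" "\<zero>\<^bsub>L\<^esub>" x] bracket_closed by simp

lemma bracket_zero_right [simp]: "x \<in> carrier L \<Longrightarrow> bracket L x \<zero>\<^bsub>L\<^esub> = \<zero>\<^bsub>L\<^esub>"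
  using bracket_smult_right[of "\<zero>\<^bsub>K\<^esub>" x "\<zero>\<^bsub>L\<^esub>"] bracket_closed by simp

lemma bracket_antisym:
  assumes "x \<in> carrier L" "y \<in> carrier L"
  shows "bracket L y x = \<ominus>\<^bsub>L\<^esub> bracket L x y"
proof -
  have "bracket L y x \<oplus>\<^bsub>L\<^esub> bracket L x y = bracket L (x \<oplus>\<^bsub>L\<^esub> y) (x \<oplus>\<^bsub>L\<^esub> y)"
    using assms
    by (simp add: bracket_add_left bracket_add_right bracket_closed bracket_self[of x] bracket_self[of y])
  also have "\<dots> = \<zero>\<^bsub>L\<^esub>" using assms by (simp add: bracket_self)
  finally show ?thesis using assms by (metis M.minus_equality bracket_closed)
qed

lemma bracket_minus_left:
  assumes "x \<in> carrier L" "y \<in> carrier L"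
  shows "bracket L (\<ominus>\<^bsub>L\<^esub> x) y = \<ominus>\<^bsub>L\<^esub> bracket L x y"
proof -
  have "bracket L (\<ominus>\<^bsub>L\<^esub> x) y \<oplus>\<^bsub>L\<^esub> bracket L x y = \<zero>\<^bsub>L\<^esub>"
    using assms by (simp flip: bracket_add_left add: M.l_neg)
  then show ?thesis using assms by (metis M.minus_equality bracket_closed M.a_inv_closed)
qed

lemma bracket_minus_right:
  assumes "x \<in> carrier L" "y \<in> carrier L"
  shows "bracket L x (\<ominus>\<^bsub>L\<^esub> y) = \<ominus>\<^bsub>L\<^esub> bracket L x y"
proof -
  have "bracket L x (\<ominus>\<^bsub>L\<^esub> y) \<oplus>\<^bsub>L\<^esub> bracket L x y = \<zero>\<^bsub>L\<^esub>"
    using assms by (simp flip: bracket_add_right add: M.l_neg)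
  then show ?thesis using assms by (metis M.minus_equality bracket_closed M.a_inv_closed)
qed

lemma zero_if_double: "\<lbrakk>x \<in> carrier L; x \<oplus>\<^bsub>L\<^esub> x = x\<rbrakk> \<Longrightarrow> x = \<zero>\<^bsub>L\<^esub>"
  using M.add.l_cancel_one[of x x] by simp

end

lemma lie_homD:
  assumes "\<phi> \<in> lie_hom K L M"
  shows "x \<in> carrier L \<Longrightarrow> \<phi> x \<in> carrier M"
    and "\<lbrakk>x \<in> carrier L; y \<in> carrier L\<rbrakk> \<Longrightarrow> \<phi> (x \<oplus>\<^bsub>L\<^esub> y) = \<phi> x \<oplus>\<^bsub>M\<^esub> \<phi> y"
    and "\<lbrakk>c \<in> carrier K; x \<in> carrier L\<rbrakk> \<Longrightarrow> \<phi> (c \<odot>\<^bsub>L\<^esub> x) = c \<odot>\<^bsub>M\<^esub> \<phi> x"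
    and "\<lbrakk>x \<in> carrier L; y \<in> carrier L\<rbrakk> \<Longrightarrow> \<phi> (bracket L x y) = bracket M (\<phi> x) (\<phi> y)"
  using assms by (auto simp: lie_hom_def)

lemma lie_homI:
  assumes "\<And>x. x \<in> carrier L \<Longrightarrow> \<phi> x \<in> carrier M"
    and "\<And>x y. \<lbrakk>x \<in> carrier L; y \<in> carrier L\<rbrakk> \<Longrightarrow> \<phi> (x \<oplus>\<^bsub>L\<^esub> y) = \<phi> x \<oplus>\<^bsub>M\<^esub> \<phi> y"
    and "\<And>c x. \<lbrakk>c \<in> carrier K; x \<in> carrier L\<rbrakk> \<Longrightarrow> \<phi> (c \<odot>\<^bsub>L\<^esub> x) = c \<odot>\<^bsub>M\<^esub> \<phi> x"
    and "\<And>x y. \<lbrakk>x \<in> carrier L; y \<in> carrier L\<rbrakk> \<Longrightarrow> \<phi> (bracket L x y) = bracket M (\<phi> x) (\<phi> y)"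
  shows "\<phi> \<in> lie_hom K L M"
  using assms by (auto simp: lie_hom_def)

lemma lie_hom_comp:
  assumes "\<phi> \<in> lie_hom K L M" "\<psi> \<in> lie_hom K M N"
  shows "\<psi> \<circ> \<phi> \<in> lie_hom K L N"
  by (rule lie_homI) (simp_all add: lie_homD[OF assms(1)] lie_homD[OF assms(2)])

lemma lie_hom_zero:
  assumes "lie_algebra K L" "lie_algebra K M" "\<phi> \<in> lie_hom K L M"
  shows "\<phi> \<zero>\<^bsub>L\<^esub> = \<zero>\<^bsub>M\<^esub>"
proof -
  interpret L: lie_algebra K L by fact
  interpret M: lie_algebra K M by fact
  have "\<phi> \<zero>\<^bsub>L\<^esub> \<oplus>\<^bsub>M\<^esub> \<phi> \<zero>\<^bsub>L\<^esub> = \<phi> \<zero>\<^bsub>L\<^esub>"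
    by (simp flip: lie_homD(2)[OF assms(3)])
  then show ?thesis
    using M.zero_if_double lie_homD(1)[OF assms(3)] L.M.zero_closed by blast
qed

primrec lie_eval :: "('k, 'a, 'm) lie_algebra_scheme \<Rightarrow> (nat \<Rightarrow> 'a) \<Rightarrow> 'k lie_term \<Rightarrow> 'a" where
  "lie_eval L \<rho> (Gen i) = \<rho> i"
| "lie_eval L \<rho> Zero = \<zero>\<^bsub>L\<^esub>"
| "lie_eval L \<rho> (Add s t) = lie_eval L \<rho> s \<oplus>\<^bsub>L\<^esub> lie_eval L \<rho> t"
| "lie_eval L \<rho> (Smult c t) = c \<odot>\<^bsub>L\<^esub> lie_eval L \<rho> t"
| "lie_eval L \<rho> (Brk s t) = bracket L (lie_eval L \<rho> s) (lie_eval L \<rho> t)"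

lemma (in lie_algebra) lie_eval_closed:
  assumes "t \<in> lie_terms K n" "\<And>i. i < n \<Longrightarrow> \<rho> i \<in> carrier L"
  shows "lie_eval L \<rho> t \<in> carrier L"
  using assms(1) by induction (simp_all add: assms(2) bracket_closed)

lemma (in ring) lie_cong_terms:
  assumes "(s, t) \<in> lie_cong R n"
  shows "s \<in> lie_terms R n \<and> t \<in> lie_terms R n"
  using assms by induction (auto intro!: lie_terms.intros)

lemma (in lie_algebra) lie_eval_cong:
  assumes st: "(s, t) \<in> lie_cong K n" and \<rho>: "\<And>i. i < n \<Longrightarrow> \<rho> i \<in> carrier L"
  shows "lie_eval L \<rho> s = lie_eval L \<rho> t"
proof -
  have cl: "lie_eval L \<rho> s \<in> carrier L" if "s \<in> lie_terms K n" for s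
    using lie_eval_closed[OF that] \<rho> by blast
  note lie_jacobi = jacobi
  show ?thesis
    using st
  proof induction
    case (jacobi s t u)
    then show ?case using cl by (simp add: lie_jacobi)
  next
    case (add_comm s t)
    then show ?case using cl by (simp add: M.a_comm)
  qed (simp_all add: cl bracket_closed bracket_self M.a_assoc smult_l_distr
      smult_r_distr smult_assoc1 smult_l_minus M.l_neg bracket_add_left bracket_add_right
      bracket_smult_left bracket_smult_right)
qed

lemma lie_eval_hom:
  assumes "lie_algebra K L" "lie_algebra K M" "\<phi> \<in> lie_hom K L M"
    and "t \<in> lie_terms K n" and \<rho>: "\<And>i. i < n \<Longrightarrow> \<rho> i \<in> carrier L"
  shows "\<phi> (lie_eval L \<rho> t) = lie_eval M (\<lambda>i. \<phi> (\<rho> i)) t"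
  using assms(4)
proof induction
  case 2
  then show ?case using lie_hom_zero[OF assms(1-3)] by simp
qed (simp_all add: lie_homD[OF assms(3)] lie_algebra.lie_eval_closed[OF assms(1) _ \<rho>])

lemma lie_eval_gens_cong:
  assumes "t \<in> lie_terms K n" "\<And>i. i < n \<Longrightarrow> \<rho> i = \<rho>' i"
  shows "lie_eval L \<rho> t = lie_eval L \<rho>' t"
  using assms(1) by induction (simp_all add: assms(2))


section \<open>Free and presented Lie algebras\<close>

text \<open>Operations on classes and cosets are defined as unions over representatives. Such a
  union collapses to one class once independence of the representatives is known.\<close>

lemma UN_eq_const:
  assumes "a \<in> A" "\<And>x. x \<in> A \<Longrightarrow> f x = C"
  shows "(\<Union>x\<in>A. f x) = C"
  using assms by blast

lemma (in ring) lie_cong_equiv: "equiv (lie_terms R n) (lie_cong R n)"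
proof (rule equivI)
  show "lie_cong R n \<subseteq> lie_terms R n \<times> lie_terms R n"
    using lie_cong_terms by auto
  show "refl_on (lie_terms R n) (lie_cong R n)"
    by (auto simp: refl_on_def intro: lie_cong.refl)
  show "sym (lie_cong R n)" by (auto simp: sym_def intro: lie_cong.sym)
  show "Relation.trans (lie_cong R n)" by (auto simp: Relation.trans_def intro: lie_cong.trans)
qed

lemma (in ring) lie_class_eq_iff:
  "\<lbrakk>s \<in> lie_terms R n; t \<in> lie_terms R n\<rbrakk>
    \<Longrightarrow> lie_class R n s = lie_class R n t \<longleftrightarrow> (s, t) \<in> lie_cong R n"
  unfolding lie_class_def using eq_equiv_class_iff[OF lie_cong_equiv] by blast

lemma (in ring) lie_class_mem_iff: "u \<in> lie_class R n s \<longleftrightarrow> (s, u) \<in> lie_cong R n"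
  by (simp add: lie_class_def)

lemma (in ring) lie_class_eqI: "(s, t) \<in> lie_cong R n \<Longrightarrow> lie_class R n s = lie_class R n t"
  using lie_class_eq_iff lie_cong_terms by blast

lemma free_lie_carrier: "carrier (free_lie K n) = lie_class K n ` lie_terms K n"
  by (auto simp: free_lie_def quotient_def lie_class_def)

lemma lie_class_closed: "t \<in> lie_terms K n \<Longrightarrow> lie_class K n t \<in> carrier (free_lie K n)"
  by (simp add: free_lie_carrier)

lemma free_lie_zero: "\<zero>\<^bsub>free_lie K n\<^esub> = lie_class K n Zero"
  by (simp add: free_lie_def)

lemma (in ring) free_lie_add:
  assumes "s \<in> lie_terms R n" "t \<in> lie_terms R n"
  shows "lie_class R n s \<oplus>\<^bsub>free_lie R n\<^esub> lie_class R n t = lie_class R n (Add s t)"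
proof -
  have "lie_class R n (Add s' t') = lie_class R n (Add s t)"
    if "s' \<in> lie_class R n s" "t' \<in> lie_class R n t" for s' t'
    using that by (intro lie_class_eqI[symmetric]) (auto simp: lie_class_mem_iff intro: lie_cong.cong_add)
  moreover have "s \<in> lie_class R n s" "t \<in> lie_class R n t"
    using assms by (auto simp: lie_class_mem_iff intro: lie_cong.refl)
  ultimately show ?thesis
    unfolding free_lie_def lie_algebra.simps ring.simps module.simps by (intro UN_eq_const) blast+
qed

lemma (in ring) free_lie_bracket:
  assumes "s \<in> lie_terms R n" "t \<in> lie_terms R n"
  shows "bracket (free_lie R n) (lie_class R n s) (lie_class R n t) = lie_class R n (Brk s t)"
proof -
  have "lie_class R n (Brk s' t') = lie_class R n (Brk s t)"
    if "s' \<in> lie_class R n s" "t' \<in> lie_class R n t" for s' t'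
    using that by (intro lie_class_eqI[symmetric]) (auto simp: lie_class_mem_iff intro: lie_cong.cong_brk)
  moreover have "s \<in> lie_class R n s" "t \<in> lie_class R n t"
    using assms by (auto simp: lie_class_mem_iff intro: lie_cong.refl)
  ultimately show ?thesis
    unfolding free_lie_def lie_algebra.simps ring.simps module.simps by (intro UN_eq_const) blast+
qed

lemma (in ring) free_lie_smult:
  assumes "c \<in> carrier R" "t \<in> lie_terms R n"
  shows "c \<odot>\<^bsub>free_lie R n\<^esub> lie_class R n t = lie_class R n (Smult c t)"
proof -
  have "lie_class R n (Smult c t') = lie_class R n (Smult c t)" if "t' \<in> lie_class R n t" for t'
    using that assms by (intro lie_class_eqI[symmetric]) (auto simp: lie_class_mem_iff intro: lie_cong.cong_smult)
  moreover have "t \<in> lie_class R n t"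
    using assms by (auto simp: lie_class_mem_iff intro: lie_cong.refl)
  ultimately show ?thesis
    unfolding free_lie_def lie_algebra.simps ring.simps module.simps by (intro UN_eq_const) blast+
qed

theorem free_lie_algebra:
  assumes "field K"
  shows "lie_algebra K (free_lie K n)"
proof -
  interpret field K by fact
  note ops = free_lie_add free_lie_smult free_lie_bracket free_lie_zero
  have tI: "s \<in> lie_terms K n \<Longrightarrow> t \<in> lie_terms K n \<Longrightarrow> Add s t \<in> lie_terms K n"
    "s \<in> lie_terms K n \<Longrightarrow> t \<in> lie_terms K n \<Longrightarrow> Brk s t \<in> lie_terms K n"
    "c \<in> carrier K \<Longrightarrow> t \<in> lie_terms K n \<Longrightarrow> Smult c t \<in> lie_terms K n"
    "Zero \<in> lie_terms K n" for s t c
    by (auto intro: lie_terms.intros)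
  have ab: "abelian_group (free_lie K n)"
  proof (rule abelian_groupI)
    fix x assume "x \<in> carrier (free_lie K n)"
    then obtain t where t: "t \<in> lie_terms K n" "x = lie_class K n t" by (auto simp: free_lie_carrier)
    show "\<exists>y\<in>carrier (free_lie K n). y \<oplus>\<^bsub>free_lie K n\<^esub> x = \<zero>\<^bsub>free_lie K n\<^esub>"
      by (rule bexI[of _ "lie_class K n (Smult (\<ominus>\<^bsub>K\<^esub> \<one>\<^bsub>K\<^esub>) t)"])
        (use t in \<open>auto simp: ops free_lie_carrier tI del: equalityI subsetI intro!: lie_class_eqI lie_cong.add_neg\<close>)
  qed (auto simp: ops free_lie_carrier tI del: equalityI subsetI
      intro!: lie_class_eqI intro: lie_cong.add_assoc lie_cong.add_comm lie_cong.add_zero)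
  have ax: "lie_algebra_axioms K (free_lie K n)"
    by unfold_locales (auto simp: ops free_lie_carrier tI del: equalityI subsetI
      intro!: lie_class_eqI intro: lie_cong.brk_add_left lie_cong.brk_add_right lie_cong.brk_smult_left
        lie_cong.brk_smult_right lie_cong.brk_self lie_cong.jacobi)
  show ?thesis
    by (rule lie_algebraI[OF assms ab _ _ _ _ _ ax])
      (auto simp: ops free_lie_carrier tI del: equalityI subsetI intro!: lie_class_eqI
        intro: lie_cong.add_smult lie_cong.smult_add lie_cong.smult_smult lie_cong.smult_one)
qed

text \<open>All axioms are identities, so they pass to a surjective image on which the operations
  are compatible. For the quotient only this compatibility remains to be checked.\<close>

lemma lie_algebra_image:
  fixes M :: "('k, 'b, 'n) lie_algebra_scheme"
  assumes "lie_algebra K L"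
    and car: "carrier M = \<pi> ` carrier L" and zero: "\<zero>\<^bsub>M\<^esub> = \<pi> \<zero>\<^bsub>L\<^esub>"
    and add: "\<And>x y. \<lbrakk>x \<in> carrier L; y \<in> carrier L\<rbrakk> \<Longrightarrow> \<pi> x \<oplus>\<^bsub>M\<^esub> \<pi> y = \<pi> (x \<oplus>\<^bsub>L\<^esub> y)"
    and smult: "\<And>c x. \<lbrakk>c \<in> carrier K; x \<in> carrier L\<rbrakk> \<Longrightarrow> c \<odot>\<^bsub>M\<^esub> \<pi> x = \<pi> (c \<odot>\<^bsub>L\<^esub> x)"
    and brk: "\<And>x y. \<lbrakk>x \<in> carrier L; y \<in> carrier L\<rbrakk> \<Longrightarrow> bracket M (\<pi> x) (\<pi> y) = \<pi> (bracket L x y)"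
  shows "lie_algebra K M"
proof -
  interpret lie_algebra K L by fact
  note ops = assms(3-6)
  have ab: "abelian_group M"
  proof (rule abelian_groupI)
    fix x assume "x \<in> carrier M"
    then obtain t where t: "t \<in> carrier L" "x = \<pi> t" by (auto simp: car)
    show "\<exists>y\<in>carrier M. y \<oplus>\<^bsub>M\<^esub> x = \<zero>\<^bsub>M\<^esub>"
      by (rule bexI[of _ "\<pi> (\<ominus>\<^bsub>L\<^esub> t)"]) (use t in \<open>auto simp: ops car M.l_neg\<close>)
  next
    fix x y assume "x \<in> carrier M" "y \<in> carrier M"
    then obtain s t where "s \<in> carrier L" "x = \<pi> s" "t \<in> carrier L" "y = \<pi> t"
      by (auto simp: car)
    then show "x \<oplus>\<^bsub>M\<^esub> y = y \<oplus>\<^bsub>M\<^esub> x" by (simp add: ops M.a_comm[of s t])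
  qed (auto simp: ops car M.a_assoc)
  have ax: "lie_algebra_axioms K M"
    by unfold_locales (auto simp: ops car bracket_closed bracket_add_left bracket_add_right
      bracket_smult_left bracket_smult_right bracket_self jacobi)
  show ?thesis
    by (rule lie_algebraI[OF K.field_axioms ab _ _ _ _ _ ax])
      (auto simp: ops car smult_l_distr smult_r_distr smult_assoc1)
qed

lemma (in lie_algebra) lie_ideal_subgroup:
  assumes "lie_ideal I K L"
  shows "abelian_subgroup I L"
proof -
  have "additive_subgroup I L"
    using assms by (simp add: additive_subgroup_def lie_ideal_def submodule_def)
  then show ?thesis using M.abelian_group_axioms by (rule abelian_subgroupI3)
qed

lemma (in lie_algebra) lie_quot_ops:
  assumes I: "lie_ideal I K L"
  shows lie_quot_carrier: "carrier (lie_quot L I) = (\<lambda>x. I +>\<^bsub>L\<^esub> x) ` carrier L"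
    and lie_quot_zero: "\<zero>\<^bsub>lie_quot L I\<^esub> = I +>\<^bsub>L\<^esub> \<zero>\<^bsub>L\<^esub>"
    and lie_quot_add: "\<lbrakk>x \<in> carrier L; y \<in> carrier L\<rbrakk>
      \<Longrightarrow> (I +>\<^bsub>L\<^esub> x) \<oplus>\<^bsub>lie_quot L I\<^esub> (I +>\<^bsub>L\<^esub> y) = I +>\<^bsub>L\<^esub> (x \<oplus>\<^bsub>L\<^esub> y)"
    and lie_quot_smult: "\<lbrakk>c \<in> carrier K; x \<in> carrier L\<rbrakk>
      \<Longrightarrow> c \<odot>\<^bsub>lie_quot L I\<^esub> (I +>\<^bsub>L\<^esub> x) = I +>\<^bsub>L\<^esub> (c \<odot>\<^bsub>L\<^esub> x)"
    and lie_quot_bracket: "\<lbrakk>x \<in> carrier L; y \<in> carrier L\<rbrakk>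
      \<Longrightarrow> bracket (lie_quot L I) (I +>\<^bsub>L\<^esub> x) (I +>\<^bsub>L\<^esub> y) = I +>\<^bsub>L\<^esub> bracket L x y"
    and lie_quot_eq_iff: "\<lbrakk>x \<in> carrier L; y \<in> carrier L\<rbrakk>
      \<Longrightarrow> I +>\<^bsub>L\<^esub> x = I +>\<^bsub>L\<^esub> y \<longleftrightarrow> (\<exists>i\<in>I. x = i \<oplus>\<^bsub>L\<^esub> y)"
proof -
  interpret I: abelian_subgroup I L by (rule lie_ideal_subgroup[OF I])
  have sub: "submodule I K L" and br: "\<And>x y. x \<in> carrier L \<Longrightarrow> y \<in> I \<Longrightarrow> bracket L x y \<in> I"
    using I by (auto simp: lie_ideal_def)
  have IL: "\<And>i. i \<in> I \<Longrightarrow> i \<in> carrier L" using I.a_subset by auto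
  \<comment> \<open>\<open>lie_ideal\<close> asks for absorption on one side only; antisymmetry
    supplies the other, needed when both representatives vary.\<close>
  have br': "bracket L y x \<in> I" if "x \<in> carrier L" "y \<in> I" for x y
  proof -
    have "bracket L y x = \<ominus>\<^bsub>L\<^esub> bracket L x y" using that IL by (intro bracket_antisym) auto
    then show ?thesis using br[OF that] by simp
  qed
  have mem: "u \<in> I +>\<^bsub>L\<^esub> x \<longleftrightarrow> (\<exists>i\<in>I. u = i \<oplus>\<^bsub>L\<^esub> x)" for u x
    by (auto simp: a_r_coset_def')
  have eqI: "I +>\<^bsub>L\<^esub> (i \<oplus>\<^bsub>L\<^esub> x) = I +>\<^bsub>L\<^esub> x" if "i \<in> I" "x \<in> carrier L" for i x
  proof -
    have "i \<oplus>\<^bsub>L\<^esub> x \<in> I +>\<^bsub>L\<^esub> x" using that mem by blast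
    then show ?thesis using M.a_repr_independence[OF _ that(2) I.a_subgroup] by simp
  qed
  have self: "x \<in> I +>\<^bsub>L\<^esub> x" if "x \<in> carrier L" for x
    using that by (rule I.a_rcos_self)
  show eq: "I +>\<^bsub>L\<^esub> x = I +>\<^bsub>L\<^esub> y \<longleftrightarrow> (\<exists>i\<in>I. x = i \<oplus>\<^bsub>L\<^esub> y)" if "x \<in> carrier L" "y \<in> carrier L" for x y
    using self[OF that(1)] mem[of x y] eqI[OF _ that(2)] by auto
  show "carrier (lie_quot L I) = (\<lambda>x. I +>\<^bsub>L\<^esub> x) ` carrier L"
    by (auto simp: lie_quot_def A_RCOSETS_def')
  show "\<zero>\<^bsub>lie_quot L I\<^esub> = I +>\<^bsub>L\<^esub> \<zero>\<^bsub>L\<^esub>"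
    by (simp add: lie_quot_def I.a_subset)
  show "(I +>\<^bsub>L\<^esub> x) \<oplus>\<^bsub>lie_quot L I\<^esub> (I +>\<^bsub>L\<^esub> y) = I +>\<^bsub>L\<^esub> (x \<oplus>\<^bsub>L\<^esub> y)"
    if "x \<in> carrier L" "y \<in> carrier L" for x y
    using that by (simp add: lie_quot_def I.a_rcos_sum)
  show "c \<odot>\<^bsub>lie_quot L I\<^esub> (I +>\<^bsub>L\<^esub> x) = I +>\<^bsub>L\<^esub> (c \<odot>\<^bsub>L\<^esub> x)" if cx: "c \<in> carrier K" "x \<in> carrier L" for c x
  proof -
    have "I +>\<^bsub>L\<^esub> (c \<odot>\<^bsub>L\<^esub> u) = I +>\<^bsub>L\<^esub> (c \<odot>\<^bsub>L\<^esub> x)" if u: "u \<in> I +>\<^bsub>L\<^esub> x" for u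
    proof -
      obtain i where i: "i \<in> I" "u = i \<oplus>\<^bsub>L\<^esub> x" using u mem by blast
      then show ?thesis
        using cx eqI[of "c \<odot>\<^bsub>L\<^esub> i"] submodule.smult_closed[OF sub] IL by (simp add: smult_r_distr)
    qed
    with self[OF cx(2)] show ?thesis
      unfolding lie_quot_def lie_algebra.simps module.simps by (intro UN_eq_const) blast+
  qed
  show "bracket (lie_quot L I) (I +>\<^bsub>L\<^esub> x) (I +>\<^bsub>L\<^esub> y) = I +>\<^bsub>L\<^esub> bracket L x y"
    if xy: "x \<in> carrier L" "y \<in> carrier L" for x y
  proof -
    have "I +>\<^bsub>L\<^esub> bracket L u v = I +>\<^bsub>L\<^esub> bracket L x y"
      if uv: "u \<in> I +>\<^bsub>L\<^esub> x" "v \<in> I +>\<^bsub>L\<^esub> y" for u v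
    proof -
      obtain i j where ij: "i \<in> I" "j \<in> I" "u = i \<oplus>\<^bsub>L\<^esub> x" "v = j \<oplus>\<^bsub>L\<^esub> y" using uv by (auto simp: mem)
      have "bracket L u v = bracket L i v \<oplus>\<^bsub>L\<^esub> (bracket L x j \<oplus>\<^bsub>L\<^esub> bracket L x y)"
        using ij xy IL bracket_add_left[of i x v] bracket_add_right[of x j y] by simp
      moreover have "bracket L i v \<in> I" "bracket L x j \<in> I"
        using br br' ij xy IL by auto
      ultimately show ?thesis using eqI xy IL bracket_closed by simp
    qed
    with self[OF xy(1)] self[OF xy(2)] show ?thesis
      unfolding lie_quot_def lie_algebra.simps module.simps by (intro UN_eq_const) blast+
  qed
qed

theorem (in lie_algebra) lie_quot_algebra:
  assumes "lie_ideal I K L"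
  shows "lie_algebra K (lie_quot L I)"
  by (rule lie_algebra_image[OF lie_algebra_axioms, where \<pi> = "\<lambda>x. I +>\<^bsub>L\<^esub> x"]) (simp_all add: lie_quot_ops[OF assms])

lemma (in lie_algebra) gen_lie_ideal:
  assumes "S \<subseteq> carrier L"
  shows "lie_ideal (gen_lie_ideal K L S) K L" and "S \<subseteq> gen_lie_ideal K L S"
proof -
  have car: "lie_ideal (carrier L) K L"
    using carrier_is_submodule by (simp add: lie_ideal_def bracket_closed)
  show "S \<subseteq> gen_lie_ideal K L S" by (auto simp: gen_lie_ideal_def)
  have sub: "submodule I K L" if "lie_ideal I K L" for I
    using that by (simp add: lie_ideal_def)
  have zero: "\<zero>\<^bsub>L\<^esub> \<in> I" if "lie_ideal I K L" for I
    using additive_subgroup.zero_closed[OF abelian_subgroup.axioms(1)[OF lie_ideal_subgroup[OF that]]] .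
  have "submodule (gen_lie_ideal K L S) K L"
    unfolding gen_lie_ideal_def
  proof (rule submoduleI)
    show "\<Inter> {I. lie_ideal I K L \<and> S \<subseteq> I} \<subseteq> carrier L" using car assms by blast
    show "\<zero>\<^bsub>L\<^esub> \<in> \<Inter> {I. lie_ideal I K L \<and> S \<subseteq> I}" using zero by blast
  qed (use submoduleE(3-5)[OF sub] in blast)+
  then show "lie_ideal (gen_lie_ideal K L S) K L"
    by (auto simp: lie_ideal_def gen_lie_ideal_def)
qed

definition presented_class :: "('k, 'r) ring_scheme \<Rightarrow> nat \<Rightarrow> 'k lie_term set set
    \<Rightarrow> 'k lie_term \<Rightarrow> 'k lie_term set set" where
  "presented_class K n R t =
    gen_lie_ideal K (free_lie K n) R +>\<^bsub>free_lie K n\<^esub> lie_class K n t"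

locale lie_presentation = field K for K :: "('k, 'r) ring_scheme" (structure) +
  fixes n :: nat and R :: "'k lie_term set set"
  assumes relations: "R \<subseteq> carrier (free_lie K n)"
begin

sublocale F: lie_algebra K "free_lie K n"
  by (rule free_lie_algebra) (rule field_axioms)

lemma ideal: "lie_ideal (gen_lie_ideal K (free_lie K n) R) K (free_lie K n)"
  by (rule F.gen_lie_ideal) (rule relations)

sublocale P: lie_algebra K "presented_lie K n R"
  unfolding presented_lie_def by (rule F.lie_quot_algebra) (rule ideal)

lemmas quot_ops = F.lie_quot_ops[OF ideal, folded presented_lie_def]

lemma presented_carrier:
  "carrier (presented_lie K n R) = presented_class K n R ` lie_terms K n"
  by (simp add: quot_ops free_lie_carrier presented_class_def image_image)

lemma presented_class_simps:
  "\<zero>\<^bsub>presented_lie K n R\<^esub> = presented_class K n R Zero"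
  "\<lbrakk>s \<in> lie_terms K n; t \<in> lie_terms K n\<rbrakk> \<Longrightarrow> presented_class K n R s \<oplus>\<^bsub>presented_lie K n R\<^esub>
     presented_class K n R t = presented_class K n R (Add s t)"
  "\<lbrakk>c \<in> carrier K; t \<in> lie_terms K n\<rbrakk> \<Longrightarrow> c \<odot>\<^bsub>presented_lie K n R\<^esub>
     presented_class K n R t = presented_class K n R (Smult c t)"
  "\<lbrakk>s \<in> lie_terms K n; t \<in> lie_terms K n\<rbrakk> \<Longrightarrow> bracket (presented_lie K n R)
     (presented_class K n R s) (presented_class K n R t) = presented_class K n R (Brk s t)"
  by (simp_all add: presented_class_def quot_ops lie_class_closed free_lie_add free_lie_smult
      free_lie_bracket free_lie_zero)

lemma presented_class_closed:
  "t \<in> lie_terms K n \<Longrightarrow> presented_class K n R t \<in> carrier (presented_lie K n R)"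
  by (simp add: presented_carrier)

lemma presented_class_relation:
  assumes "lie_class K n t \<in> R" "t \<in> lie_terms K n"
  shows "presented_class K n R t = \<zero>\<^bsub>presented_lie K n R\<^esub>"
proof -
  have "lie_class K n t \<in> gen_lie_ideal K (free_lie K n) R"
    using F.gen_lie_ideal(2)[OF relations] assms by auto
  moreover have "lie_class K n t = lie_class K n t \<oplus>\<^bsub>free_lie K n\<^esub> \<zero>\<^bsub>free_lie K n\<^esub>"
    using lie_class_closed[OF assms(2)] by simp
  ultimately show ?thesis
    unfolding quot_ops(2) presented_class_def
    by (intro quot_ops(6)[THEN iffD2, OF lie_class_closed[OF assms(2)] F.M.zero_closed] bexI)
qed

lemma presented_class_eval:
  assumes "t \<in> lie_terms K n"
  shows "lie_eval (presented_lie K n R) (\<lambda>i. presented_class K n R (Gen i)) t = presented_class K n R t"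
  using assms by induction (simp_all add: presented_class_simps)

text \<open>The universal property of a presentation. The kernel \<open>J\<close> of evaluation on
  the free algebra is an ideal containing \<open>R\<close>, hence contains the ideal generated by
  \<open>R\<close>, so the value does not depend on the representative that \<psi> chooses.\<close>

theorem presented_hom:
  assumes N: "lie_algebra K N" and \<rho>: "\<And>i. i < n \<Longrightarrow> \<rho> i \<in> carrier N"
    and R0: "\<And>t. \<lbrakk>t \<in> lie_terms K n; lie_class K n t \<in> R\<rbrakk> \<Longrightarrow> lie_eval N \<rho> t = \<zero>\<^bsub>N\<^esub>"
  obtains \<psi> where "\<psi> \<in> lie_hom K (presented_lie K n R) N"
    and "\<And>t. t \<in> lie_terms K n \<Longrightarrow> \<psi> (presented_class K n R t) = lie_eval N \<rho> t"
proof -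
  interpret N: lie_algebra K N by fact
  have cl: "lie_eval N \<rho> t \<in> carrier N" if "t \<in> lie_terms K n" for t
    using that \<rho> by (rule N.lie_eval_closed)
  define J where "J = lie_class K n ` {t \<in> lie_terms K n. lie_eval N \<rho> t = \<zero>\<^bsub>N\<^esub>}"
  have J: "lie_class K n t \<in> J \<longleftrightarrow> lie_eval N \<rho> t = \<zero>\<^bsub>N\<^esub>" if "t \<in> lie_terms K n" for t
    using that N.lie_eval_cong[OF _ \<rho>] lie_class_eq_iff by (auto simp: J_def)
  note tI = lie_terms.intros
  have "lie_ideal J K (free_lie K n)"
    unfolding lie_ideal_def
  proof
    have inv: "\<ominus>\<^bsub>free_lie K n\<^esub> a \<in> J" if a: "a \<in> J" for a
    proof -
      obtain t where t: "t \<in> lie_terms K n" "a = lie_class K n t" "lie_eval N \<rho> t = \<zero>\<^bsub>N\<^esub>"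
        using a by (auto simp: J_def)
      have "\<ominus>\<^bsub>free_lie K n\<^esub> a = (\<ominus> \<one>) \<odot>\<^bsub>free_lie K n\<^esub> a"
        using t F.smult_l_minus[of \<one> a] by (simp add: lie_class_closed)
      also have "\<dots> = lie_class K n (Smult (\<ominus> \<one>) t)" using t by (simp add: free_lie_smult)
      also have "\<dots> \<in> J" using t by (subst J) (auto intro: tI)
      finally show ?thesis .
    qed
    show "submodule J K (free_lie K n)"
      by (rule F.submoduleI)
        (auto simp: inv, auto simp: J_def free_lie_carrier free_lie_zero free_lie_add free_lie_smult
          intro!: imageI tI)
    show "\<forall>x\<in>carrier (free_lie K n). \<forall>y\<in>J. bracket (free_lie K n) x y \<in> J"
      by (auto simp: J_def free_lie_carrier free_lie_bracket cl intro!: imageI tI)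
  qed
  moreover have "R \<subseteq> J"
    using relations R0 by (auto simp: free_lie_carrier J_def)
  ultimately have IJ: "gen_lie_ideal K (free_lie K n) R \<subseteq> J"
    by (auto simp: gen_lie_ideal_def)
  have eq: "lie_eval N \<rho> s = lie_eval N \<rho> t"
    if st: "s \<in> lie_terms K n" "t \<in> lie_terms K n" "presented_class K n R s = presented_class K n R t" for s t
  proof -
    obtain i where i: "i \<in> gen_lie_ideal K (free_lie K n) R"
      "lie_class K n s = i \<oplus>\<^bsub>free_lie K n\<^esub> lie_class K n t"
      using st quot_ops(6)[of "lie_class K n s" "lie_class K n t"]
      by (auto simp: presented_class_def lie_class_closed)
    obtain u where u: "u \<in> lie_terms K n" "i = lie_class K n u" "lie_eval N \<rho> u = \<zero>\<^bsub>N\<^esub>"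
      using i IJ by (auto simp: J_def)
    have "lie_class K n s = lie_class K n (Add u t)" using i u st by (simp add: free_lie_add)
    then have "(s, Add u t) \<in> lie_cong K n" using st u by (simp add: lie_class_eq_iff tI)
    then show ?thesis using N.lie_eval_cong[OF _ \<rho>, of s "Add u t"] u cl st by simp
  qed
  define \<psi> where "\<psi> A = lie_eval N \<rho> (SOME t. t \<in> lie_terms K n \<and> A = presented_class K n R t)" for A
  have \<psi>: "\<psi> (presented_class K n R t) = lie_eval N \<rho> t" if "t \<in> lie_terms K n" for t
    unfolding \<psi>_def by (rule someI2[of _ t], use that in simp, rule eq) (use that in auto)
  have "\<psi> \<in> lie_hom K (presented_lie K n R) N"
    by (rule lie_homI) (auto simp: presented_carrier presented_class_simps \<psi> cl tI)
  with \<psi> show ?thesis using that by blast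
qed

end


section \<open>A Lie algebra in which prescribed elements are Lie monomials\<close>

text \<open>Rewriting rules that pull differences outwards and then move them across the equation,
  so that \<open>a_ac\<close> settles identities with subtraction.\<close>

lemma (in abelian_group) diff_simps:
  assumes "a \<in> carrier G" "b \<in> carrier G" "c \<in> carrier G"
  shows "(a \<ominus> b) \<oplus> c = (a \<oplus> c) \<ominus> b" "c \<oplus> (a \<ominus> b) = (c \<oplus> a) \<ominus> b"
    "(a \<ominus> b) \<ominus> c = a \<ominus> (b \<oplus> c)" "a \<ominus> (b \<ominus> c) = (a \<oplus> c) \<ominus> b"
    "a \<ominus> b = c \<longleftrightarrow> a = c \<oplus> b" "c = a \<ominus> b \<longleftrightarrow> c \<oplus> b = a"
proof -
  have eq: "a \<ominus> b = c \<longleftrightarrow> a = c \<oplus> b"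
  proof
    assume "a \<ominus> b = c"
    then have "c \<oplus> b = a \<oplus> (\<ominus> b \<oplus> b)" using assms by (simp add: a_minus_def a_assoc flip: \<open>a \<ominus> b = c\<close>)
    then show "a = c \<oplus> b" using assms by (simp add: l_neg)
  next
    assume "a = c \<oplus> b"
    then show "a \<ominus> b = c" using assms by (simp add: a_minus_def a_assoc r_neg)
  qed
  then show "a \<ominus> b = c \<longleftrightarrow> a = c \<oplus> b" "c = a \<ominus> b \<longleftrightarrow> c \<oplus> b = a" by auto
qed (use assms in \<open>simp_all add: a_minus_def a_ac minus_add\<close>)

context lie_algebra
begin

lemma bracket_diff_left:
  assumes "x \<in> carrier L" "y \<in> carrier L" "z \<in> carrier L"
  shows "bracket L (x \<ominus>\<^bsub>L\<^esub> y) z = bracket L x z \<ominus>\<^bsub>L\<^esub> bracket L y z"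
  using assms by (simp add: a_minus_def bracket_add_left bracket_minus_left)

lemma bracket_diff_right:
  assumes "x \<in> carrier L" "y \<in> carrier L" "z \<in> carrier L"
  shows "bracket L z (x \<ominus>\<^bsub>L\<^esub> y) = bracket L z x \<ominus>\<^bsub>L\<^esub> bracket L z y"
  using assms by (simp add: a_minus_def bracket_add_right bracket_minus_right)

lemma smult_diff:
  assumes "c \<in> carrier K" "x \<in> carrier L" "y \<in> carrier L"
  shows "c \<odot>\<^bsub>L\<^esub> (x \<ominus>\<^bsub>L\<^esub> y) = c \<odot>\<^bsub>L\<^esub> x \<ominus>\<^bsub>L\<^esub> c \<odot>\<^bsub>L\<^esub> y"
  using assms by (simp add: a_minus_def smult_r_distr smult_r_minus)

end

subsection \<open>Functions on words\<close>

text \<open>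
  The bracket for which all the maps \<open>F \<mapsto> (\<lambda>w. F (a # w))\<close> are derivations, and evaluation at
  the empty word is a homomorphism.
\<close>

primrec word_bracket :: "('k, 'a, 'm) lie_algebra_scheme \<Rightarrow> nat list
    \<Rightarrow> (nat list \<Rightarrow> 'a) \<Rightarrow> (nat list \<Rightarrow> 'a) \<Rightarrow> 'a" where
  "word_bracket L [] F G = bracket L (F []) (G [])"
| "word_bracket L (a # w) F G =
    word_bracket L w (\<lambda>u. F (a # u)) G \<oplus>\<^bsub>L\<^esub> word_bracket L w F (\<lambda>u. G (a # u))"

definition word_lie :: "('k, 'a, 'm) lie_algebra_scheme \<Rightarrow> ('k, nat list \<Rightarrow> 'a) lie_algebra" where
  "word_lie L = \<lparr>carrier = {F. \<forall>w. F w \<in> carrier L}, monoid.mult = undefined, one = undefined,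
     ring.zero = (\<lambda>w. \<zero>\<^bsub>L\<^esub>), ring.add = (\<lambda>F G w. F w \<oplus>\<^bsub>L\<^esub> G w),
     module.smult = (\<lambda>c F w. c \<odot>\<^bsub>L\<^esub> F w), bracket = (\<lambda>F G w. word_bracket L w F G)\<rparr>"

context lie_algebra
begin

lemma word_bracket_closed:
  "\<lbrakk>\<forall>w. F w \<in> carrier L; \<forall>w. G w \<in> carrier L\<rbrakk> \<Longrightarrow> word_bracket L w F G \<in> carrier L"
  by (induction w arbitrary: F G) (simp_all add: bracket_closed)

lemma word_bracket_add_left:
  "\<lbrakk>\<forall>w. F w \<in> carrier L; \<forall>w. G w \<in> carrier L; \<forall>w. H w \<in> carrier L\<rbrakk> \<Longrightarrow>
    word_bracket L w (\<lambda>w. F w \<oplus>\<^bsub>L\<^esub> G w) H = word_bracket L w F H \<oplus>\<^bsub>L\<^esub> word_bracket L w G H"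
proof (induction w arbitrary: F G H)
  case (Cons a w)
  note cl = word_bracket_closed[of _ _ w]
  show ?case
    using Cons.prems Cons.IH[of "\<lambda>u. F (a # u)" "\<lambda>u. G (a # u)" H]
      Cons.IH[of F G "\<lambda>u. H (a # u)"]
    by (simp add: cl M.a_ac)
qed (simp add: bracket_add_left)

lemma word_bracket_antisym:
  "\<lbrakk>\<forall>w. F w \<in> carrier L; \<forall>w. G w \<in> carrier L\<rbrakk> \<Longrightarrow>
    word_bracket L w G F = \<ominus>\<^bsub>L\<^esub> word_bracket L w F G"
proof (induction w arbitrary: F G)
  case Nil
  then show ?case using bracket_antisym[of "F []" "G []"] by simp
next
  case (Cons a w)
  note cl = word_bracket_closed[of _ _ w]
  show ?case
    using Cons.prems Cons.IH[of "\<lambda>u. F (a # u)" G] Cons.IH[of F "\<lambda>u. G (a # u)"]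
    by (simp add: cl M.minus_add M.a_comm)
qed

lemma word_bracket_add_right:
  assumes "\<forall>w. F w \<in> carrier L" "\<forall>w. G w \<in> carrier L" "\<forall>w. H w \<in> carrier L"
  shows "word_bracket L w H (\<lambda>w. F w \<oplus>\<^bsub>L\<^esub> G w) = word_bracket L w H F \<oplus>\<^bsub>L\<^esub> word_bracket L w H G"
  using word_bracket_antisym[of "\<lambda>w. F w \<oplus>\<^bsub>L\<^esub> G w" H w] word_bracket_antisym[of F H w]
    word_bracket_antisym[of G H w] word_bracket_add_left[of F G H w] assms
  by (simp add: word_bracket_closed M.minus_add)

lemma word_bracket_smult_left:
  "\<lbrakk>c \<in> carrier K; \<forall>w. F w \<in> carrier L; \<forall>w. G w \<in> carrier L\<rbrakk> \<Longrightarrow>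
    word_bracket L w (\<lambda>w. c \<odot>\<^bsub>L\<^esub> F w) G = c \<odot>\<^bsub>L\<^esub> word_bracket L w F G"
  by (induction w arbitrary: F G) (simp_all add: bracket_smult_left word_bracket_closed smult_r_distr)

lemma word_bracket_smult_right:
  "\<lbrakk>c \<in> carrier K; \<forall>w. F w \<in> carrier L; \<forall>w. G w \<in> carrier L\<rbrakk> \<Longrightarrow>
    word_bracket L w F (\<lambda>w. c \<odot>\<^bsub>L\<^esub> G w) = c \<odot>\<^bsub>L\<^esub> word_bracket L w F G"
  by (induction w arbitrary: F G) (simp_all add: bracket_smult_right word_bracket_closed smult_r_distr)

text \<open>Antisymmetry would not give this in characteristic 2. At the empty word it is the axiom
  of \<open>L\<close>; at a longer word the two Leibniz terms are negatives of each other.\<close>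

lemma word_bracket_self:
  assumes "\<forall>w. F w \<in> carrier L"
  shows "word_bracket L w F F = \<zero>\<^bsub>L\<^esub>"
proof (cases w)
  case Nil
  then show ?thesis using assms by (simp add: bracket_self)
next
  case (Cons a v)
  then show ?thesis
    using assms word_bracket_antisym[of "\<lambda>u. F (a # u)" F v]
    by (simp add: word_bracket_closed M.r_neg)
qed

text \<open>Removing the first letter is a derivation, so the identity at \<open>a # w\<close> is
  the sum of three Jacobi identities at \<open>w\<close>, with one of the three functions shifted in
  each.\<close>

lemma word_bracket_jacobi:
  "\<lbrakk>\<forall>w. F w \<in> carrier L; \<forall>w. G w \<in> carrier L; \<forall>w. H w \<in> carrier L\<rbrakk> \<Longrightarrow>
    word_bracket L w F (\<lambda>u. word_bracket L u G H) \<oplus>\<^bsub>L\<^esub>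
    (word_bracket L w G (\<lambda>u. word_bracket L u H F) \<oplus>\<^bsub>L\<^esub>
     word_bracket L w H (\<lambda>u. word_bracket L u F G)) = \<zero>\<^bsub>L\<^esub>"
proof (induction w arbitrary: F G H)
  case Nil
  then show ?case by (simp add: jacobi)
next
  case (Cons a w)
  let ?d = "\<lambda>F u. F (a # u)"
  note cl = word_bracket_closed
  define B where "B F G H = word_bracket L w F (\<lambda>u. word_bracket L u G H)" for F G H
  have Bcl: "B F G H \<in> carrier L"
    if "\<forall>w. F w \<in> carrier L" "\<forall>w. G w \<in> carrier L" "\<forall>w. H w \<in> carrier L" for F G H
    using that by (simp add: B_def cl)
  have expand: "word_bracket L (a # w) F (\<lambda>u. word_bracket L u G H)
      = B (?d F) G H \<oplus>\<^bsub>L\<^esub> (B F (?d G) H \<oplus>\<^bsub>L\<^esub> B F G (?d H))"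
    if "\<forall>w. F w \<in> carrier L" "\<forall>w. G w \<in> carrier L" "\<forall>w. H w \<in> carrier L" for F G H
    using that by (simp add: B_def cl word_bracket_add_right)
  have J: "B F G H \<oplus>\<^bsub>L\<^esub> (B G H F \<oplus>\<^bsub>L\<^esub> B H F G) = \<zero>\<^bsub>L\<^esub>"
    if "\<forall>w. F w \<in> carrier L" "\<forall>w. G w \<in> carrier L" "\<forall>w. H w \<in> carrier L" for F G H
    unfolding B_def using that by (rule Cons.IH)
  \<comment> \<open>The nine Leibniz terms are sorted by which of the three functions carries the
    shift.\<close>
  have regroup: "(a1 \<oplus>\<^bsub>L\<^esub> (a2 \<oplus>\<^bsub>L\<^esub> a3)) \<oplus>\<^bsub>L\<^esub> ((b1 \<oplus>\<^bsub>L\<^esub> (b2 \<oplus>\<^bsub>L\<^esub> b3)) \<oplus>\<^bsub>L\<^esub> (c1 \<oplus>\<^bsub>L\<^esub> (c2 \<oplus>\<^bsub>L\<^esub> c3)))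
      = \<zero>\<^bsub>L\<^esub>"
    if "a1 \<oplus>\<^bsub>L\<^esub> (b3 \<oplus>\<^bsub>L\<^esub> c2) = \<zero>\<^bsub>L\<^esub>" "a2 \<oplus>\<^bsub>L\<^esub> (b1 \<oplus>\<^bsub>L\<^esub> c3) = \<zero>\<^bsub>L\<^esub>" "a3 \<oplus>\<^bsub>L\<^esub> (b2 \<oplus>\<^bsub>L\<^esub> c1) = \<zero>\<^bsub>L\<^esub>"
      and "a1 \<in> carrier L" "a2 \<in> carrier L" "a3 \<in> carrier L" "b1 \<in> carrier L" "b2 \<in> carrier L"
        "b3 \<in> carrier L" "c1 \<in> carrier L" "c2 \<in> carrier L" "c3 \<in> carrier L"
    for a1 a2 a3 b1 b2 b3 c1 c2 c3
  proof -
    have "(a1 \<oplus>\<^bsub>L\<^esub> (a2 \<oplus>\<^bsub>L\<^esub> a3)) \<oplus>\<^bsub>L\<^esub> ((b1 \<oplus>\<^bsub>L\<^esub> (b2 \<oplus>\<^bsub>L\<^esub> b3)) \<oplus>\<^bsub>L\<^esub> (c1 \<oplus>\<^bsub>L\<^esub> (c2 \<oplus>\<^bsub>L\<^esub> c3)))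
      = (a1 \<oplus>\<^bsub>L\<^esub> (b3 \<oplus>\<^bsub>L\<^esub> c2)) \<oplus>\<^bsub>L\<^esub> ((a2 \<oplus>\<^bsub>L\<^esub> (b1 \<oplus>\<^bsub>L\<^esub> c3)) \<oplus>\<^bsub>L\<^esub> (a3 \<oplus>\<^bsub>L\<^esub> (b2 \<oplus>\<^bsub>L\<^esub> c1)))"
      using that(4-) by (simp add: M.a_ac)
    then show ?thesis by (simp add: that(1-3))
  qed
  show ?case
    unfolding expand[OF Cons.prems] expand[OF Cons.prems(2,3,1)] expand[OF Cons.prems(3,1,2)]
    by (rule regroup) (use Cons.prems J Bcl in auto)
qed

theorem word_lie_algebra: "lie_algebra K (word_lie L)"
proof -
  have ab: "abelian_group (word_lie L)"
  proof (rule abelian_groupI)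
    fix F assume F: "F \<in> carrier (word_lie L)"
    show "\<exists>G\<in>carrier (word_lie L). G \<oplus>\<^bsub>word_lie L\<^esub> F = \<zero>\<^bsub>word_lie L\<^esub>"
      by (rule bexI[of _ "\<lambda>w. \<ominus>\<^bsub>L\<^esub> F w"]) (use F in \<open>auto simp: word_lie_def M.l_neg\<close>)
  next
    fix F G assume "F \<in> carrier (word_lie L)" "G \<in> carrier (word_lie L)"
    then show "F \<oplus>\<^bsub>word_lie L\<^esub> G = G \<oplus>\<^bsub>word_lie L\<^esub> F"
      by (simp add: word_lie_def M.a_comm)
  qed (auto simp: word_lie_def M.a_assoc)
  have ax: "lie_algebra_axioms K (word_lie L)"
    by unfold_locales (simp_all add: word_lie_def word_bracket_closed word_bracket_add_left
      word_bracket_add_right word_bracket_smult_left word_bracket_smult_right word_bracket_self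
      word_bracket_jacobi)
  show ?thesis
    by (rule lie_algebraI[OF K.field_axioms ab _ _ _ _ _ ax])
      (simp_all add: word_lie_def smult_l_distr smult_r_distr smult_assoc1)
qed

end

subsection \<open>The semidirect product with the derivations\<close>

text \<open>Derivations are normalised to vanish off the carrier, so that equality is extensional.\<close>

definition lie_derivations :: "('k, 'r) ring_scheme \<Rightarrow> ('k, 'a, 'm) lie_algebra_scheme \<Rightarrow> ('a \<Rightarrow> 'a) set"
  where "lie_derivations K L = {D.
    (\<forall>x. D x \<in> carrier L) \<and> (\<forall>x. x \<notin> carrier L \<longrightarrow> D x = \<zero>\<^bsub>L\<^esub>) \<and>
    (\<forall>x\<in>carrier L. \<forall>y\<in>carrier L. D (x \<oplus>\<^bsub>L\<^esub> y) = D x \<oplus>\<^bsub>L\<^esub> D y) \<and>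
    (\<forall>c\<in>carrier K. \<forall>x\<in>carrier L. D (c \<odot>\<^bsub>L\<^esub> x) = c \<odot>\<^bsub>L\<^esub> D x) \<and>
    (\<forall>x\<in>carrier L. \<forall>y\<in>carrier L. D (bracket L x y) = bracket L (D x) y \<oplus>\<^bsub>L\<^esub> bracket L x (D y))}"

definition lie_holomorph :: "('k, 'r) ring_scheme \<Rightarrow> ('k, 'a, 'm) lie_algebra_scheme
    \<Rightarrow> ('k, 'a \<times> ('a \<Rightarrow> 'a)) lie_algebra" where
  "lie_holomorph K L = \<lparr>carrier = carrier L \<times> lie_derivations K L, monoid.mult = undefined,
     one = undefined, ring.zero = (\<zero>\<^bsub>L\<^esub>, \<lambda>u. \<zero>\<^bsub>L\<^esub>),
     ring.add = (\<lambda>U V. (fst U \<oplus>\<^bsub>L\<^esub> fst V, \<lambda>u. snd U u \<oplus>\<^bsub>L\<^esub> snd V u)),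
     module.smult = (\<lambda>c U. (c \<odot>\<^bsub>L\<^esub> fst U, \<lambda>u. c \<odot>\<^bsub>L\<^esub> snd U u)),
     bracket = (\<lambda>U V. (bracket L (fst U) (fst V) \<oplus>\<^bsub>L\<^esub> (snd U (fst V) \<ominus>\<^bsub>L\<^esub> snd V (fst U)),
        \<lambda>u. snd U (snd V u) \<ominus>\<^bsub>L\<^esub> snd V (snd U u)))\<rparr>"

context lie_algebra
begin

lemma derivationD:
  assumes "D \<in> lie_derivations K L"
  shows "D x \<in> carrier L" "x \<notin> carrier L \<Longrightarrow> D x = \<zero>\<^bsub>L\<^esub>"
    "\<lbrakk>x \<in> carrier L; y \<in> carrier L\<rbrakk> \<Longrightarrow> D (x \<oplus>\<^bsub>L\<^esub> y) = D x \<oplus>\<^bsub>L\<^esub> D y"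
    "\<lbrakk>c \<in> carrier K; x \<in> carrier L\<rbrakk> \<Longrightarrow> D (c \<odot>\<^bsub>L\<^esub> x) = c \<odot>\<^bsub>L\<^esub> D x"
    "\<lbrakk>x \<in> carrier L; y \<in> carrier L\<rbrakk> \<Longrightarrow> D (bracket L x y) = bracket L (D x) y \<oplus>\<^bsub>L\<^esub> bracket L x (D y)"
  using assms by (auto simp: lie_derivations_def)

lemma derivation_zero: "D \<in> lie_derivations K L \<Longrightarrow> D \<zero>\<^bsub>L\<^esub> = \<zero>\<^bsub>L\<^esub>"
  using derivationD(4)[of D "\<zero>\<^bsub>K\<^esub>" "\<zero>\<^bsub>L\<^esub>"] derivationD(1)[of D "\<zero>\<^bsub>L\<^esub>"] by simp

lemma derivation_diff:
  assumes "D \<in> lie_derivations K L" "x \<in> carrier L" "y \<in> carrier L"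
  shows "D (x \<ominus>\<^bsub>L\<^esub> y) = D x \<ominus>\<^bsub>L\<^esub> D y"
proof -
  have "D ((x \<ominus>\<^bsub>L\<^esub> y) \<oplus>\<^bsub>L\<^esub> y) = D (x \<ominus>\<^bsub>L\<^esub> y) \<oplus>\<^bsub>L\<^esub> D y"
    by (rule derivationD(3)[OF assms(1)]) (use assms in auto)
  moreover have "(x \<ominus>\<^bsub>L\<^esub> y) \<oplus>\<^bsub>L\<^esub> y = x"
    using assms by (simp add: a_minus_def M.a_assoc M.l_neg)
  ultimately show ?thesis
    using assms derivationD(1)[OF assms(1)] by (simp add: M.diff_simps)
qed

lemma zero_derivation: "(\<lambda>u. \<zero>\<^bsub>L\<^esub>) \<in> lie_derivations K L"
  by (simp add: lie_derivations_def)

lemma derivation_add: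
  assumes "D \<in> lie_derivations K L" "E \<in> lie_derivations K L"
  shows "(\<lambda>u. D u \<oplus>\<^bsub>L\<^esub> E u) \<in> lie_derivations K L"
  unfolding lie_derivations_def using assms
  by (auto simp: derivationD bracket_closed smult_r_distr bracket_add_left bracket_add_right M.a_ac)

lemma derivation_smult:
  assumes "D \<in> lie_derivations K L" "c \<in> carrier K"
  shows "(\<lambda>u. c \<odot>\<^bsub>L\<^esub> D u) \<in> lie_derivations K L"
proof -
  have "c \<odot>\<^bsub>L\<^esub> (d \<odot>\<^bsub>L\<^esub> x) = d \<odot>\<^bsub>L\<^esub> (c \<odot>\<^bsub>L\<^esub> x)" if "d \<in> carrier K" "x \<in> carrier L" for d x
    using that assms(2) by (simp flip: smult_assoc1 add: K.m_comm)
  then show ?thesis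
    unfolding lie_derivations_def using assms
    by (auto simp: derivationD bracket_closed smult_r_distr bracket_smult_left bracket_smult_right)
qed

lemma derivation_commutator:
  assumes "D \<in> lie_derivations K L" "E \<in> lie_derivations K L"
  shows "(\<lambda>u. D (E u) \<ominus>\<^bsub>L\<^esub> E (D u)) \<in> lie_derivations K L"
  unfolding lie_derivations_def mem_Collect_eq
proof (intro conjI allI ballI impI)
  note [simp] = derivationD[OF assms(1)] derivationD[OF assms(2)] derivation_zero assms
  fix x
  show "D (E x) \<ominus>\<^bsub>L\<^esub> E (D x) \<in> carrier L" by simp
  show "D (E x) \<ominus>\<^bsub>L\<^esub> E (D x) = \<zero>\<^bsub>L\<^esub>" if "x \<notin> carrier L"
    using that by (simp add: M.diff_simps)
  fix y assume xy: "x \<in> carrier L" "y \<in> carrier L"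
  show "D (E (x \<oplus>\<^bsub>L\<^esub> y)) \<ominus>\<^bsub>L\<^esub> E (D (x \<oplus>\<^bsub>L\<^esub> y)) =
      D (E x) \<ominus>\<^bsub>L\<^esub> E (D x) \<oplus>\<^bsub>L\<^esub> (D (E y) \<ominus>\<^bsub>L\<^esub> E (D y))"
    using xy by (simp add: M.diff_simps M.a_ac)
  show "D (E (bracket L x y)) \<ominus>\<^bsub>L\<^esub> E (D (bracket L x y)) =
      bracket L (D (E x) \<ominus>\<^bsub>L\<^esub> E (D x)) y \<oplus>\<^bsub>L\<^esub> bracket L x (D (E y) \<ominus>\<^bsub>L\<^esub> E (D y))"
    using xy by (simp add: bracket_diff_left bracket_diff_right bracket_closed M.diff_simps M.a_ac)
next
  note [simp] = derivationD[OF assms(1)] derivationD[OF assms(2)]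
  fix c x assume "c \<in> carrier K" "x \<in> carrier L"
  then show "D (E (c \<odot>\<^bsub>L\<^esub> x)) \<ominus>\<^bsub>L\<^esub> E (D (c \<odot>\<^bsub>L\<^esub> x)) = c \<odot>\<^bsub>L\<^esub> (D (E x) \<ominus>\<^bsub>L\<^esub> E (D x))"
    by (simp add: smult_diff)
qed

text \<open>\<open>A\<close> is the \<open>L\<close>-component of a double bracket in the semidirect
  product. Summed cyclically, the terms with derivations cancel in pairs and the Jacobi identity of
  \<open>L\<close> is left.\<close>

lemma holomorph_jacobi:
  assumes D: "D1 \<in> lie_derivations K L" "D2 \<in> lie_derivations K L" "D3 \<in> lie_derivations K L"
    and x: "x1 \<in> carrier L" "x2 \<in> carrier L" "x3 \<in> carrier L"
  defines "A \<equiv> \<lambda>x1 x2 x3 D1 D2 D3. bracket L x1 (bracket L x2 x3 \<oplus>\<^bsub>L\<^esub> (D2 x3 \<ominus>\<^bsub>L\<^esub> D3 x2)) \<oplus>\<^bsub>L\<^esub>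
      (D1 (bracket L x2 x3 \<oplus>\<^bsub>L\<^esub> (D2 x3 \<ominus>\<^bsub>L\<^esub> D3 x2)) \<ominus>\<^bsub>L\<^esub> (D2 (D3 x1) \<ominus>\<^bsub>L\<^esub> D3 (D2 x1)))"
  shows "A x1 x2 x3 D1 D2 D3 \<oplus>\<^bsub>L\<^esub> (A x2 x3 x1 D2 D3 D1 \<oplus>\<^bsub>L\<^esub> A x3 x1 x2 D3 D1 D2) = \<zero>\<^bsub>L\<^esub>"
proof -
  \<comment> \<open>The Leibniz rule with every derivative in the second argument, so that terms
    which cancel become syntactically equal.\<close>
  have leibniz: "D (bracket L x y) = bracket L x (D y) \<ominus>\<^bsub>L\<^esub> bracket L y (D x)"
    if "D \<in> lie_derivations K L" "x \<in> carrier L" "y \<in> carrier L" for D x y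
    using that derivationD(1,5)[OF that(1)] bracket_antisym[of y "D x"]
    by (simp add: a_minus_def bracket_closed M.a_comm)
  note cl = bracket_closed derivationD(1)[OF D(1)] derivationD(1)[OF D(2)] derivationD(1)[OF D(3)]
  have A: "A x y z D E F = (bracket L x (bracket L y z) \<oplus>\<^bsub>L\<^esub> (bracket L x (E z) \<oplus>\<^bsub>L\<^esub> (bracket L y (D z)
        \<oplus>\<^bsub>L\<^esub> (D (E z) \<oplus>\<^bsub>L\<^esub> F (E x))))) \<ominus>\<^bsub>L\<^esub> (bracket L x (F y) \<oplus>\<^bsub>L\<^esub> (bracket L z (D y) \<oplus>\<^bsub>L\<^esub> (D (F y) \<oplus>\<^bsub>L\<^esub> E (F x))))"
    if "D \<in> lie_derivations K L" "E \<in> lie_derivations K L" "F \<in> lie_derivations K L"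
      "x \<in> carrier L" "y \<in> carrier L" "z \<in> carrier L" for x y z D E F
    using that unfolding A_def
    by (simp add: leibniz derivation_diff derivationD(1,3) bracket_closed bracket_add_right
        bracket_diff_right M.diff_simps M.a_ac)
  \<comment> \<open>Solved for one term, the Jacobi identity becomes a rewrite rule, and what
    remains is an identity in an abelian group.\<close>
  have J: "bracket L x1 (bracket L x2 x3) = \<zero>\<^bsub>L\<^esub> \<ominus>\<^bsub>L\<^esub> (bracket L x2 (bracket L x3 x1) \<oplus>\<^bsub>L\<^esub> bracket L x3 (bracket L x1 x2))"
    using jacobi[OF x] x by (simp add: M.diff_simps bracket_closed)
  show ?thesis
    unfolding A[OF D x] A[OF D(2,3,1) x(2,3,1)] A[OF D(3,1,2) x(3,1,2)] J
    using x by (simp add: cl M.diff_simps M.a_ac)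
qed

theorem holomorph_algebra: "lie_algebra K (lie_holomorph K L)"
proof -
  note ders = derivation_add derivation_smult derivation_commutator zero_derivation
  note [simp] = derivationD(1)
  have ab: "abelian_group (lie_holomorph K L)"
  proof (rule abelian_groupI)
    fix U assume U: "U \<in> carrier (lie_holomorph K L)"
    then have D: "snd U \<in> lie_derivations K L" "fst U \<in> carrier L" by (auto simp: lie_holomorph_def)
    show "\<exists>V\<in>carrier (lie_holomorph K L). V \<oplus>\<^bsub>lie_holomorph K L\<^esub> U = \<zero>\<^bsub>lie_holomorph K L\<^esub>"
      by (rule bexI[of _ "((\<ominus>\<^bsub>K\<^esub> \<one>\<^bsub>K\<^esub>) \<odot>\<^bsub>L\<^esub> fst U, \<lambda>u. (\<ominus>\<^bsub>K\<^esub> \<one>\<^bsub>K\<^esub>) \<odot>\<^bsub>L\<^esub> snd U u)"])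
        (use D derivation_smult[OF D(1), of "\<ominus>\<^bsub>K\<^esub> \<one>\<^bsub>K\<^esub>"] in \<open>auto simp: lie_holomorph_def smult_l_minus M.l_neg\<close>)
  next
    fix U V assume "U \<in> carrier (lie_holomorph K L)" "V \<in> carrier (lie_holomorph K L)"
    then show "U \<oplus>\<^bsub>lie_holomorph K L\<^esub> V = V \<oplus>\<^bsub>lie_holomorph K L\<^esub> U"
      by (auto simp: lie_holomorph_def M.a_comm)
  qed (auto simp: lie_holomorph_def ders M.a_assoc)
  have ax: "lie_algebra_axioms K (lie_holomorph K L)"
  proof (unfold_locales, goal_cases)
    \<comment> \<open>Goal 7 is the Jacobi identity, goal 6 the vanishing of
      \<open>[U, U]\<close>.\<close>
    case (7 U V W)
    obtain x D y E z F where UVW: "U = (x, D)" "V = (y, E)" "W = (z, F)"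
      by (cases U; cases V; cases W)
    have mem: "x \<in> carrier L" "y \<in> carrier L" "z \<in> carrier L" "D \<in> lie_derivations K L"
      "E \<in> lie_derivations K L" "F \<in> lie_derivations K L"
      using 7 by (auto simp: UVW lie_holomorph_def)
    have "D (E (F u) \<ominus>\<^bsub>L\<^esub> F (E u)) \<ominus>\<^bsub>L\<^esub> (E (F (D u)) \<ominus>\<^bsub>L\<^esub> F (E (D u))) \<oplus>\<^bsub>L\<^esub>
        (E (F (D u) \<ominus>\<^bsub>L\<^esub> D (F u)) \<ominus>\<^bsub>L\<^esub> (F (D (E u)) \<ominus>\<^bsub>L\<^esub> D (F (E u))) \<oplus>\<^bsub>L\<^esub>
        (F (D (E u) \<ominus>\<^bsub>L\<^esub> E (D u)) \<ominus>\<^bsub>L\<^esub> (D (E (F u)) \<ominus>\<^bsub>L\<^esub> E (D (F u))))) = \<zero>\<^bsub>L\<^esub>" for u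
      using mem by (simp add: derivation_diff M.diff_simps M.a_ac)
    then show ?case
      using holomorph_jacobi[OF mem(4-6,1-3)] by (simp add: lie_holomorph_def UVW)
  next
    case (6 U)
    then show ?case by (auto simp: lie_holomorph_def bracket_self M.diff_simps)
  qed (auto simp: lie_holomorph_def ders derivationD(3,4) bracket_closed bracket_add_left bracket_add_right
      bracket_smult_left bracket_smult_right smult_r_distr smult_diff M.diff_simps M.a_ac)
  show ?thesis
    by (rule lie_algebraI[OF K.field_axioms ab _ _ _ _ _ ax])
      (auto simp: lie_holomorph_def ders smult_l_distr smult_r_distr smult_assoc1)
qed

end


subsection \<open>The model\<close>

definition letter :: "('k, 'a, 'm) lie_algebra_scheme \<Rightarrow> nat \<Rightarrow> (nat list \<Rightarrow> 'a) \<Rightarrow> nat list \<Rightarrow> 'a" where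
  "letter L a F = (if \<forall>w. F w \<in> carrier L then (\<lambda>w. F (a # w)) else (\<lambda>w. \<zero>\<^bsub>L\<^esub>))"

lemma (in lie_algebra) letter_derivation: "letter L a \<in> lie_derivations K (word_lie L)"
  by (auto simp: lie_derivations_def letter_def word_lie_def word_bracket_closed)

primrec iter_bracket :: "('k, 'a, 'm) lie_algebra_scheme \<Rightarrow> 'a \<Rightarrow> 'a \<Rightarrow> nat \<Rightarrow> 'a" where
  "iter_bracket L b f 0 = f"
| "iter_bracket L b f (Suc i) = bracket L b (iter_bracket L b f i)"

text \<open>The first letter other than \<open>b\<close> on the left is \<open>a\<close>, at
  position \<open>i\<close>; on the right only the last letter can differ from \<open>b\<close>.
  This separates the words on which the function of the model is supported.\<close>

lemma replicate_snoc_eq: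
  assumes "a \<noteq> b"
  shows "replicate i b @ a # w = replicate m b @ [c] \<longleftrightarrow> w = [] \<and> m = i \<and> a = c"
proof
  assume eq: "replicate i b @ a # w = replicate m b @ [c]"
  then have len: "m = i + length w" by (metis Suc_eq_plus1 add_Suc_right length_Cons length_append
      length_replicate list.size(3) nat.inject add.right_neutral)
  have "(replicate i b @ a # w) ! i = a" by (simp add: nth_append)
  moreover have "(replicate m b @ [c]) ! i = b" if "i < m" using that by (simp add: nth_append)
  ultimately have "\<not> i < m" using eq assms by auto
  then show "w = [] \<and> m = i \<and> a = c" using len eq by auto
qed simp

theorem (in lie_algebra) prescribed_monomials:
  assumes s: "\<And>i. s i \<in> carrier L" and t: "\<And>i. t i \<in> carrier L"
  obtains N :: "('a, (nat list \<Rightarrow> 'b) \<times> ((nat list \<Rightarrow> 'b) \<Rightarrow> nat list \<Rightarrow> 'b)) lie_algebra"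
    and \<alpha> \<beta> b f c
  where "lie_algebra K N" "\<alpha> \<in> carrier N" "\<beta> \<in> carrier N" "b \<in> carrier N" "f \<in> carrier N"
    "c \<in> lie_hom K L N" "inj_on c (carrier L)"
    "\<And>i. bracket N \<alpha> (iter_bracket N b f i) = c (s i)"
    "\<And>i. bracket N \<beta> (iter_bracket N b f i) = c (t i)"
proof -
  interpret G: lie_algebra K "word_lie L" by (rule word_lie_algebra)
  have ops: "carrier (word_lie L) = {F. \<forall>w. F w \<in> carrier L}" "\<zero>\<^bsub>word_lie L\<^esub> = (\<lambda>w. \<zero>\<^bsub>L\<^esub>)"
    "F \<oplus>\<^bsub>word_lie L\<^esub> G = (\<lambda>w. F w \<oplus>\<^bsub>L\<^esub> G w)" "c \<odot>\<^bsub>word_lie L\<^esub> F = (\<lambda>w. c \<odot>\<^bsub>L\<^esub> F w)"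
    "bracket (word_lie L) F G = (\<lambda>w. word_bracket L w F G)" for F G c
    by (simp_all add: word_lie_def)
  have minus_zero: "F \<ominus>\<^bsub>word_lie L\<^esub> (\<lambda>w. \<zero>\<^bsub>L\<^esub>) = F" if "\<forall>w. F w \<in> carrier L" for F
  proof -
    have "F \<in> carrier (word_lie L)" using that by (simp add: ops)
    then show ?thesis
      using G.M.diff_simps(5)[of F "\<zero>\<^bsub>word_lie L\<^esub>" F] G.M.r_zero[of F] G.M.zero_closed
      by (simp only: simp_thms flip: ops(2))
  qed
  define N where "N = lie_holomorph K (word_lie L)"
  interpret N: lie_algebra K N unfolding N_def by (rule G.holomorph_algebra)
  let ?z = "\<lambda>u :: nat list \<Rightarrow> 'b. \<lambda>w :: nat list. \<zero>\<^bsub>L\<^esub>"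
  \<comment> \<open>The letters 0, 1 and 2 become alpha, beta and b. Each is a pure derivation, so
    bracketing with a function just strips the letter from the front of the word.\<close>
  define el where "el a = ((\<lambda>w :: nat list. \<zero>\<^bsub>L\<^esub>), letter L a)" for a
  have z: "?z \<in> lie_derivations K (word_lie L)"
    using G.zero_derivation by (simp add: word_lie_def)
  have el: "el a \<in> carrier N" for a
    using letter_derivation by (simp add: el_def N_def lie_holomorph_def word_lie_def)
  have fun_el: "(F, ?z) \<in> carrier N" if "\<forall>w. F w \<in> carrier L" for F
    using z that by (simp add: N_def lie_holomorph_def word_lie_def)
  have zero_bracket: "word_bracket L w (\<lambda>u. \<zero>\<^bsub>L\<^esub>) F = \<zero>\<^bsub>L\<^esub>" "word_bracket L w F (\<lambda>u. \<zero>\<^bsub>L\<^esub>) = \<zero>\<^bsub>L\<^esub>"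
    if "\<forall>w. F w \<in> carrier L" for F w
    using that by (induction w arbitrary: F) simp_all
  have el_bracket: "bracket N (el a) (F, ?z) = (\<lambda>w. F (a # w), ?z)" if "\<forall>w. F w \<in> carrier L" for a F
    using that zero_bracket
    by (auto simp: N_def lie_holomorph_def el_def ops minus_zero letter_def fun_eq_iff)
  define c where "c x = ((\<lambda>w :: nat list. if w = [] then x else \<zero>\<^bsub>L\<^esub>), ?z)" for x
  \<comment> \<open>Functions concentrated at the empty word form a copy of \<open>L\<close>: at any
    other word each Leibniz term shifts one of the factors to zero.\<close>
  have c_bracket: "word_bracket L w (\<lambda>w. if w = [] then x else \<zero>\<^bsub>L\<^esub>) (\<lambda>w. if w = [] then y else \<zero>\<^bsub>L\<^esub>)
      = (if w = [] then bracket L x y else \<zero>\<^bsub>L\<^esub>)" if "x \<in> carrier L" "y \<in> carrier L" for x y w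
    using that by (cases w) (simp_all add: zero_bracket)
  have "c \<in> lie_hom K L N"
  proof (rule lie_homI)
    show "c x \<in> carrier N" if "x \<in> carrier L" for x
      unfolding c_def by (rule fun_el) (use that in auto)
  qed (auto simp: c_def N_def lie_holomorph_def ops minus_zero c_bracket fun_eq_iff bracket_closed)
  moreover have "inj_on c (carrier L)"
    by (auto simp: inj_on_def c_def fun_eq_iff split: if_splits)
  \<comment> \<open>\<open>length w - 1\<close> counts the letters before the last one. The
    truncation at the empty word is harmless, since both tests fail there.\<close>
  moreover define f where "f w = (if w = replicate (length w - 1) 2 @ [0] then s (length w - 1)
      else if w = replicate (length w - 1) 2 @ [1] then t (length w - 1) else \<zero>\<^bsub>L\<^esub>)" for w :: "nat list"
  have f: "\<forall>w. f w \<in> carrier L" by (simp add: f_def s t)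
  have iter: "iter_bracket N (el 2) (f, ?z) i = (\<lambda>w. f (replicate i 2 @ w), ?z)" for i
  proof (induction i)
    case (Suc i)
    show ?case using f by (simp add: Suc el_bracket replicate_app_Cons_same)
  qed simp
  have "bracket N (el a) (iter_bracket N (el 2) (f, ?z) i) = (\<lambda>w. f (replicate i 2 @ a # w), ?z)" for i a
    using f by (simp add: iter el_bracket)
  moreover have "(\<lambda>w. f (replicate i 2 @ 0 # w)) = (\<lambda>w. if w = [] then s i else \<zero>\<^bsub>L\<^esub>)"
    "(\<lambda>w. f (replicate i 2 @ 1 # w)) = (\<lambda>w. if w = [] then t i else \<zero>\<^bsub>L\<^esub>)" for i
    by (auto simp: f_def fun_eq_iff replicate_snoc_eq simp del: One_nat_def)
  ultimately show ?thesis
    using that[OF N.lie_algebra_axioms el[of 0] el[of 1] el[of 2] fun_el[OF f]] by (simp add: c_def)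
qed


section \<open>Recursive functions\<close>

inductive_cases Zr_E: "rec_eval Zr xs y"
inductive_cases Sc_E: "rec_eval Sc xs y"
inductive_cases Pj_E: "rec_eval (Pj i) xs y"
inductive_cases Cn_E: "rec_eval (Cn f gs) xs y"
inductive_cases Pr_0E: "rec_eval (Pr f g) (0 # xs) y"
inductive_cases Pr_SucE: "rec_eval (Pr f g) (Suc k # xs) y"
inductive_cases Mn_E: "rec_eval (Mn f) xs y"

lemma list_all2_det:
  assumes "list_all2 (\<lambda>g y. P g y \<and> (\<forall>z. P g z \<longrightarrow> y = z)) gs ys" "list_all2 P gs zs"
  shows "ys = zs"
  using assms
proof (induction gs ys arbitrary: zs rule: list_all2_induct)
  case (Cons g gs y ys)
  then show ?case by (cases zs) auto
qed simp

text \<open>Since \<open>rec_eval\<close> is a relation, this is what allows a successful evaluation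
  to be read back as the expected value in the converse directions of
  \<open>re_set_image\<close>.\<close>

lemma rec_eval_det: "rec_eval f xs y \<Longrightarrow> rec_eval f xs z \<Longrightarrow> y = z"
proof (induction arbitrary: z rule: rec_eval.induct)
  case (comp xs gs ys f w)
  from comp.prems obtain ys' where "list_all2 (\<lambda>g. rec_eval g xs) gs ys'" "rec_eval f ys' z"
    by (rule Cn_E)
  moreover from this have "ys = ys'" using list_all2_det[OF comp.IH(1)] by blast
  ultimately show ?case using comp.IH(2) by blast
next
  case (mu f k xs)
  from mu.prems have z1: "rec_eval f (z # xs) 0" by (rule Mn_E)
  have z2: "\<exists>r. rec_eval f (j # xs) (Suc r)" if "j < z" for j
    using mu.prems by (rule Mn_E) (use that in blast)
  show ?case
  proof (rule linorder_cases[of k z])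
    assume "k < z"
    then obtain r where "rec_eval f (k # xs) (Suc r)" using z2 by blast
    then show ?thesis using mu.IH(1) by blast
  next
    assume "z < k"
    then obtain r where "\<forall>y. rec_eval f (z # xs) y \<longrightarrow> Suc r = y" using mu.IH(2) by blast
    then show ?thesis using z1 by blast
  qed
next
  case (prim_Suc f g k xs r y)
  from prim_Suc.prems obtain r' where "rec_eval (Pr f g) (k # xs) r'" "rec_eval g (k # r' # xs) z"
    by (rule Pr_SucE)
  then show ?case using prim_Suc.IH by blast
next
  case (zero xs)
  then show ?case by (rule Zr_E) simp
next
  case (succ x xs)
  then show ?case by (rule Sc_E) simp
next
  case (proj i xs)
  from proj.prems show ?case by (rule Pj_E) simp
next
  case (prim_0 f xs y g)
  from prim_0.prems have "rec_eval f xs z" by (rule Pr_0E)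
  then show ?case by (rule prim_0.IH)
qed

text \<open>Total functions of \<open>n\<close> arguments; the code may do anything on tuples of
  another length. Taking the tuple as the single argument lets closure rules follow the syntax of an
  expression.\<close>

definition recursive :: "nat \<Rightarrow> (nat list \<Rightarrow> nat) \<Rightarrow> bool" where
  "recursive n F \<longleftrightarrow> (\<exists>r. \<forall>xs. length xs = n \<longrightarrow> rec_eval r xs (F xs))"

lemma recursive_arg: "i < n \<Longrightarrow> recursive n (\<lambda>xs. xs ! i)"
  unfolding recursive_def using rec_eval.proj by blast

lemma recursive_comp1:
  assumes "recursive 1 (\<lambda>xs. G (xs ! 0))" "recursive n F"
  shows "recursive n (\<lambda>xs. G (F xs))"
proof -
  obtain g f where g: "\<And>xs. length xs = 1 \<Longrightarrow> rec_eval g xs (G (xs ! 0))"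
    and f: "\<And>xs. length xs = n \<Longrightarrow> rec_eval f xs (F xs)"
    using assms unfolding recursive_def by blast
  have "rec_eval (Cn g [f]) xs (G (F xs))" if "length xs = n" for xs
    using rec_eval.comp[of xs "[f]" "[F xs]" g] f[OF that] g[of "[F xs]"] by simp
  then show ?thesis unfolding recursive_def by blast
qed

lemma recursive_comp2:
  assumes "recursive 2 (\<lambda>xs. G (xs ! 0) (xs ! 1))" "recursive n F" "recursive n H"
  shows "recursive n (\<lambda>xs. G (F xs) (H xs))"
proof -
  obtain g f h where g: "\<And>xs. length xs = 2 \<Longrightarrow> rec_eval g xs (G (xs ! 0) (xs ! 1))"
    and f: "\<And>xs. length xs = n \<Longrightarrow> rec_eval f xs (F xs)"
    and h: "\<And>xs. length xs = n \<Longrightarrow> rec_eval h xs (H xs)"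
    using assms unfolding recursive_def by blast
  have "rec_eval (Cn g [f, h]) xs (G (F xs) (H xs))" if "length xs = n" for xs
    using rec_eval.comp[of xs "[f, h]" "[F xs, H xs]" g] f[OF that] h[OF that] g[of "[F xs, H xs]"]
    by simp
  then show ?thesis unfolding recursive_def by blast
qed

lemma recursive_Suc: "recursive n F \<Longrightarrow> recursive n (\<lambda>xs. Suc (F xs))"
proof (rule recursive_comp1[where G = Suc])
  have "rec_eval Sc xs (Suc (xs ! 0))" if "length xs = 1" for xs :: "nat list"
    using that by (cases xs) (auto intro: rec_eval.succ)
  then show "recursive 1 (\<lambda>xs. Suc (xs ! 0))" unfolding recursive_def by blast
qed

lemma recursive_const: "recursive n (\<lambda>xs. c)"
proof (induction c)
  case 0
  show ?case unfolding recursive_def using rec_eval.zero by blast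
qed (rule recursive_Suc)

lemma recursive_prim1:
  assumes G: "recursive 2 (\<lambda>xs. G (xs ! 0) (xs ! 1))" and B: "\<And>k. B (Suc k) = G k (B k)"
  shows "recursive 1 (\<lambda>xs. B (xs ! 0))"
proof -
  obtain g where g: "\<And>xs. length xs = 2 \<Longrightarrow> rec_eval g xs (G (xs ! 0) (xs ! 1))"
    using G unfolding recursive_def by blast
  obtain f where f: "rec_eval f [] (B 0)"
    using recursive_const[of 0 "B 0"] unfolding recursive_def by auto
  have "rec_eval (Pr f g) [k] (B k)" for k
  proof (induction k)
    case 0
    show ?case using f by (rule rec_eval.prim_0)
  next
    case (Suc k)
    show ?case using rec_eval.prim_Suc[OF Suc, of "B (Suc k)"] g[of "[k, B k]"] by (simp add: B)
  qed
  moreover have "xs = [xs ! 0]" if "length xs = 1" for xs :: "nat list"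
    using that by (cases xs) auto
  ultimately show ?thesis unfolding recursive_def by metis
qed

lemma recursive_prim2:
  assumes F: "recursive 1 (\<lambda>xs. F (xs ! 0))" and G: "recursive 3 (\<lambda>xs. G (xs ! 0) (xs ! 1) (xs ! 2))"
    and B: "\<And>y. B 0 y = F y" "\<And>k y. B (Suc k) y = G k (B k y) y"
  shows "recursive 2 (\<lambda>xs. B (xs ! 0) (xs ! 1))"
proof -
  obtain f g where f: "\<And>xs. length xs = 1 \<Longrightarrow> rec_eval f xs (F (xs ! 0))"
    and g: "\<And>xs. length xs = 3 \<Longrightarrow> rec_eval g xs (G (xs ! 0) (xs ! 1) (xs ! 2))"
    using F G unfolding recursive_def by blast
  have "rec_eval (Pr f g) [k, y] (B k y)" for k y
  proof (induction k)
    case 0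
    show ?case using rec_eval.prim_0[of f "[y]" "F y" g] f[of "[y]"] by (simp add: B)
  next
    case (Suc k)
    show ?case using rec_eval.prim_Suc[OF Suc, of "B (Suc k) y"] g[of "[k, B k y, y]"]
      by (simp add: B numeral_2_eq_2)
  qed
  moreover have "xs = [xs ! 0, xs ! 1]" if "length xs = 2" for xs :: "nat list"
    using that by (cases xs; cases "tl xs") auto
  ultimately show ?thesis unfolding recursive_def by metis
qed

lemma recursive_Least:
  assumes F: "recursive 2 (\<lambda>xs. F (xs ! 0) (xs ! 1))" and ex: "\<And>y. \<exists>k. F k y = 0"
  shows "recursive 1 (\<lambda>xs. LEAST k. F k (xs ! 0) = 0)"
proof -
  obtain f where f: "\<And>xs. length xs = 2 \<Longrightarrow> rec_eval f xs (F (xs ! 0) (xs ! 1))"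
    using F unfolding recursive_def by blast
  have f2: "rec_eval f [k, y] (F k y)" for k y using f[of "[k, y]"] by simp
  have "rec_eval (Mn f) [y] (LEAST k. F k y = 0)" for y
  proof (rule rec_eval.mu)
    show "rec_eval f [LEAST k. F k y = 0, y] 0"
      using f2[of "LEAST k. F k y = 0" y] LeastI_ex[OF ex[of y]] by simp
  next
    fix j assume "j < (LEAST k. F k y = 0)"
    then have "F j y \<noteq> 0" by (rule not_less_Least)
    then show "\<exists>r. rec_eval f [j, y] (Suc r)" using f2[of j y] by (metis not0_implies_Suc)
  qed
  moreover have "xs = [xs ! 0]" if "length xs = 1" for xs :: "nat list"
    using that by (cases xs) auto
  ultimately show ?thesis unfolding recursive_def by metis
qed

named_theorems recursive_intros

lemmas [recursive_intros] = recursive_arg recursive_const recursive_Suc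

lemma recursive_add [recursive_intros]:
  "\<lbrakk>recursive n F; recursive n G\<rbrakk> \<Longrightarrow> recursive n (\<lambda>xs. F xs + G xs)"
  by (rule recursive_comp2[where G = "(+)"],
      rule recursive_prim2[where F = "\<lambda>y. y" and G = "\<lambda>k r y. Suc r"])
    (auto intro!: recursive_intros)

lemma recursive_mult [recursive_intros]:
  "\<lbrakk>recursive n F; recursive n G\<rbrakk> \<Longrightarrow> recursive n (\<lambda>xs. F xs * G xs)"
  by (rule recursive_comp2[where G = "(*)"],
      rule recursive_prim2[where F = "\<lambda>y. 0" and G = "\<lambda>k r y. r + y"])
    (auto intro!: recursive_intros)

lemma recursive_pred: "recursive n F \<Longrightarrow> recursive n (\<lambda>xs. F xs - Suc 0)"
  by (rule recursive_comp1[where G = "\<lambda>x. x - Suc 0"],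
      rule recursive_prim1[where G = "\<lambda>k r. k"])
    (auto intro!: recursive_intros)

lemma recursive_diff [recursive_intros]:
  "\<lbrakk>recursive n F; recursive n G\<rbrakk> \<Longrightarrow> recursive n (\<lambda>xs. F xs - G xs)"
  by (rule recursive_comp2[where G = "\<lambda>y x. x - y", of n G F],
      rule recursive_prim2[where F = "\<lambda>y. y" and G = "\<lambda>k r y. r - Suc 0"])
    (auto intro!: recursive_intros recursive_pred)

text \<open>With truncated subtraction, the two one-sided differences add up to the distance of
  \<open>A\<close> and \<open>B\<close>, and 1 minus it is the indicator of equality.\<close>

lemma recursive_if_eq [recursive_intros]:
  assumes "recursive n A" "recursive n B" "recursive n F" "recursive n G"
  shows "recursive n (\<lambda>xs. if A xs = B xs then F xs else G xs)"
proof -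
  have "recursive n (\<lambda>xs. (1 - ((A xs - B xs) + (B xs - A xs))) * F xs
      + (1 - (1 - ((A xs - B xs) + (B xs - A xs)))) * G xs)"
    by (intro recursive_intros assms)
  moreover have "(if A xs = B xs then F xs else G xs) = (1 - ((A xs - B xs) + (B xs - A xs))) * F xs
      + (1 - (1 - ((A xs - B xs) + (B xs - A xs)))) * G xs" for xs
    by (cases "A xs" "B xs" rule: linorder_cases) auto
  ultimately show ?thesis by simp
qed

lemma recursive_triangle [recursive_intros]:
  "recursive n F \<Longrightarrow> recursive n (\<lambda>xs. triangle (F xs))"
  by (rule recursive_comp1[where G = triangle],
      rule recursive_prim1[where G = "\<lambda>k r. r + Suc k"])
    (auto intro!: recursive_intros)

lemma recursive_prod_encode [recursive_intros]:
  "\<lbrakk>recursive n F; recursive n G\<rbrakk> \<Longrightarrow> recursive n (\<lambda>xs. prod_encode (F xs, G xs))"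
  by (simp add: prod_encode_def recursive_intros)

definition pfst :: "nat \<Rightarrow> nat" where "pfst z = fst (prod_decode z)"
definition psnd :: "nat \<Rightarrow> nat" where "psnd z = snd (prod_decode z)"

lemma pfst_psnd [simp]:
  "pfst (prod_encode (a, b)) = a" "psnd (prod_encode (a, b)) = b"
  "prod_encode (pfst z, psnd z) = z"
  by (simp_all add: pfst_def psnd_def)

lemma triangle_mono: "m \<le> n \<Longrightarrow> triangle m \<le> triangle n"
  by (induction n rule: nat_induct) (auto simp: le_Suc_eq)

text \<open>In the Cantor pairing \<open>z = triangle (a + b) + a\<close>, the sum
  \<open>a + b\<close> is the least \<open>s\<close> with \<open>z < triangle (Suc s)\<close>. The
  truncated difference puts this inequality in the form that minimisation accepts; both projections
  follow.\<close>

lemma triangle_root: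
  "(LEAST s. Suc z - triangle (Suc s) = 0) = pfst z + psnd z"
proof (rule Least_equality)
  have z: "z = triangle (pfst z + psnd z) + pfst z"
    using pfst_psnd(3)[of z] by (simp add: prod_encode_def)
  show "Suc z - triangle (Suc (pfst z + psnd z)) = 0" by (subst z) simp
  fix s assume s: "Suc z - triangle (Suc s) = 0"
  show "pfst z + psnd z \<le> s"
  proof (rule ccontr)
    assume "\<not> pfst z + psnd z \<le> s"
    then have "triangle (Suc s) \<le> triangle (pfst z + psnd z)" by (intro triangle_mono) simp
    then show False using z s by linarith
  qed
qed

lemma recursive_triangle_root:
  "recursive n F \<Longrightarrow> recursive n (\<lambda>xs. LEAST s. Suc (F xs) - triangle (Suc s) = 0)"
proof (rule recursive_comp1[where G = "\<lambda>z. LEAST s. Suc z - triangle (Suc s) = 0"],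
    rule recursive_Least[where F = "\<lambda>s z. Suc z - triangle (Suc s)"])
  show "recursive 2 (\<lambda>xs. Suc (xs ! 1) - triangle (Suc (xs ! 0)))"
    by (auto intro!: recursive_intros)
  have "n \<le> triangle n" for n by (induction n) auto
  then show "\<exists>k. Suc y - triangle (Suc k) = 0" for y
    by (metis diff_is_0_eq)
qed

lemma recursive_pfst [recursive_intros]:
  assumes "recursive n F" shows "recursive n (\<lambda>xs. pfst (F xs))"
proof -
  have "recursive n (\<lambda>xs. F xs - triangle (LEAST s. Suc (F xs) - triangle (Suc s) = 0))"
    by (intro recursive_intros recursive_triangle_root assms)
  moreover have "z - triangle (LEAST s. Suc z - triangle (Suc s) = 0) = pfst z" for z
    using pfst_psnd(3)[of z] unfolding triangle_root by (simp add: prod_encode_def)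
  ultimately show ?thesis by simp
qed

lemma recursive_psnd [recursive_intros]:
  assumes "recursive n F" shows "recursive n (\<lambda>xs. psnd (F xs))"
proof -
  have "recursive n (\<lambda>xs. (LEAST s. Suc (F xs) - triangle (Suc s) = 0) - pfst (F xs))"
    by (intro recursive_intros recursive_triangle_root assms)
  then show ?thesis unfolding triangle_root by simp
qed

text \<open>The case \<open>p = 0\<close> is included: then \<open>x mod 0 = x\<close>, and the test
  for resetting never succeeds. It occurs in characteristic 0.\<close>

lemma recursive_mod [recursive_intros]:
  "recursive n F \<Longrightarrow> recursive n (\<lambda>xs. F xs mod p)"
  by (rule recursive_comp1[where G = "\<lambda>x. x mod p"],
      rule recursive_prim1[where G = "\<lambda>k r. if Suc r = p then 0 else Suc r"])
    (auto intro!: recursive_intros simp: mod_Suc)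

text \<open>A function of finite support is a nested case distinction. It is applied to
  \<open>pj\<close>, which is therefore set to 0 past the end of the list of scalars.\<close>

lemma recursive_table:
  assumes "\<And>j. j \<ge> d \<Longrightarrow> f j = 0"
  shows "recursive 1 (\<lambda>xs. f (xs ! 0))"
  using assms
proof (induction d arbitrary: f)
  case 0
  then show ?case using recursive_const[of 1 0] by simp
next
  case (Suc d)
  have "recursive 1 (\<lambda>xs. (f(d := 0)) (xs ! 0))"
    using Suc.prems by (intro Suc.IH) (auto simp: le_Suc_eq)
  then have "recursive 1 (\<lambda>xs. if xs ! 0 = d then f d else (f(d := 0)) (xs ! 0))"
    by (intro recursive_intros) auto
  moreover have "(\<lambda>xs. if xs ! 0 = d then f d else (f(d := 0)) (xs ! 0)) = (\<lambda>xs :: nat list. f (xs ! 0))"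
    by auto
  ultimately show ?case by simp
qed

text \<open>
  Injectivity of \<open>g\<close> is what makes dovetailing unnecessary: the parameter of an element is
  found by an unbounded search, and a single membership test in \<open>A\<close> remains.
\<close>

lemma re_set_image:
  assumes g: "recursive 1 (\<lambda>xs. g (xs ! 0))" and inj: "inj g" and A: "re_set A"
    and fl: "recursive 1 (\<lambda>xs. fl (xs ! 0))" and h: "recursive 1 (\<lambda>xs. h (xs ! 0))"
  shows "re_set (g ` {p. fl p = 0 \<or> h p \<in> A})"
proof -
  obtain a where a: "A = {x. \<exists>y. rec_eval a [x] y}" using A unfolding re_set_def by blast
  \<comment> \<open>The distance of \<open>g k\<close> and \<open>y\<close> vanishes exactly when
    \<open>k\<close> is the preimage of \<open>y\<close>, so minimising it inverts
    \<open>g\<close>.\<close>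
  have "recursive 2 (\<lambda>xs. (g (xs ! 0) - xs ! 1) + (xs ! 1 - g (xs ! 0)))"
    by (intro recursive_intros recursive_comp1[OF g]) auto
  then obtain d where d: "\<And>xs. length xs = 2 \<Longrightarrow> rec_eval d xs ((g (xs ! 0) - xs ! 1) + (xs ! 1 - g (xs ! 0)))"
    unfolding recursive_def by blast
  have d2: "rec_eval d [k, y] ((g k - y) + (y - g k))" for k y using d[of "[k, y]"] by simp
  have search: "rec_eval (Mn d) [y] p \<longleftrightarrow> g p = y" for p y
  proof
    assume "rec_eval (Mn d) [y] p"
    then have "rec_eval d [p, y] 0" by (rule Mn_E)
    then have "(g p - y) + (y - g p) = 0" using d2 rec_eval_det by blast
    then show "g p = y" by simp
  next
    assume p: "g p = y"
    show "rec_eval (Mn d) [y] p"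
    proof (rule rec_eval.mu)
      show "rec_eval d [p, y] 0" using d2[of p y] p by simp
      fix j assume "j < p"
      then have "g j \<noteq> y" using p inj by (auto dest: injD)
      then have "(g j - y) + (y - g j) \<noteq> 0" by simp
      then show "\<exists>r. rec_eval d [j, y] (Suc r)" using d2[of j y] by (metis not0_implies_Suc)
    qed
  qed
  have "recursive 1 (\<lambda>xs. if fl (xs ! 0) = 0 then 0 else 1)"
    by (intro recursive_intros recursive_comp1[OF fl]) auto
  then obtain s where s: "\<And>xs. length xs = 1 \<Longrightarrow> rec_eval s xs (if fl (xs ! 0) = 0 then 0 else 1)"
    unfolding recursive_def by blast
  have s1: "rec_eval s [p] (if fl p = 0 then 0 else 1)" for p using s[of "[p]"] by simp
  obtain hr where hr: "\<And>xs. length xs = 1 \<Longrightarrow> rec_eval hr xs (h (xs ! 0))"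
    using h unfolding recursive_def by blast
  have h1: "rec_eval hr [p] (h p)" for p using hr[of "[p]"] by simp
  \<comment> \<open>A guard: composition is strict, so \<open>a\<close> must not be run at all when
    the flag is 0. Primitive recursion on the flag runs \<open>a\<close> at flag 1 and returns 0 at
    flag 0.\<close>
  define t where "t = Pr Zr (Cn a [Pj 2])"
  have t0: "rec_eval t [0, x] 0" for x
    unfolding t_def by (intro rec_eval.prim_0 rec_eval.zero)
  have pj: "rec_eval (Pj 2) [0, 0, x] x" for x
    using rec_eval.proj[of 2 "[0, 0, x]"] by simp
  have t1: "(\<exists>y. rec_eval t [1, x] y) \<longleftrightarrow> x \<in> A" for x
  proof
    assume "\<exists>y. rec_eval t [1, x] y"
    then obtain y where "rec_eval t [Suc 0, x] y" by auto
    then obtain r where r: "rec_eval t [0, x] r" "rec_eval (Cn a [Pj 2]) [0, r, x] y"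
      unfolding t_def by (rule Pr_SucE)
    have "r = 0" using r(1) t0 rec_eval_det by blast
    with r(2) obtain ys where ys: "list_all2 (\<lambda>g. rec_eval g [0, 0, x]) [Pj 2] ys" "rec_eval a ys y"
      by (auto elim: Cn_E)
    then obtain z where z: "ys = [z]" "rec_eval (Pj 2) [0, 0, x] z" by (auto simp: list_all2_Cons1)
    have "z = x" using z(2) pj rec_eval_det by blast
    then show "x \<in> A" using ys z a by auto
  next
    assume "x \<in> A"
    then obtain y where "rec_eval a [x] y" using a by blast
    then have "rec_eval (Cn a [Pj 2]) [0, 0, x] y"
      using pj by (intro rec_eval.comp[of _ _ "[x]"]) auto
    then have "rec_eval t [Suc 0, x] y"
      using t0 unfolding t_def by (intro rec_eval.prim_Suc[of _ _ 0 "[x]" 0]) (auto simp: t_def)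
    then show "\<exists>y. rec_eval t [1, x] y" by auto
  qed
  define q where "q = Cn t [s, hr]"
  have q: "(\<exists>y. rec_eval q [p] y) \<longleftrightarrow> fl p = 0 \<or> h p \<in> A" for p
  proof -
    have "rec_eval q [p] y \<longleftrightarrow> rec_eval t [if fl p = 0 then 0 else 1, h p] y" for y
    proof
      assume "rec_eval q [p] y"
      then obtain ys where ys: "list_all2 (\<lambda>g. rec_eval g [p]) [s, hr] ys" "rec_eval t ys y"
        unfolding q_def by (rule Cn_E)
      then obtain u v where "ys = [u, v]" "rec_eval s [p] u" "rec_eval hr [p] v"
        by (auto simp: list_all2_Cons1)
      moreover from this have "u = (if fl p = 0 then 0 else 1)" "v = h p"
        using s1[of p] h1[of p] rec_eval_det by blast+
      ultimately show "rec_eval t [if fl p = 0 then 0 else 1, h p] y" using ys by blast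
    next
      assume "rec_eval t [if fl p = 0 then 0 else 1, h p] y"
      then show "rec_eval q [p] y"
        unfolding q_def using s1 h1
        by (intro rec_eval.comp[of _ _ "[if fl p = 0 then 0 else 1, h p]"]) auto
    qed
    then show ?thesis using t0[of "h p"] t1[of "h p"] by (cases "fl p = 0") auto
  qed
  have "y \<in> g ` {p. fl p = 0 \<or> h p \<in> A} \<longleftrightarrow> (\<exists>z. rec_eval (Cn q [Mn d]) [y] z)" for y
  proof
    assume "y \<in> g ` {p. fl p = 0 \<or> h p \<in> A}"
    then obtain p z where p: "y = g p" "rec_eval q [p] z" using q by blast
    have "rec_eval (Cn q [Mn d]) [y] z"
      using p search[of y p] by (intro rec_eval.comp[of _ _ "[p]"]) auto
    then show "\<exists>z. rec_eval (Cn q [Mn d]) [y] z" ..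
  next
    assume "\<exists>z. rec_eval (Cn q [Mn d]) [y] z"
    then obtain z where "rec_eval (Cn q [Mn d]) [y] z" ..
    then obtain ys where ys: "list_all2 (\<lambda>g. rec_eval g [y]) [Mn d] ys" "rec_eval q ys z"
      by (rule Cn_E)
    then obtain p where "ys = [p]" "rec_eval (Mn d) [y] p" by (auto simp: list_all2_Cons1)
    then have "g p = y" "fl p = 0 \<or> h p \<in> A" using ys search[of y p] q[of p] by auto
    then show "y \<in> g ` {p. fl p = 0 \<or> h p \<in> A}" by blast
  qed
  then have "\<forall>y. y \<in> g ` {p. fl p = 0 \<or> h p \<in> A} \<longleftrightarrow> y \<in> {y. \<exists>z. rec_eval (Cn q [Mn d]) [y] z}"
    by (simp only: mem_Collect_eq) simp
  then have "g ` {p. fl p = 0 \<or> h p \<in> A} = {y. \<exists>z. rec_eval (Cn q [Mn d]) [y] z}"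
    by (intro Set.set_eqI) (erule allE)
  then show ?thesis unfolding re_set_def by (rule exI)
qed


section \<open>Integral equations for the scalars\<close>

abbreviation int_scalar :: "('k, 'r) ring_scheme \<Rightarrow> int \<Rightarrow> 'k" where
  "int_scalar K z \<equiv> [z] \<cdot>\<^bsub>K\<^esub> \<one>\<^bsub>K\<^esub>"

primrec list_eval :: "('k, 'r) ring_scheme \<Rightarrow> 'k \<Rightarrow> int list \<Rightarrow> 'k" where
  "list_eval K \<theta> [] = \<zero>\<^bsub>K\<^esub>"
| "list_eval K \<theta> (a # as) = int_scalar K a \<oplus>\<^bsub>K\<^esub> \<theta> \<otimes>\<^bsub>K\<^esub> list_eval K \<theta> as"

text \<open>The derivative at \<open>\<theta>\<close>, by the product rule for \<open>a + X g\<close>.\<close>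

primrec list_deriv :: "('k, 'r) ring_scheme \<Rightarrow> 'k \<Rightarrow> int list \<Rightarrow> 'k" where
  "list_deriv K \<theta> [] = \<zero>\<^bsub>K\<^esub>"
| "list_deriv K \<theta> (a # as) = list_eval K \<theta> as \<oplus>\<^bsub>K\<^esub> \<theta> \<otimes>\<^bsub>K\<^esub> list_deriv K \<theta> as"

context field
begin

lemma int_scalar_add: "int_scalar R (a + b) = int_scalar R a \<oplus> int_scalar R b"
  by (rule add.int_pow_mult) simp

lemma int_scalar_0 [simp]: "int_scalar R 0 = \<zero>"
  by (simp add: add_pow_def)

lemma int_scalar_1 [simp]: "int_scalar R 1 = \<one>"
  by (rule add.int_pow_1) simp

lemma int_scalar_minus: "int_scalar R (- a) = \<ominus> int_scalar R a"
  by (rule add.int_pow_neg) simp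

lemma int_scalar_mult: "int_scalar R (a * b) = int_scalar R a \<otimes> int_scalar R b"
proof -
  have "int_scalar R (a * b) = [b] \<cdot> (int_scalar R a)" by (rule add.int_pow_pow[symmetric]) simp
  also have "\<dots> = [b] \<cdot> (int_scalar R a \<otimes> \<one>)" by simp
  also have "\<dots> = int_scalar R a \<otimes> int_scalar R b" by (rule add_pow_rdistr_int[symmetric]) auto
  finally show ?thesis .
qed

lemma int_scalar_nat: "int_scalar R (int n) = [n] \<cdot> \<one>"
  by (simp add: add_pow_def int_pow_int)

lemma list_eval_closed [simp]: "\<theta> \<in> carrier R \<Longrightarrow> list_eval R \<theta> as \<in> carrier R"
  by (induction as) auto

lemma list_deriv_closed [simp]: "\<theta> \<in> carrier R \<Longrightarrow> list_deriv R \<theta> as \<in> carrier R"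
  by (induction as) auto

text \<open>The passage to \<open>int poly\<close> makes degrees and \<open>pderiv\<close> available
  for finding the equations.\<close>

definition poly_eval :: "'a \<Rightarrow> int poly \<Rightarrow> 'a" where
  "poly_eval \<theta> p = list_eval R \<theta> (Polynomial.coeffs p)"

lemma poly_eval_closed [simp]: "\<theta> \<in> carrier R \<Longrightarrow> poly_eval \<theta> p \<in> carrier R"
  by (simp add: poly_eval_def)

lemma poly_eval_0 [simp]: "poly_eval \<theta> 0 = \<zero>"
  by (simp add: poly_eval_def)

lemma poly_eval_pCons: "\<theta> \<in> carrier R \<Longrightarrow> poly_eval \<theta> (pCons a p) = int_scalar R a \<oplus> \<theta> \<otimes> poly_eval \<theta> p"
  by (auto simp: poly_eval_def cCons_def)

lemma poly_eval_add:
  "\<theta> \<in> carrier R \<Longrightarrow> poly_eval \<theta> (p + q) = poly_eval \<theta> p \<oplus> poly_eval \<theta> q"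
proof (induction p arbitrary: q rule: pCons_induct)
  case (pCons a p)
  obtain b q' where q: "q = pCons b q'" by (cases q)
  show ?case
    using pCons.IH[OF pCons.prems, of q'] pCons.prems
    by (simp add: q poly_eval_pCons int_scalar_add r_distr a_ac)
qed simp

lemma list_deriv_coeffs:
  "\<theta> \<in> carrier R \<Longrightarrow> list_deriv R \<theta> (Polynomial.coeffs p) = poly_eval \<theta> (pderiv p)"
proof (induction p rule: pCons_induct)
  case (pCons a p)
  have "list_deriv R \<theta> (Polynomial.coeffs (pCons a p)) =
      poly_eval \<theta> p \<oplus> \<theta> \<otimes> list_deriv R \<theta> (Polynomial.coeffs p)"
    using pCons.hyps pCons.prems by (auto simp: cCons_def poly_eval_def)
  also have "\<dots> = poly_eval \<theta> (pderiv (pCons a p))"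
    using pCons.prems pCons.IH[OF pCons.prems]
    by (simp add: pderiv_pCons poly_eval_add poly_eval_pCons)
  finally show ?case .
qed simp

lemma poly_eval_monom:
  assumes "\<theta> \<in> carrier R"
  shows "poly_eval \<theta> (Polynomial.monom a n) = int_scalar R a \<otimes> \<theta> [^] n"
proof (induction n)
  case 0
  then show ?case using assms poly_eval_pCons[OF assms, of a 0] by (simp add: monom_0)
next
  case (Suc n)
  then show ?case using assms
    by (simp add: monom_Suc poly_eval_pCons m_ac)
qed

lemma prime_subfield_generate: "prime_subfield R = generate_field R {}"
  by (simp add: prime_subfield_def generate_field_min_subfield2)

lemma prime_subfield_is_subfield: "subfield (prime_subfield R) R"
  unfolding prime_subfield_generate by (rule generate_field_is_subfield) simp

text \<open>The elements that satisfy such an equation are closed under the field operations. The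
  equation is kept free of inverses, so that only integers are combined.\<close>

lemma prime_subfield_fraction:
  assumes "x \<in> prime_subfield R"
  obtains a b where "int_scalar R b \<noteq> \<zero>" "int_scalar R b \<otimes> x = int_scalar R a"
proof -
  have "x \<in> carrier R \<and> (\<exists>a b. int_scalar R b \<noteq> \<zero> \<and> int_scalar R b \<otimes> x = int_scalar R a)"
    using assms unfolding prime_subfield_generate
  proof induction
    case one
    show ?case by (intro conjI exI[of _ 1]) auto
  next
    case (a_inv h)
    then obtain a b where h: "h \<in> carrier R" "int_scalar R b \<noteq> \<zero>" "int_scalar R b \<otimes> h = int_scalar R a"
      by blast
    then show ?case
      by (intro conjI exI[of _ "- a"] exI[of _ b]) (auto simp: r_minus int_scalar_minus)
  next
    case (m_inv h)
    then obtain a b where h: "h \<in> carrier R" "int_scalar R b \<noteq> \<zero>" "int_scalar R b \<otimes> h = int_scalar R a"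
      by blast
    have u: "h \<in> Units R" using m_inv h field_Units by auto
    have "int_scalar R a \<otimes> inv h = int_scalar R b"
      using h u by (simp flip: h(3) add: m_assoc)
    moreover have "int_scalar R a \<noteq> \<zero>"
      using h m_inv integral[of "int_scalar R b" h] by auto
    ultimately show ?case using u by (intro conjI exI[of _ b] exI[of _ a]) auto
  next
    case (eng_add h1 h2)
    then obtain a b c d where h: "h1 \<in> carrier R" "int_scalar R b \<noteq> \<zero>" "int_scalar R b \<otimes> h1 = int_scalar R a"
      "h2 \<in> carrier R" "int_scalar R d \<noteq> \<zero>" "int_scalar R d \<otimes> h2 = int_scalar R c"
      by blast
    have "int_scalar R (b * d) \<otimes> (h1 \<oplus> h2)
        = int_scalar R d \<otimes> (int_scalar R b \<otimes> h1) \<oplus> int_scalar R b \<otimes> (int_scalar R d \<otimes> h2)"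
      using h(1,4) by (simp add: int_scalar_mult r_distr l_distr m_ac)
    also have "\<dots> = int_scalar R (d * a + b * c)" by (simp add: h int_scalar_add int_scalar_mult)
    finally show ?case
      using h integral[of "int_scalar R b" "int_scalar R d"]
      by (intro conjI exI[of _ "d * a + b * c"] exI[of _ "b * d"]) (auto simp: int_scalar_mult)
  next
    case (eng_mult h1 h2)
    then obtain a b c d where h: "h1 \<in> carrier R" "int_scalar R b \<noteq> \<zero>" "int_scalar R b \<otimes> h1 = int_scalar R a"
      "h2 \<in> carrier R" "int_scalar R d \<noteq> \<zero>" "int_scalar R d \<otimes> h2 = int_scalar R c"
      by blast
    have "int_scalar R (b * d) \<otimes> (h1 \<otimes> h2) = (int_scalar R b \<otimes> h1) \<otimes> (int_scalar R d \<otimes> h2)"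
      using h(1,4) by (simp add: int_scalar_mult m_ac)
    also have "\<dots> = int_scalar R (a * c)" by (simp add: h int_scalar_mult)
    finally show ?case
      using h integral[of "int_scalar R b" "int_scalar R d"]
      by (intro conjI exI[of _ "a * c"] exI[of _ "b * d"]) (auto simp: int_scalar_mult)
  qed simp
  then show ?thesis using that by blast
qed

lemma prime_subfield_common_denominator:
  assumes "set ks \<subseteq> prime_subfield R"
  obtains b as where "int_scalar R b \<noteq> \<zero>" "map (\<lambda>k. int_scalar R b \<otimes> k) ks = map (int_scalar R) as"
proof -
  have sub: "prime_subfield R \<subseteq> carrier R"
    using subfieldE(3)[OF prime_subfield_is_subfield] by auto
  have "\<exists>b as. int_scalar R b \<noteq> \<zero> \<and> map (\<lambda>k. int_scalar R b \<otimes> k) ks = map (int_scalar R) as"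
    using assms
  proof (induction ks)
    case Nil
    show ?case by (intro exI[of _ 1] exI[of _ "[]"]) simp
  next
    case (Cons k ks)
    then obtain b as where b: "int_scalar R b \<noteq> \<zero>" "map (\<lambda>k. int_scalar R b \<otimes> k) ks = map (int_scalar R) as"
      by auto
    have "k \<in> prime_subfield R" using Cons.prems by simp
    then obtain c d where c: "int_scalar R d \<noteq> \<zero>" "int_scalar R d \<otimes> k = int_scalar R c"
      by (rule prime_subfield_fraction)
    have kc: "k \<in> carrier R" "set ks \<subseteq> carrier R" using Cons.prems sub by auto
    have "map (\<lambda>k. int_scalar R (b * d) \<otimes> k) ks
        = map ((\<otimes>) (int_scalar R d)) (map (\<lambda>k. int_scalar R b \<otimes> k) ks)"
      using kc by (auto simp: int_scalar_mult m_ac)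
    also have "\<dots> = map (int_scalar R) (map ((*) d) as)"
      unfolding b(2) by (simp add: int_scalar_mult)
    finally have "map (\<lambda>k. int_scalar R (b * d) \<otimes> k) ks = map (int_scalar R) (map ((*) d) as)" .
    moreover have "int_scalar R (b * d) \<otimes> k = int_scalar R (b * c)"
      using kc c by (simp add: int_scalar_mult m_assoc)
    ultimately have "map (\<lambda>k. int_scalar R (b * d) \<otimes> k) (k # ks) = map (int_scalar R) (b * c # map ((*) d) as)"
      by simp
    moreover have "int_scalar R (b * d) \<noteq> \<zero>"
      using b c integral[of "int_scalar R b" "int_scalar R d"] by (auto simp: int_scalar_mult)
    ultimately show ?case by blast
  qed
  then show ?thesis using that by blast
qed

text \<open>Identifies a linear combination of powers with evaluation by Horner's scheme. The offset
  \<open>j\<close> is for the induction.\<close>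

lemma combine_powers:
  assumes "\<theta> \<in> carrier R"
  shows "combine (map (int_scalar R) as) (map (\<lambda>i. \<theta> [^] (i + j)) [0..<length as]) = \<theta> [^] j \<otimes> list_eval R \<theta> as"
proof (induction as arbitrary: j)
  case (Cons a as)
  have "map (\<lambda>i. \<theta> [^] (i + j)) [0..<length (a # as)] = \<theta> [^] j # map (\<lambda>i. \<theta> [^] (i + Suc j)) [0..<length as]"
    by (simp add: map_upt_Suc del: upt_Suc nat_pow_Suc)
  then show ?case
    using assms Cons[of "Suc j"] by (simp add: r_distr m_ac del: upt_Suc)
qed (use assms in simp)

text \<open>The powers of \<theta> up to the dimension are one too many to be independent, and
  denominators can be cleared. A coefficient has to be nonzero in the field, since a nonzero integer
  may vanish there.\<close>

lemma integral_equation: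
  assumes fd: "finite_dimension (prime_subfield R) (carrier R)" and \<theta>: "\<theta> \<in> carrier R"
  obtains as where "list_eval R \<theta> as = \<zero>" "\<exists>a\<in>set as. int_scalar R a \<noteq> \<zero>"
proof -
  note F = prime_subfield_is_subfield
  obtain n where n: "dimension n (prime_subfield R) (carrier R)"
    using fd by (auto simp: finite_dimension_def)
  define us where "us = map (\<lambda>i. \<theta> [^] (i + 0)) [0..<Suc n]"
  have us: "set us \<subseteq> carrier R" using \<theta> by (auto simp: us_def)
  have "dependent (prime_subfield R) us"
    using independent_length_le_dimension[OF F n _ us] by (auto simp: us_def)
  then obtain ks where ks: "set ks \<subseteq> prime_subfield R" "combine ks us = \<zero>"
    "\<not> set (take (length us) ks) \<subseteq> {\<zero>}"
    using trivial_combine_imp_independent[OF F us] by blast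
  \<comment> \<open>\<open>combine\<close> drops surplus coefficients, so the lists are first
    brought to equal length, keeping a coefficient that is not zero.\<close>
  then obtain ks' where ks': "set (take (length us) ks) \<subseteq> set ks'" "set ks' \<subseteq> set (take (length us) ks) \<union> {\<zero>}"
      "length ks' = length us" "combine ks' us = \<zero>"
    using combine_normalize[OF subset_trans[OF ks(1) subfieldE(3)[OF F]] us ks(2)] by metis
  have "set ks' \<subseteq> prime_subfield R"
  proof -
    have "\<zero> \<in> prime_subfield R" using F by (rule subringE(2)[OF subfieldE(1)])
    then show ?thesis using ks'(2) ks(1) set_take_subset[of "length us" ks] by blast
  qed
  then obtain b as where b: "int_scalar R b \<noteq> \<zero>" "map (\<lambda>k. int_scalar R b \<otimes> k) ks' = map (int_scalar R) as"
    by (rule prime_subfield_common_denominator)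
  have ksc: "set ks' \<subseteq> carrier R" using \<open>set ks' \<subseteq> prime_subfield R\<close> subfieldE(3)[OF F] by blast
  have len: "length as = Suc n" using b(2) ks'(3) by (metis length_map length_upt us_def diff_zero)
  have "combine (map (\<lambda>k. int_scalar R b \<otimes> k) ks') us = int_scalar R b \<otimes> combine ks' us"
    using combine_r_distr[OF ksc us, of "int_scalar R b"] by simp
  then have "combine (map (int_scalar R) as) us = \<zero>" by (simp add: b(2) ks'(4))
  then have "list_eval R \<theta> as = \<zero>"
    using combine_powers[OF \<theta>, of as 0] \<theta> by (simp add: us_def len del: upt_Suc)
  moreover have "\<exists>a\<in>set as. int_scalar R a \<noteq> \<zero>"
  proof -
    obtain k where k: "k \<in> set ks'" "k \<noteq> \<zero>" using ks(3) ks'(1) by blast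
    then have "int_scalar R b \<otimes> k \<in> set (map (int_scalar R) as)"
      by (simp flip: b(2))
    moreover have "int_scalar R b \<otimes> k \<noteq> \<zero>" using k b(1) ksc integral[of "int_scalar R b" k] by blast
    ultimately show ?thesis by auto
  qed
  ultimately show ?thesis using that by blast
qed

lemma list_eval_Poly: "\<theta> \<in> carrier R \<Longrightarrow> poly_eval \<theta> (Poly as) = list_eval R \<theta> as"
  by (induction as) (simp_all add: poly_eval_pCons)

text \<open>A nonzero polynomial of least degree annihilating \<theta> is not constant, because
  nonzero integers stay nonzero; its derivative is then nonzero of smaller degree and cannot vanish
  at \<theta>.\<close>

lemma separable_equation_char_0:
  assumes fd: "finite_dimension (prime_subfield R) (carrier R)" and \<theta>: "\<theta> \<in> carrier R"
    and char: "\<And>z. int_scalar R z = \<zero> \<Longrightarrow> z = 0"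
  obtains as where "list_eval R \<theta> as = \<zero>" "list_deriv R \<theta> as \<noteq> \<zero>"
proof -
  obtain as where as: "list_eval R \<theta> as = \<zero>" "\<exists>a\<in>set as. int_scalar R a \<noteq> \<zero>"
    using integral_equation[OF fd \<theta>] by blast
  then have "Poly as \<noteq> 0" by (auto simp: Poly_eq_0)
  then have "\<exists>p. p \<noteq> 0 \<and> poly_eval \<theta> p = \<zero>" using as \<theta> list_eval_Poly by auto
  then obtain p where p: "p \<noteq> 0" "poly_eval \<theta> p = \<zero>"
    and min: "\<And>q. q \<noteq> 0 \<Longrightarrow> poly_eval \<theta> q = \<zero> \<Longrightarrow> Polynomial.degree p \<le> Polynomial.degree q"
    using exists_least_iff[of "\<lambda>d. \<exists>p. Polynomial.degree p = d \<and> p \<noteq> 0 \<and> poly_eval \<theta> p = \<zero>"]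
    by (metis (no_types, lifting) linorder_not_less)
  have "Polynomial.degree p \<noteq> 0"
  proof
    assume "Polynomial.degree p = 0"
    then obtain a where a: "p = [:a:]" by (rule degree_eq_zeroE)
    then have "int_scalar R a = \<zero>" using p(2) \<theta> by (simp add: poly_eval_pCons)
    then show False using char a p(1) by simp
  qed
  then have "pderiv p \<noteq> 0" "Polynomial.degree (pderiv p) < Polynomial.degree p"
    by (simp_all add: pderiv_eq_0_iff degree_pderiv)
  then have "poly_eval \<theta> (pderiv p) \<noteq> \<zero>" using min by (meson not_le)
  then show ?thesis
    using that[of "Polynomial.coeffs p"] p(2) list_deriv_coeffs[OF \<theta>] by (simp add: poly_eval_def)
qed

text \<open>A vanishing nonzero integer leaves finitely many integer scalars, hence finitely many
  fractions, hence finitely many combinations of a basis.\<close>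

lemma finite_field_if_char:
  assumes fd: "finite_dimension (prime_subfield R) (carrier R)"
    and char: "int_scalar R z = \<zero>" "z \<noteq> 0"
  shows "finite (carrier R)"
proof -
  note F = prime_subfield_is_subfield
  define m where "m = \<bar>z\<bar>"
  have m: "m > 0" "int_scalar R m = \<zero>" using char by (auto simp: m_def abs_if int_scalar_minus)
  have "int_scalar R a \<in> int_scalar R ` {0..<m}" for a
  proof -
    have "int_scalar R a = int_scalar R (m * (a div m) + a mod m)" by simp
    also have "\<dots> = int_scalar R (a mod m)" unfolding int_scalar_add int_scalar_mult m(2) by simp
    finally show ?thesis using m(1) by auto
  qed
  then have "range (int_scalar R) \<subseteq> int_scalar R ` {0..<m}" by blast
  then have fin: "finite (range (int_scalar R))" by (rule finite_subset) simp
  have "x \<in> (\<lambda>(a, b). inv b \<otimes> a) ` (range (int_scalar R) \<times> range (int_scalar R))"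
    if x: "x \<in> prime_subfield R" for x
  proof -
    obtain a b where ab: "int_scalar R b \<noteq> \<zero>" "int_scalar R b \<otimes> x = int_scalar R a"
      using x by (rule prime_subfield_fraction)
    have "x \<in> carrier R" using x subfieldE(3)[OF F] by blast
    moreover have "int_scalar R b \<in> Units R" using ab field_Units by auto
    ultimately have "x = inv (int_scalar R b) \<otimes> int_scalar R a"
      by (simp flip: ab(2) add: m_assoc[symmetric])
    then show ?thesis by auto
  qed
  then have finF: "finite (prime_subfield R)"
    using fin by (intro finite_subset[OF subsetI finite_imageI[OF finite_cartesian_product[OF fin fin]]]) blast
  have "finite (Span (prime_subfield R) us)" if "set us \<subseteq> carrier R" for us
    using that
  proof (induction us)
    case (Cons u us)
    have "line_extension (prime_subfield R) u (Span (prime_subfield R) us)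
        \<subseteq> (\<lambda>(k, v). k \<otimes> u \<oplus> v) ` (prime_subfield R \<times> Span (prime_subfield R) us)"
      by (auto simp: line_extension_mem_iff image_iff)
    then show ?case using Cons finF by (auto intro: finite_subset)
  qed simp
  moreover obtain n where "dimension n (prime_subfield R) (carrier R)"
    using fd by (auto simp: finite_dimension_def)
  then obtain us where "set us \<subseteq> carrier R" "Span (prime_subfield R) us = carrier R"
    using exists_base[OF F] by blast
  ultimately show ?thesis by metis
qed

text \<open>In a field of \<open>q\<close> elements every \<theta> is a root of
  \<open>X^q - X\<close>, whose derivative is the constant -1 because \<open>q\<close> vanishes in
  the field.\<close>

lemma separable_equation_finite:
  assumes fin: "finite (carrier R)" and \<theta>: "\<theta> \<in> carrier R"
  obtains as where "list_eval R \<theta> as = \<zero>" "list_deriv R \<theta> as \<noteq> \<zero>"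
proof -
  define q where "q = card (carrier R)"
  have q0: "int_scalar R (int q) = \<zero>"
    using add.pow_order_eq_1[of \<one>] by (simp add: int_scalar_nat q_def Coset.order_def)
  have q1: "q \<ge> 1" using fin \<theta> unfolding q_def by (metis One_nat_def Suc_leI card_gt_0_iff empty_iff)
  have pow: "\<theta> [^] q = \<theta>"
  proof (cases "\<theta> = \<zero>")
    case True
    then show ?thesis using q1 by (simp add: nat_pow_zero)
  next
    case False
    interpret G: group "Multiplicative_Group.mult_of R" by (rule field_mult_group)
    have "\<theta> [^] (q - 1) = \<one>"
      using G.pow_order_eq_1[of \<theta>] False \<theta> fin
      by (simp add: order_mult_of Coset.order_def q_def Multiplicative_Group.nat_pow_mult_of)
    then have "\<theta> [^] (q - 1) \<otimes> \<theta> = \<theta>" using \<theta> by simp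
    then show ?thesis using q1 \<theta> nat_pow_Suc[of \<theta> "q - 1"] by simp
  qed
  define p :: "int poly" where "p = Polynomial.monom 1 q + [:0, - 1:]"
  have "poly_eval \<theta> p = \<zero>"
    using \<theta> by (simp add: p_def poly_eval_add poly_eval_monom poly_eval_pCons pow int_scalar_minus r_minus r_neg)
  moreover have "pderiv p = Polynomial.monom (int q) (q - 1) + [:- 1:]"
    by (simp add: p_def pderiv_add pderiv_monom pderiv_pCons)
  then have "poly_eval \<theta> (pderiv p) = \<ominus> \<one>"
    using \<theta> by (simp add: poly_eval_add poly_eval_monom poly_eval_pCons q0 int_scalar_minus)
  moreover have "\<ominus> \<one> \<noteq> \<zero>" by (metis minus_zero minus_minus one_closed one_not_zero)
  ultimately show ?thesis
    using that[of "Polynomial.coeffs p"] list_deriv_coeffs[OF \<theta>, of p] by (simp add: poly_eval_def)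
qed

theorem separable_equation:
  assumes "finite_dimension (prime_subfield R) (carrier R)" "\<theta> \<in> carrier R"
  obtains as where "list_eval R \<theta> as = \<zero>" "list_deriv R \<theta> as \<noteq> \<zero>"
  using separable_equation_char_0[OF assms] separable_equation_finite[OF finite_field_if_char[OF assms(1)] assms(2)]
  by metis

end


subsection \<open>Averaging over the scalars\<close>

text \<open>
  A list of pairs \<open>(\<beta>, \<mu>)\<close> stands for an element of the tensor product over the prime subfield
  of \<open>K\<close> with itself, the right-hand factors being named by natural numbers \<open>\<mu>\<close>
  (multiplicatively, with value \<open>\<kappa> \<mu>\<close>). It acts on families \<open>h\<close> where \<open>h m\<close> is thought of as the
  image of \<open>\<kappa> m\<close> times a fixed vector under a map that is only additive. The aim is a
  separability idempotent, which turns such a map into a linear one.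
\<close>

primrec twist :: "('k, 'a, 'm) lie_algebra_scheme \<Rightarrow> ('k \<times> nat) list \<Rightarrow> (nat \<Rightarrow> 'a) \<Rightarrow> nat \<Rightarrow> 'a" where
  "twist L [] h m = \<zero>\<^bsub>L\<^esub>"
| "twist L (e # es) h m = fst e \<odot>\<^bsub>L\<^esub> h (m * snd e) \<oplus>\<^bsub>L\<^esub> twist L es h m"

text \<open>The image of the tensor under multiplication to the field. Weight 1 is one of the two
  properties of a separability idempotent.\<close>

primrec twist_weight :: "('k, 'r) ring_scheme \<Rightarrow> (nat \<Rightarrow> 'k) \<Rightarrow> ('k \<times> nat) list \<Rightarrow> 'k" where
  "twist_weight K \<kappa> [] = \<zero>\<^bsub>K\<^esub>"
| "twist_weight K \<kappa> (e # es) = fst e \<otimes>\<^bsub>K\<^esub> \<kappa> (snd e) \<oplus>\<^bsub>K\<^esub> twist_weight K \<kappa> es"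

definition scale_twist :: "('k, 'r) ring_scheme \<Rightarrow> 'k \<Rightarrow> ('k \<times> nat) list \<Rightarrow> ('k \<times> nat) list" where
  "scale_twist K c es = map (\<lambda>e. (c \<otimes>\<^bsub>K\<^esub> fst e, snd e)) es"

text \<open>The product in the tensor product; the right-hand factors multiply through their
  names.\<close>

primrec comp_twist :: "('k, 'r) ring_scheme \<Rightarrow> ('k \<times> nat) list \<Rightarrow> ('k \<times> nat) list \<Rightarrow> ('k \<times> nat) list"
  where
  "comp_twist K [] es' = []"
| "comp_twist K (e # es) es' =
    map (\<lambda>e'. (fst e \<otimes>\<^bsub>K\<^esub> fst e', snd e * snd e')) es' @ comp_twist K es es'"

text \<open>\<open>f(X)\<close>, and the divided difference \<open>(f(X) - f(\<theta>)) / (X - \<theta>)\<close>, where \<open>X\<close> acts by \<open>m \<mapsto> m p\<close>.\<close>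

primrec pow_twist :: "('k, 'r) ring_scheme \<Rightarrow> nat \<Rightarrow> int list \<Rightarrow> nat \<Rightarrow> ('k \<times> nat) list" where
  "pow_twist K p [] \<mu> = []"
| "pow_twist K p (a # as) \<mu> = (int_scalar K a, \<mu>) # pow_twist K p as (\<mu> * p)"

primrec diff_twist :: "('k, 'r) ring_scheme \<Rightarrow> 'k \<Rightarrow> nat \<Rightarrow> int list \<Rightarrow> ('k \<times> nat) list" where
  "diff_twist K \<theta> p [] = []"
| "diff_twist K \<theta> p (a # as) = pow_twist K p as 1 @ scale_twist K \<theta> (diff_twist K \<theta> p as)"

inductive_set monomials :: "nat set \<Rightarrow> nat set" for P where
  one: "1 \<in> monomials P"
| mult: "\<lbrakk>m \<in> monomials P; p \<in> P\<rbrakk> \<Longrightarrow> m * p \<in> monomials P"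

lemma monomials_mult: "\<lbrakk>m' \<in> monomials P; m \<in> monomials P\<rbrakk> \<Longrightarrow> m * m' \<in> monomials P"
proof (induction rule: monomials.induct)
  case (mult m' p)
  have "m * m' * p \<in> monomials P" using mult.IH[OF mult.prems] mult.hyps(2) by (rule monomials.mult)
  then show ?case by (simp add: Groups.mult.assoc)
qed simp

lemma monomials_power: "\<mu> \<in> monomials P \<Longrightarrow> p \<in> P \<Longrightarrow> set (pow_twist K p as \<mu>) \<subseteq> UNIV \<times> monomials P"
  by (induction as arbitrary: \<mu>) (auto intro: monomials.intros)

lemma diff_twist_monomials: "p \<in> P \<Longrightarrow> set (diff_twist K \<theta> p as) \<subseteq> UNIV \<times> monomials P"
proof (induction as)
  case (Cons a as)
  then show ?case
    using monomials_power[OF monomials.one Cons.prems, of K as]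
    by (auto simp: scale_twist_def)
qed simp

lemma monomials_mono: "P \<subseteq> Q \<Longrightarrow> monomials P \<subseteq> monomials Q"
proof
  fix m assume "P \<subseteq> Q" "m \<in> monomials P"
  from this(2,1) show "m \<in> monomials Q" by induction (auto intro: monomials.intros simp del: One_nat_def)
qed

lemma comp_twist_monomials:
  "\<lbrakk>set es \<subseteq> UNIV \<times> monomials P; set es' \<subseteq> UNIV \<times> monomials P\<rbrakk>
    \<Longrightarrow> set (comp_twist K es es') \<subseteq> UNIV \<times> monomials P"
  by (induction es) (auto, fastforce intro: monomials_mult)

context field
begin

lemma scale_twist_closed: "\<lbrakk>c \<in> carrier R; fst ` set es \<subseteq> carrier R\<rbrakk> \<Longrightarrow> fst ` set (scale_twist R c es) \<subseteq> carrier R"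
  by (auto simp: scale_twist_def)

lemma comp_twist_closed:
  "\<lbrakk>fst ` set es \<subseteq> carrier R; fst ` set es' \<subseteq> carrier R\<rbrakk> \<Longrightarrow> fst ` set (comp_twist R es es') \<subseteq> carrier R"
  by (induction es) auto

lemma pow_twist_closed: "fst ` set (pow_twist R p as \<mu>) \<subseteq> carrier R"
  by (induction as arbitrary: \<mu>) auto

lemma diff_twist_closed: "\<theta> \<in> carrier R \<Longrightarrow> fst ` set (diff_twist R \<theta> p as) \<subseteq> carrier R"
proof (induction as)
  case (Cons a as)
  then show ?case using pow_twist_closed[of p as 1] scale_twist_closed by (simp add: image_Un)
qed simp

context
  fixes \<kappa> :: "nat \<Rightarrow> 'a"
  assumes \<kappa>_closed: "\<And>m. \<kappa> m \<in> carrier R" and \<kappa>_one: "\<kappa> 1 = \<one>"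
    and \<kappa>_mult: "\<And>m m'. \<kappa> (m * m') = \<kappa> m \<otimes> \<kappa> m'"
begin

lemma twist_weight_closed: "fst ` set es \<subseteq> carrier R \<Longrightarrow> twist_weight R \<kappa> es \<in> carrier R"
  by (induction es) (auto simp: \<kappa>_closed)

lemma twist_weight_append:
  "\<lbrakk>fst ` set es \<subseteq> carrier R; fst ` set es' \<subseteq> carrier R\<rbrakk>
    \<Longrightarrow> twist_weight R \<kappa> (es @ es') = twist_weight R \<kappa> es \<oplus> twist_weight R \<kappa> es'"
  by (induction es) (auto simp: \<kappa>_closed twist_weight_closed a_assoc)

lemma twist_weight_scale:
  "\<lbrakk>c \<in> carrier R; fst ` set es \<subseteq> carrier R\<rbrakk>
    \<Longrightarrow> twist_weight R \<kappa> (scale_twist R c es) = c \<otimes> twist_weight R \<kappa> es"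
  by (induction es) (auto simp: scale_twist_def \<kappa>_closed twist_weight_closed r_distr m_assoc)

lemma twist_weight_comp:
  assumes "fst ` set es \<subseteq> carrier R" "fst ` set es' \<subseteq> carrier R"
  shows "twist_weight R \<kappa> (comp_twist R es es') = twist_weight R \<kappa> es \<otimes> twist_weight R \<kappa> es'"
  using assms(1)
proof (induction es)
  case Nil
  then show ?case using twist_weight_closed[OF assms(2)] by simp
next
  case (Cons e es)
  let ?f = "\<lambda>e'. (fst e \<otimes> fst e', snd e * snd e')"
  have e: "fst e \<in> carrier R" using Cons.prems by simp
  have "twist_weight R \<kappa> (map ?f fs) = (fst e \<otimes> \<kappa> (snd e)) \<otimes> twist_weight R \<kappa> fs"
    if "fst ` set fs \<subseteq> carrier R" for fs
    using that e by (induction fs) (auto simp: \<kappa>_closed \<kappa>_mult twist_weight_closed r_distr m_ac)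
  moreover have "fst ` set (map ?f es') \<subseteq> carrier R" using assms(2) e by auto
  ultimately show ?case
    using Cons e assms(2) comp_twist_closed[of es es']
    by (simp add: twist_weight_append \<kappa>_closed twist_weight_closed l_distr)
qed

lemma twist_weight_pow:
  assumes "\<theta> \<in> carrier R" "\<kappa> p = \<theta>"
  shows "twist_weight R \<kappa> (pow_twist R p as \<mu>) = \<kappa> \<mu> \<otimes> list_eval R \<theta> as"
proof (induction as arbitrary: \<mu>)
  case Nil
  then show ?case using \<kappa>_closed by simp
next
  case (Cons a as)
  then show ?case using assms \<kappa>_closed[of \<mu>] by (simp add: \<kappa>_mult r_distr m_ac)
qed

text \<open>Multiplication puts \<open>X = \<theta>\<close> into the divided difference, which gives
  the derivative.\<close>

lemma twist_weight_diff:
  assumes "\<theta> \<in> carrier R" "\<kappa> p = \<theta>"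
  shows "twist_weight R \<kappa> (diff_twist R \<theta> p as) = list_deriv R \<theta> as"
proof (induction as)
  case (Cons a as)
  show ?case
    using Cons assms
    by (simp add: twist_weight_append twist_weight_scale twist_weight_pow pow_twist_closed
        diff_twist_closed scale_twist_closed \<kappa>_one[simplified])
qed simp

end

end

context lie_algebra
begin

lemma twist_closed:
  "\<lbrakk>fst ` set es \<subseteq> carrier K; \<And>m. h m \<in> carrier L\<rbrakk> \<Longrightarrow> twist L es h m \<in> carrier L"
  by (induction es) auto

lemma twist_append:
  "\<lbrakk>fst ` set es \<subseteq> carrier K; fst ` set es' \<subseteq> carrier K; \<And>m. h m \<in> carrier L\<rbrakk>
    \<Longrightarrow> twist L (es @ es') h m = twist L es h m \<oplus>\<^bsub>L\<^esub> twist L es' h m"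
  by (induction es) (auto simp: twist_closed M.a_assoc)

lemma twist_scale:
  "\<lbrakk>c \<in> carrier K; fst ` set es \<subseteq> carrier K; \<And>m. h m \<in> carrier L\<rbrakk>
    \<Longrightarrow> twist L (scale_twist K c es) h m = c \<odot>\<^bsub>L\<^esub> twist L es h m"
  by (induction es) (auto simp: scale_twist_def twist_closed smult_r_distr smult_assoc1)

lemma twist_add:
  "\<lbrakk>fst ` set es \<subseteq> carrier K; \<And>m. h m \<in> carrier L; \<And>m. h' m \<in> carrier L\<rbrakk>
    \<Longrightarrow> twist L es (\<lambda>m. h m \<oplus>\<^bsub>L\<^esub> h' m) m = twist L es h m \<oplus>\<^bsub>L\<^esub> twist L es h' m"
  by (induction es) (auto simp: twist_closed smult_r_distr M.a_ac)

lemma twist_smult: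
  assumes "fst ` set es \<subseteq> carrier K" "\<And>m. h m \<in> carrier L" "c \<in> carrier K"
  shows "twist L es (\<lambda>m. c \<odot>\<^bsub>L\<^esub> h m) m = c \<odot>\<^bsub>L\<^esub> twist L es h m"
  using assms(1)
proof (induction es)
  case Nil
  then show ?case using assms(3) by simp
next
  case (Cons e es)
  have "fst e \<odot>\<^bsub>L\<^esub> (c \<odot>\<^bsub>L\<^esub> x) = c \<odot>\<^bsub>L\<^esub> (fst e \<odot>\<^bsub>L\<^esub> x)" if "x \<in> carrier L" for x
    using Cons.prems assms(3) that by (simp add: K.m_comm flip: smult_assoc1)
  then show ?case using Cons assms by (simp add: twist_closed smult_r_distr)
qed

lemma twist_zero: "fst ` set es \<subseteq> carrier K \<Longrightarrow> twist L es (\<lambda>m. \<zero>\<^bsub>L\<^esub>) m = \<zero>\<^bsub>L\<^esub>"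
  by (induction es) auto

lemma twist_shift: "twist L es (\<lambda>m. h (m * \<mu>)) m = twist L es h (m * \<mu>)"
  by (induction es) (auto simp: mult_ac)

text \<open>Both factors of the tensor product are commutative. Thus an equation satisfied by
  \<open>h\<close> survives averaging over other generators.\<close>

lemma twist_commute:
  assumes "fst ` set es \<subseteq> carrier K" "fst ` set es' \<subseteq> carrier K" "\<And>m. h m \<in> carrier L"
  shows "twist L es (twist L es' h) m = twist L es' (twist L es h) m"
  using assms(1)
proof (induction es)
  case Nil
  then show ?case using assms twist_zero by simp
next
  case (Cons e es)
  have cl: "twist L es h m \<in> carrier L" "twist L es' h m \<in> carrier L" for m
    using Cons.prems assms by (auto intro: twist_closed)
  have "twist L es' (twist L (e # es) h) m =
      twist L es' (\<lambda>m. fst e \<odot>\<^bsub>L\<^esub> h (m * snd e)) m \<oplus>\<^bsub>L\<^esub> twist L es' (twist L es h) m"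
  proof -
    have "twist L (e # es) h = (\<lambda>m. fst e \<odot>\<^bsub>L\<^esub> h (m * snd e) \<oplus>\<^bsub>L\<^esub> twist L es h m)"
      by (simp add: fun_eq_iff)
    then show ?thesis
      using Cons.prems assms(3) cl twist_add[OF assms(2), of "\<lambda>m. fst e \<odot>\<^bsub>L\<^esub> h (m * snd e)" "twist L es h"]
      by simp
  qed
  also have "twist L es' (\<lambda>m. fst e \<odot>\<^bsub>L\<^esub> h (m * snd e)) m = fst e \<odot>\<^bsub>L\<^esub> twist L es' h (m * snd e)"
    using Cons.prems assms twist_smult[OF assms(2), of "\<lambda>m. h (m * snd e)" "fst e"] by (simp add: twist_shift)
  finally show ?case using Cons by simp
qed

lemma twist_comp:
  assumes "fst ` set es \<subseteq> carrier K" "fst ` set es' \<subseteq> carrier K" "\<And>m. h m \<in> carrier L"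
  shows "twist L (comp_twist K es es') h m = twist L es (twist L es' h) m"
  using assms(1)
proof (induction es)
  case (Cons e es)
  let ?f = "\<lambda>e'. (fst e \<otimes>\<^bsub>K\<^esub> fst e', snd e * snd e')"
  have e: "fst e \<in> carrier K" using Cons.prems by simp
  have "twist L (map ?f fs) h m = fst e \<odot>\<^bsub>L\<^esub> twist L fs h (m * snd e)"
    if "fst ` set fs \<subseteq> carrier K" for fs
    using that e assms(3) by (induction fs) (auto simp: twist_closed smult_r_distr smult_assoc1 mult.assoc)
  moreover have "fst ` set (map ?f es') \<subseteq> carrier K" using assms(2) e by auto
  ultimately show ?case
    using Cons assms(2,3) by (simp add: twist_append K.comp_twist_closed)
qed simp

lemma twist_pow_shift:
  "twist L (pow_twist K p as (\<mu> * \<nu>)) h m = twist L (pow_twist K p as \<nu>) h (m * \<mu>)"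
  by (induction as arbitrary: \<nu>) (auto simp: mult.assoc)

text \<open>The divided difference times \<open>X - \<theta>\<close> is
  \<open>f(X) - f(\<theta>)\<close>, rearranged to avoid subtraction; \<open>X\<close> acts by
  shifting \<open>m\<close> to \<open>m * p\<close>.\<close>

lemma twist_diff:
  assumes \<theta>: "\<theta> \<in> carrier K" and h: "\<And>m. h m \<in> carrier L"
  shows "twist L (diff_twist K \<theta> p as) h (m * p) \<oplus>\<^bsub>L\<^esub> list_eval K \<theta> as \<odot>\<^bsub>L\<^esub> h m =
    \<theta> \<odot>\<^bsub>L\<^esub> twist L (diff_twist K \<theta> p as) h m \<oplus>\<^bsub>L\<^esub> twist L (pow_twist K p as 1) h m"
proof (induction as)
  case Nil
  then show ?case using \<theta> h by simp
next
  case (Cons a as)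
  define q where "q m = twist L (pow_twist K p as 1) h m" for m
  define d where "d m = twist L (diff_twist K \<theta> p as) h m" for m
  have cl: "q m \<in> carrier L" "d m \<in> carrier L" for m
    unfolding q_def d_def by (intro twist_closed K.pow_twist_closed K.diff_twist_closed \<theta> h)+
  have ev: "list_eval K \<theta> as \<in> carrier K" using \<theta> by simp
  have d': "twist L (diff_twist K \<theta> p (a # as)) h m = q m \<oplus>\<^bsub>L\<^esub> \<theta> \<odot>\<^bsub>L\<^esub> d m" for m
    using \<theta> h K.pow_twist_closed K.diff_twist_closed K.scale_twist_closed
    by (simp add: twist_append twist_scale q_def d_def)
  have q': "twist L (pow_twist K p (a # as) 1) h m = int_scalar K a \<odot>\<^bsub>L\<^esub> h m \<oplus>\<^bsub>L\<^esub> q (m * p)"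
    using twist_pow_shift[of p as p 1 h m] by (simp add: q_def)
  have IH: "\<theta> \<odot>\<^bsub>L\<^esub> d (m * p) \<oplus>\<^bsub>L\<^esub> \<theta> \<odot>\<^bsub>L\<^esub> (list_eval K \<theta> as \<odot>\<^bsub>L\<^esub> h m) = \<theta> \<odot>\<^bsub>L\<^esub> (\<theta> \<odot>\<^bsub>L\<^esub> d m) \<oplus>\<^bsub>L\<^esub> \<theta> \<odot>\<^bsub>L\<^esub> q m"
    using Cons cl \<theta> h ev by (simp add: q_def d_def flip: smult_r_distr)
  have "(q (m * p) \<oplus>\<^bsub>L\<^esub> \<theta> \<odot>\<^bsub>L\<^esub> d (m * p)) \<oplus>\<^bsub>L\<^esub> list_eval K \<theta> (a # as) \<odot>\<^bsub>L\<^esub> h m =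
      (q (m * p) \<oplus>\<^bsub>L\<^esub> int_scalar K a \<odot>\<^bsub>L\<^esub> h m) \<oplus>\<^bsub>L\<^esub>
      (\<theta> \<odot>\<^bsub>L\<^esub> d (m * p) \<oplus>\<^bsub>L\<^esub> \<theta> \<odot>\<^bsub>L\<^esub> (list_eval K \<theta> as \<odot>\<^bsub>L\<^esub> h m))"
    using cl \<theta> h ev by (simp add: smult_l_distr smult_assoc1 M.a_ac)
  also have "\<dots> = \<theta> \<odot>\<^bsub>L\<^esub> (q m \<oplus>\<^bsub>L\<^esub> \<theta> \<odot>\<^bsub>L\<^esub> d m) \<oplus>\<^bsub>L\<^esub> (int_scalar K a \<odot>\<^bsub>L\<^esub> h m \<oplus>\<^bsub>L\<^esub> q (m * p))"
    unfolding IH using cl \<theta> h by (simp add: smult_r_distr M.a_ac)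
  finally show ?case unfolding d' q' .
qed

text \<open>Where the family is already linear at the names that occur, averaging only multiplies by
  the weight. With weight 1 it changes nothing.\<close>

lemma twist_eigen:
  assumes "fst ` set es \<subseteq> carrier K" "v \<in> carrier L" "\<And>m. \<kappa> m \<in> carrier K"
    and "\<And>e. e \<in> set es \<Longrightarrow> h (m * snd e) = \<kappa> (snd e) \<odot>\<^bsub>L\<^esub> v"
  shows "twist L es h m = twist_weight K \<kappa> es \<odot>\<^bsub>L\<^esub> v"
  using assms(1,4)
proof (induction es)
  case (Cons e es)
  have "twist_weight K \<kappa> es \<in> carrier K"
    using Cons.prems(1) by (induction es) (auto simp: assms(3))
  then show ?case using Cons assms(2,3) by (simp add: smult_l_distr smult_assoc1)
qed (use assms in simp)

lemma twist_hom:
  assumes "lie_algebra K M" "\<phi> \<in> lie_hom K L M" "fst ` set es \<subseteq> carrier K" "\<And>m. h m \<in> carrier L"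
  shows "\<phi> (twist L es h m) = twist M es (\<lambda>m. \<phi> (h m)) m"
  using assms(3)
proof (induction es)
  case Nil
  show ?case using lie_hom_zero[OF lie_algebra_axioms assms(1,2)] by simp
next
  case (Cons e es)
  then show ?case using assms(4) by (simp add: lie_homD[OF assms(2)] twist_closed)
qed

lemma twist_bracket_left:
  assumes "fst ` set es \<subseteq> carrier K" "\<And>m. h m \<in> carrier L" "v \<in> carrier L"
  shows "bracket L (twist L es h m) v = twist L es (\<lambda>m. bracket L (h m) v) m"
  using assms by (induction es) (auto simp: twist_closed bracket_add_left bracket_smult_left)

lemma twist_bracket_right:
  assumes "fst ` set es \<subseteq> carrier K" "\<And>m. h m \<in> carrier L" "v \<in> carrier L"
  shows "bracket L v (twist L es h m) = twist L es (\<lambda>m. bracket L v (h m)) m"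
  using assms by (induction es) (auto simp: twist_closed bracket_add_right bracket_smult_right)

text \<open>The idempotent is the product of the divided differences of the \<open>f_j\<close> at
  \<open>\<theta>_j = \<kappa> p_j\<close>, each divided by \<open>f_j'(\<theta>_j)\<close>. A
  factor times \<open>X_j - \<theta>_j\<close> is a multiple of \<open>f_j(X_j)\<close>, which
  annihilates the family. One list \<open>es\<close> serves all families \<open>h\<close>, so that
  sums and brackets of families can be averaged consistently.\<close>

theorem separability_twist:
  assumes \<kappa>: "\<And>m. \<kappa> m \<in> carrier K" "\<kappa> 1 = \<one>\<^bsub>K\<^esub>" "\<And>m m'. \<kappa> (m * m') = \<kappa> m \<otimes>\<^bsub>K\<^esub> \<kappa> m'"
    and eqs: "\<And>p as. (p, as) \<in> set cs \<Longrightarrow> list_eval K (\<kappa> p) as = \<zero>\<^bsub>K\<^esub> \<and> list_deriv K (\<kappa> p) as \<noteq> \<zero>\<^bsub>K\<^esub>"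
  shows "\<exists>es. fst ` set es \<subseteq> carrier K \<and> set es \<subseteq> UNIV \<times> monomials (fst ` set cs) \<and>
    twist_weight K \<kappa> es = \<one>\<^bsub>K\<^esub> \<and>
    (\<forall>h. (\<forall>m. h m \<in> carrier L) \<longrightarrow> (\<forall>(p, as)\<in>set cs. \<forall>m. twist L (pow_twist K p as 1) h m = \<zero>\<^bsub>L\<^esub>) \<longrightarrow>
      (\<forall>(p, as)\<in>set cs. \<forall>m. twist L es h (m * p) = \<kappa> p \<odot>\<^bsub>L\<^esub> twist L es h m))"
  using eqs
proof (induction cs)
  case Nil
  show ?case
    by (intro exI[of _ "[(\<one>\<^bsub>K\<^esub>, 1)]"]) (auto simp: \<kappa>(2)[simplified] monomials.one[simplified])
next
  case (Cons c cs)
  obtain p as where c: "c = (p, as)" by (cases c)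
  have prems: "\<And>p as. (p, as) \<in> set cs \<Longrightarrow>
      list_eval K (\<kappa> p) as = \<zero>\<^bsub>K\<^esub> \<and> list_deriv K (\<kappa> p) as \<noteq> \<zero>\<^bsub>K\<^esub>"
    using Cons.prems by auto
  obtain es where es: "fst ` set es \<subseteq> carrier K" "set es \<subseteq> UNIV \<times> monomials (fst ` set cs)"
    "twist_weight K \<kappa> es = \<one>\<^bsub>K\<^esub>"
    and all: "\<forall>h. (\<forall>m. h m \<in> carrier L) \<longrightarrow>
      (\<forall>(p, as)\<in>set cs. \<forall>m. twist L (pow_twist K p as 1) h m = \<zero>\<^bsub>L\<^esub>) \<longrightarrow>
      (\<forall>(p, as)\<in>set cs. \<forall>m. twist L es h (m * p) = \<kappa> p \<odot>\<^bsub>L\<^esub> twist L es h m)"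
    by (rule exE[OF Cons.IH], erule prems, elim conjE, rule that)
  have tw: "twist L es h (m * p) = \<kappa> p \<odot>\<^bsub>L\<^esub> twist L es h m"
    if h: "\<And>m. h m \<in> carrier L" and mem: "(p, as) \<in> set cs"
      and rel: "\<And>p as m. (p, as) \<in> set cs \<Longrightarrow> twist L (pow_twist K p as 1) h m = \<zero>\<^bsub>L\<^esub>" for h p as m
  proof -
    have "\<forall>(p, as)\<in>set cs. \<forall>m. twist L (pow_twist K p as 1) h m = \<zero>\<^bsub>L\<^esub>" using rel by auto
    with all h have "\<forall>(p, as)\<in>set cs. \<forall>m. twist L es h (m * p) = \<kappa> p \<odot>\<^bsub>L\<^esub> twist L es h m" by blast
    then show ?thesis using mem by auto
  qed
  define \<theta> where "\<theta> = \<kappa> p"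
  have \<theta>: "\<theta> \<in> carrier K" "list_eval K \<theta> as = \<zero>\<^bsub>K\<^esub>" "list_deriv K \<theta> as \<noteq> \<zero>\<^bsub>K\<^esub>"
    using Cons.prems[of p as] \<kappa>(1) by (auto simp: c \<theta>_def)
  \<comment> \<open>The weight of the divided difference is the derivative; dividing by it
    normalises the weight to 1.\<close>
  define \<delta> where "\<delta> = inv\<^bsub>K\<^esub> (list_deriv K \<theta> as)"
  have u: "list_deriv K \<theta> as \<in> Units K" using \<theta> K.field_Units by auto
  then have \<delta>: "\<delta> \<in> carrier K" "\<delta> \<otimes>\<^bsub>K\<^esub> list_deriv K \<theta> as = \<one>\<^bsub>K\<^esub>" by (auto simp: \<delta>_def)
  define fs where "fs = scale_twist K \<delta> (diff_twist K \<theta> p as)"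
  have fs: "fst ` set fs \<subseteq> carrier K" "set fs \<subseteq> UNIV \<times> monomials (fst ` set (c # cs))"
  proof -
    show "fst ` set fs \<subseteq> carrier K"
      unfolding fs_def by (rule K.scale_twist_closed[OF \<delta>(1) K.diff_twist_closed[OF \<theta>(1)]])
    have "set (diff_twist K \<theta> p as) \<subseteq> UNIV \<times> monomials (fst ` set (c # cs))"
      by (rule diff_twist_monomials) (simp add: c)
    then show "set fs \<subseteq> UNIV \<times> monomials (fst ` set (c # cs))"
      by (auto simp: fs_def scale_twist_def)
  qed
  have es': "set es \<subseteq> UNIV \<times> monomials (fst ` set (c # cs))"
    using es(2) monomials_mono[of "fst ` set cs" "fst ` set (c # cs)"] by auto
  have wt: "twist_weight K \<kappa> fs = \<one>\<^bsub>K\<^esub>"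
    unfolding fs_def K.twist_weight_scale[where \<kappa> = \<kappa>, OF \<kappa> \<delta>(1) K.diff_twist_closed[OF \<theta>(1)]]
      K.twist_weight_diff[where \<kappa> = \<kappa>, OF \<kappa> \<theta>(1) \<theta>_def[symmetric]]
    by (rule \<delta>(2))
  have fs_twist: "twist L fs h (m * p) = \<theta> \<odot>\<^bsub>L\<^esub> twist L fs h m"
    if h: "\<And>m. h m \<in> carrier L" "\<And>m. twist L (pow_twist K p as 1) h m = \<zero>\<^bsub>L\<^esub>" for h m
  proof -
    have dc: "fst ` set (diff_twist K \<theta> p as) \<subseteq> carrier K" using \<theta>(1) by (rule K.diff_twist_closed)
    then have cl: "twist L (diff_twist K \<theta> p as) h m \<in> carrier L" for m using h by (intro twist_closed)
    have "twist L (diff_twist K \<theta> p as) h (m * p) = \<theta> \<odot>\<^bsub>L\<^esub> twist L (diff_twist K \<theta> p as) h m"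
      using twist_diff[where h = h, OF \<theta>(1) h(1), of p as m] h cl \<theta> by simp
    then show ?thesis
      using twist_scale[where h = h, OF \<delta>(1) dc h(1)] \<delta>(1) \<theta>(1) cl K.m_comm[of \<delta> \<theta>]
      by (simp add: fs_def flip: smult_assoc1)
  qed
  show ?case
  proof (intro exI[of _ "comp_twist K fs es"] conjI allI impI ballI)
    show "fst ` set (comp_twist K fs es) \<subseteq> carrier K"
      by (rule K.comp_twist_closed[OF fs(1) es(1)])
    show "set (comp_twist K fs es) \<subseteq> UNIV \<times> monomials (fst ` set (c # cs))"
      by (rule comp_twist_monomials[OF fs(2) es'])
    show "twist_weight K \<kappa> (comp_twist K fs es) = \<one>\<^bsub>K\<^esub>"
      using K.twist_weight_comp[where \<kappa> = \<kappa>, OF \<kappa> fs(1) es(1)] wt es(3) by simp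
    fix h x
    assume h: "\<forall>m. h m \<in> carrier L"
      and rel: "\<forall>(p, as)\<in>set (c # cs). \<forall>m. twist L (pow_twist K p as 1) h m = \<zero>\<^bsub>L\<^esub>"
      and x: "x \<in> set (c # cs)"
    obtain q bs where qb: "x = (q, bs)" by (cases x)
    define g where "g = twist L es h"
    have g: "g m \<in> carrier L" for m unfolding g_def using h es(1) by (intro twist_closed) auto
    have comp: "twist L (comp_twist K fs es) h m = twist L fs g m" for m
      using twist_comp[OF fs(1) es(1), of h m] h by (simp add: g_def)
    have "twist L fs g (m * q) = \<kappa> q \<odot>\<^bsub>L\<^esub> twist L fs g m" for m
    proof (cases "x = c")
      case True
      then have "q = p" using qb c by simp
      \<comment> \<open>The equation of \<open>p\<close> is inherited by the family averaged over
        the other generators.\<close>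
      moreover have "twist L (pow_twist K p as 1) g m = \<zero>\<^bsub>L\<^esub>" for m
      proof -
        have "twist L (pow_twist K p as 1) g m = twist L es (twist L (pow_twist K p as 1) h) m"
          unfolding g_def using es(1) h K.pow_twist_closed by (intro twist_commute) auto
        also have "twist L (pow_twist K p as 1) h = (\<lambda>m. \<zero>\<^bsub>L\<^esub>)" using rel by (auto simp: c fun_eq_iff)
        finally show ?thesis using twist_zero[OF es(1)] by simp
      qed
      ultimately show ?thesis using fs_twist[of g m] g by (simp add: \<theta>_def)
    next
      case False
      then have "(q, bs) \<in> set cs" using x qb by auto
      then have gq: "g (m * q) = \<kappa> q \<odot>\<^bsub>L\<^esub> g m" for m
        unfolding g_def using h rel by (intro tw[of h q bs m]) auto
      \<comment> \<open>Conversely, linearity already gained for \<open>q\<close> is not lost, since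
        a twist commutes with shifts and scalars.\<close>
      have "twist L fs g (m * q) = twist L fs (\<lambda>m. g (m * q)) m" by (rule twist_shift[symmetric])
      also have "\<dots> = \<kappa> q \<odot>\<^bsub>L\<^esub> twist L fs g m"
        unfolding gq by (rule twist_smult[where h = g, OF fs(1) g \<kappa>(1)])
      finally show ?thesis .
    qed
    then show "case x of (p, as) \<Rightarrow> \<forall>m. twist L (comp_twist K fs es) h (m * p) =
        \<kappa> p \<odot>\<^bsub>L\<^esub> twist L (comp_twist K fs es) h m"
      by (simp add: qb comp)
  qed
qed

end


section \<open>Names\<close>

abbreviation pe :: "nat \<Rightarrow> nat \<Rightarrow> nat" where "pe a b \<equiv> prod_encode (a, b)"

text \<open>
  Codes of formal expressions. The first four agree with \<open>term_encode\<close>; the others stand for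
  \<open>\<kappa> m\<close> times \<open>x\<close>, for the product of \<open>x\<close> with the scalar coded by \<open>c\<close> relative to the list
  \<open>drop j bs\<close>, for \<open>prime_decode q\<close> times \<open>x\<close>, and for \<open>k\<close> times \<open>x\<close>.
\<close>

abbreviation "cZero \<equiv> pe (Suc 0) 0"
abbreviation "cAdd x y \<equiv> pe 2 (pe x y)"
abbreviation "cSmult c x \<equiv> pe 3 (pe c x)"
abbreviation "cBrk x y \<equiv> pe 4 (pe x y)"
abbreviation "cMul m x \<equiv> pe 5 (pe m x)"
abbreviation "cComb j c x \<equiv> pe 6 (pe j (pe c x))"
abbreviation "cFrac q x \<equiv> pe 7 (pe q x)"
abbreviation "cInt k x \<equiv> pe 8 (pe k x)"

text \<open>The polynomial \<open>as\<close>, with coefficients passed through \<open>f\<close>,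
  applied to \<open>x\<close> when \<open>p\<close> names the variable. With \<open>nat a\<close>
  and \<open>nat (- a)\<close> as coefficients it yields the positive and the negative part.\<close>

primrec cLin :: "(int \<Rightarrow> nat) \<Rightarrow> nat \<Rightarrow> int list \<Rightarrow> nat \<Rightarrow> nat \<Rightarrow> nat" where
  "cLin f p [] \<mu> x = cZero"
| "cLin f p (a # as) \<mu> x = cAdd (cInt (f a) (cMul \<mu> x)) (cLin f p as (\<mu> * p) x)"

text \<open>
  The junk value \<open>0\<close> of \<open>prime_decode\<close> for a denominator vanishing in \<open>K\<close> is accounted for by
  replacing the equation \<open>(b + 1) y = a x\<close> by \<open>1 y = 0 x\<close>.
\<close>

definition den :: "nat \<Rightarrow> nat \<Rightarrow> nat" where
  "den chr b = (if Suc b mod chr = 0 then 1 else Suc b)"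

definition num :: "nat \<Rightarrow> nat \<Rightarrow> nat \<Rightarrow> nat" where
  "num chr b v = (if Suc b mod chr = 0 then 0 else v)"

text \<open>Every scalar operation is reduced to additions and \<open>cMul\<close>: lists of
  coefficients are unfolded one by one, natural multiples are repeated sums, and fractions are fixed
  by multiplying with the denominator. Even and odd numerators code nonnegative and negative
  integers; the negative ones are moved to the other side, as only natural multiples have codes. The
  last rule is \<open>f_j(b_j) = 0\<close>, split likewise. The first rule forces the name of zero
  to be zero.\<close>

inductive name_eq :: "(nat \<Rightarrow> nat) \<Rightarrow> nat \<Rightarrow> (nat \<Rightarrow> int list) \<Rightarrow> nat \<Rightarrow> nat \<Rightarrow> nat \<Rightarrow> bool"
  for pj chr eqs d where
  "name_eq pj chr eqs d (cAdd cZero cZero) cZero"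
| "name_eq pj chr eqs d (cMul 0 x) cZero"
| "name_eq pj chr eqs d (cSmult c x) (cComb 0 c x)"
| "name_eq pj chr eqs d (cComb j 0 x) cZero"
| "name_eq pj chr eqs d (cComb j (Suc (pe q c)) x) (cAdd (cFrac q (cMul (pj j) x)) (cComb (Suc j) c x))"
| "name_eq pj chr eqs d (cInt 0 x) cZero"
| "name_eq pj chr eqs d (cInt (Suc k) x) (cAdd x (cInt k x))"
| "name_eq pj chr eqs d (cInt (den chr b) (cFrac (pe (2 * v) b) x)) (cInt (num chr b v) x)"
| "name_eq pj chr eqs d
    (cAdd (cInt (den chr b) (cFrac (pe (Suc (2 * v)) b) x)) (cInt (num chr b (Suc v)) x)) cZero"
| "j < d \<Longrightarrow> name_eq pj chr eqs d
    (cLin nat (pj j) (eqs j) 1 x) (cLin (\<lambda>a. nat (- a)) (pj j) (eqs j) 1 x)"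

lemma int_decode_double: "int_decode (2 * v) = int v" "int_decode (Suc (2 * v)) = - int (Suc v)"
  by (simp_all add: int_decode_def sum_decode_def)

text \<open>Natural numbers serve as multiplicative names of scalars, \<open>pj j\<close> being the
  name of \<open>bs ! j\<close>. Characteristic 0 is \<open>chr = 0\<close>, by
  \<open>k mod 0 = k\<close>. The padding of \<open>pj\<close> by 0 makes surplus coefficients
  contribute nothing, in agreement with \<open>combine\<close>, which drops them.\<close>

locale scalar_coding = field K for K :: "('k, 'r) ring_scheme" (structure) +
  fixes bs :: "'k list" and \<kappa> :: "nat \<Rightarrow> 'k" and pj :: "nat \<Rightarrow> nat" and chr :: nat
    and eqs :: "nat \<Rightarrow> int list"
  assumes bs: "set bs \<subseteq> carrier K"
    and \<kappa>: "\<And>m. \<kappa> m \<in> carrier K" "\<kappa> 1 = \<one>" "\<And>m m'. \<kappa> (m * m') = \<kappa> m \<otimes> \<kappa> m'"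
    and \<kappa>_0: "\<kappa> 0 = \<zero>"
    and \<kappa>_pj: "\<And>j. j < length bs \<Longrightarrow> \<kappa> (pj j) = bs ! j"
    and pj_0: "\<And>j. j \<ge> length bs \<Longrightarrow> pj j = 0"
    and chr: "\<And>k. int_scalar K (int k) = \<zero> \<longleftrightarrow> k mod chr = 0"
    and eqs: "\<And>j. j < length bs \<Longrightarrow> list_eval K (bs ! j) (eqs j) = \<zero> \<and> list_deriv K (bs ! j) (eqs j) \<noteq> \<zero>"
begin

lemma prime_decode_closed [simp]: "prime_decode K c \<in> carrier K"
  using field_Units by (auto simp: prime_decode_def Let_def split: prod.split)

lemma combine_decode_closed [simp]: "combine (map (prime_decode K) cs) (drop j bs) \<in> carrier K"
  using bs by (intro combine_in_carrier) (auto dest: in_set_dropD)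

lemma scalar_decode_closed [simp]: "scalar_decode K bs c \<in> carrier K"
  using combine_decode_closed[of "list_decode c" 0] by (simp add: scalar_decode_def)

lemma prime_decode_eq:
  "prime_decode K (pe a b) = (if Suc b mod chr = 0 then \<zero> else
    int_scalar K (int_decode a) \<otimes> inv (int_scalar K (int (Suc b))))"
  unfolding prime_decode_def int_scalar_nat[symmetric] using chr[of "Suc b"]
  by (simp add: Let_def del: of_nat_Suc)

lemma prime_decode_even:
  "int_scalar K (int (den chr b)) \<otimes> prime_decode K (pe (2 * v) b) = int_scalar K (int (num chr b v))"
proof (cases "Suc b mod chr = 0")
  case False
  then have "int_scalar K (int (Suc b)) \<in> Units K" using chr[of "Suc b"] field_Units by auto
  then show ?thesis using False
    by (simp add: prime_decode_eq den_def num_def int_decode_double m_lcomm del: of_nat_Suc)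
qed (simp add: prime_decode_eq den_def num_def)

lemma prime_decode_odd:
  "int_scalar K (int (den chr b)) \<otimes> prime_decode K (pe (Suc (2 * v)) b) \<oplus>
    int_scalar K (int (num chr b (Suc v))) = \<zero>"
proof (cases "Suc b mod chr = 0")
  case False
  then have "int_scalar K (int (Suc b)) \<in> Units K" using chr[of "Suc b"] field_Units by auto
  then have "int_scalar K (int (Suc b)) \<otimes> (\<ominus> x \<otimes> inv (int_scalar K (int (Suc b)))) = \<ominus> x"
    if "x \<in> carrier K" for x
    using that m_lcomm[of "int_scalar K (int (Suc b))" "\<ominus> x"] by simp
  then show ?thesis using False
    by (simp add: prime_decode_eq den_def num_def int_decode_double int_scalar_minus l_neg
        del: of_nat_Suc)
qed (simp add: prime_decode_eq den_def num_def)

lemma den_nonzero: "int_scalar K (int (den chr b)) \<in> Units K"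
proof (cases "Suc b mod chr = 0")
  case False
  then have "int_scalar K (int (Suc b)) \<in> Units K" using chr[of "Suc b"] field_Units by auto
  then show ?thesis using False by (simp add: den_def del: of_nat_Suc)
qed (simp add: den_def)

end

subsection \<open>Linear maps from names\<close>

text \<open>\<open>H x m\<close> is the element named as \<open>\<kappa> m\<close> times
  \<open>x\<close>. The conditions on \<open>H\<close> are equations between such elements, their
  sums and their brackets; none involves the scalar action of \<open>V\<close>.\<close>

locale name_system = scalar_coding K bs \<kappa> pj chr eqs + V: lie_algebra K V
  for K :: "('k, 'r) ring_scheme" (structure) and bs \<kappa> pj chr eqs
    and V :: "('k, 'v, 'm) lie_algebra_scheme" +
  fixes H :: "nat \<Rightarrow> nat \<Rightarrow> 'v"
  assumes H_closed: "H x m \<in> carrier V"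
    and H_add: "H (cAdd x y) m = H x m \<oplus>\<^bsub>V\<^esub> H y m"
    and H_brk: "bracket V (H x m) (H y m') = H (cBrk x y) (m * m')"
    and H_mul: "H (cMul \<mu> x) m = H x (m * \<mu>)"
    and H_eq: "name_eq pj chr eqs (length bs) x y \<Longrightarrow> H x m = H y m"
begin

lemma H_zero: "H cZero m = \<zero>\<^bsub>V\<^esub>"
proof (rule V.zero_if_double[OF H_closed])
  show "H cZero m \<oplus>\<^bsub>V\<^esub> H cZero m = H cZero m"
    unfolding H_add[symmetric] by (rule H_eq) (rule name_eq.intros)
qed

lemma H_at_zero: "H x 0 = \<zero>\<^bsub>V\<^esub>"
proof -
  have "H x 0 = H (cMul 0 x) 1" by (simp add: H_mul)
  also have "\<dots> = H cZero 1" by (rule H_eq) (rule name_eq.intros)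
  finally show ?thesis by (simp add: H_zero)
qed

lemma H_int: "H (cInt k x) m = int_scalar K (int k) \<odot>\<^bsub>V\<^esub> H x m"
proof (induction k)
  case 0
  have "H (cInt 0 x) m = H cZero m" by (rule H_eq) (rule name_eq.intros)
  then show ?case by (simp add: H_zero H_closed)
next
  case (Suc k)
  have "H (cInt (Suc k) x) m = H (cAdd x (cInt k x)) m" by (rule H_eq) (rule name_eq.intros)
  also have "\<dots> = int_scalar K (1 + int k) \<odot>\<^bsub>V\<^esub> H x m"
    unfolding int_scalar_add H_add Suc by (simp add: H_closed V.smult_l_distr)
  finally show ?case by simp
qed

text \<open>Over the prime subfield no averaging is required: additivity determines integer
  multiples, and the denominator acts invertibly on \<open>V\<close>.\<close>

lemma H_frac: "H (cFrac q x) m = prime_decode K q \<odot>\<^bsub>V\<^esub> H x m"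
proof -
  obtain a b where q: "q = pe a b" by (metis pfst_psnd(3))
  define y where "y = H (cFrac q x) m"
  have y: "y \<in> carrier V" by (simp add: y_def H_closed)
  define z where "z = prime_decode K q \<odot>\<^bsub>V\<^esub> H x m"
  have z: "z \<in> carrier V" by (simp add: z_def H_closed)
  have "int_scalar K (int (den chr b)) \<odot>\<^bsub>V\<^esub> y = int_scalar K (int (den chr b)) \<odot>\<^bsub>V\<^esub> z"
  proof (cases "even a")
    case True
    then obtain v where a: "a = 2 * v" by (rule evenE)
    have "int_scalar K (int (den chr b)) \<odot>\<^bsub>V\<^esub> y = H (cInt (den chr b) (cFrac (pe (2 * v) b) x)) m"
      by (simp add: H_int y_def q a)
    also have "\<dots> = H (cInt (num chr b v) x) m" by (rule H_eq) (rule name_eq.intros)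
    also have "\<dots> = int_scalar K (int (den chr b)) \<odot>\<^bsub>V\<^esub> z"
      by (simp add: H_int z_def q a prime_decode_even H_closed flip: V.smult_assoc1)
    finally show ?thesis .
  next
    case False
    then obtain v where a: "a = Suc (2 * v)" by (metis oddE Suc_eq_plus1)
    let ?s = "int_scalar K (int (num chr b (Suc v))) \<odot>\<^bsub>V\<^esub> H x m"
    have "int_scalar K (int (den chr b)) \<odot>\<^bsub>V\<^esub> y \<oplus>\<^bsub>V\<^esub> ?s =
        H (cAdd (cInt (den chr b) (cFrac (pe (Suc (2 * v)) b) x)) (cInt (num chr b (Suc v)) x)) m"
      by (simp add: H_int H_add y_def q a)
    also have "\<dots> = H cZero m" by (rule H_eq) (rule name_eq.intros)
    also have "\<dots> = int_scalar K (int (den chr b)) \<odot>\<^bsub>V\<^esub> z \<oplus>\<^bsub>V\<^esub> ?s"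
      using prime_decode_odd[of b v]
      by (simp add: z_def q a H_zero H_closed flip: V.smult_assoc1 V.smult_l_distr)
    finally show ?thesis using y z by (simp add: H_closed)
  qed
  then have "inv (int_scalar K (int (den chr b))) \<odot>\<^bsub>V\<^esub> (int_scalar K (int (den chr b)) \<odot>\<^bsub>V\<^esub> y) =
      inv (int_scalar K (int (den chr b))) \<odot>\<^bsub>V\<^esub> (int_scalar K (int (den chr b)) \<odot>\<^bsub>V\<^esub> z)"
    by simp
  then show ?thesis
    using y z den_nonzero[of b] by (simp add: y_def z_def flip: V.smult_assoc1)
qed

text \<open>Since \<open>a = nat a - nat (- a)\<close>, the difference of the two parts is the
  action of the polynomial itself.\<close>

lemma H_lin:
  "H (cLin nat p as \<mu> x) m =
    twist V (pow_twist K p as \<mu>) (H x) m \<oplus>\<^bsub>V\<^esub> H (cLin (\<lambda>a. nat (- a)) p as \<mu> x) m"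
proof (induction as arbitrary: \<mu>)
  case Nil
  show ?case by (simp add: H_zero)
next
  case (Cons a as)
  have tw: "twist V (pow_twist K p as \<nu>) (H x) m \<in> carrier V" for \<nu>
    by (intro V.twist_closed pow_twist_closed H_closed)
  have "int_scalar K (int (nat a)) = int_scalar K (a + int (nat (- a)))"
    by (rule arg_cong[where f = "int_scalar K"]) simp
  then have "int_scalar K (int (nat a)) = int_scalar K a \<oplus> int_scalar K (int (nat (- a)))"
    by (simp add: int_scalar_add)
  then show ?case
    using tw by (simp add: H_add H_int H_mul Cons H_closed V.smult_l_distr V.M.a_ac del: int_nat_eq)
qed

lemma H_separable:
  assumes "j < length bs"
  shows "twist V (pow_twist K (pj j) (eqs j) 1) (H x) m = \<zero>\<^bsub>V\<^esub>"
proof -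
  have "H (cLin nat (pj j) (eqs j) 1 x) m = H (cLin (\<lambda>a. nat (- a)) (pj j) (eqs j) 1 x) m"
    by (rule H_eq) (rule name_eq.intros, rule assms)
  moreover have "twist V (pow_twist K (pj j) (eqs j) 1) (H x) m \<in> carrier V"
    by (intro V.twist_closed pow_twist_closed H_closed)
  ultimately show ?thesis
    using H_lin[of "pj j" "eqs j" 1 x m] H_closed by simp
qed

text \<open>
  The averaged family respects the scalars, at least the monomials in the \<open>bs ! j\<close>, and these
  suffice because all expressions are built from them.
\<close>

theorem linear_name_map:
  obtains es where "fst ` set es \<subseteq> carrier K" "twist_weight K \<kappa> es = \<one>"
    "\<And>t. twist V es (H (term_encode t)) 1 =
      lie_eval V (\<lambda>i. twist V es (H (pe 0 i)) 1) (map_lie_term (scalar_decode K bs) t)"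
proof -
  define cs where "cs = map (\<lambda>j. (pj j, eqs j)) [0..<length bs]"
  have "\<And>p as. (p, as) \<in> set cs \<Longrightarrow> list_eval K (\<kappa> p) as = \<zero> \<and> list_deriv K (\<kappa> p) as \<noteq> \<zero>"
    using eqs \<kappa>_pj by (auto simp: cs_def)
  from V.separability_twist[where \<kappa> = \<kappa> and cs = cs, OF \<kappa> this]
  obtain es where es: "fst ` set es \<subseteq> carrier K" "set es \<subseteq> UNIV \<times> monomials (fst ` set cs)"
    "twist_weight K \<kappa> es = \<one>"
    and all: "\<forall>h. (\<forall>m. h m \<in> carrier V) \<longrightarrow>
      (\<forall>(p, as)\<in>set cs. \<forall>m. twist V (pow_twist K p as 1) h m = \<zero>\<^bsub>V\<^esub>) \<longrightarrow>
      (\<forall>(p, as)\<in>set cs. \<forall>m. twist V es h (m * p) = \<kappa> p \<odot>\<^bsub>V\<^esub> twist V es h m)"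
    by blast
  define \<Phi> where "\<Phi> x = twist V es (H x)" for x
  have \<Phi>_closed: "\<Phi> x m \<in> carrier V" for x m
    unfolding \<Phi>_def using es(1) H_closed by (rule V.twist_closed)
  have \<Phi>_pj: "\<Phi> x (m * pj j) = bs ! j \<odot>\<^bsub>V\<^esub> \<Phi> x m" if j: "j < length bs" for x m j
  proof -
    have "\<forall>(p, as)\<in>set cs. \<forall>m. twist V (pow_twist K p as 1) (H x) m = \<zero>\<^bsub>V\<^esub>"
      using H_separable by (auto simp: cs_def)
    then have "\<forall>(p, as)\<in>set cs. \<forall>m. twist V es (H x) (m * p) = \<kappa> p \<odot>\<^bsub>V\<^esub> twist V es (H x) m"
      using all H_closed by blast
    then show ?thesis using j \<kappa>_pj by (auto simp: cs_def \<Phi>_def)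
  qed
  have \<Phi>_mono: "\<Phi> x m = \<kappa> m \<odot>\<^bsub>V\<^esub> \<Phi> x 1" if "m \<in> monomials (fst ` set cs)" for x m
    using that
  proof induction
    case one
    show ?case using \<Phi>_closed[of x 1] \<kappa>(2) by simp
  next
    case (mult m p)
    then obtain j where j: "j < length bs" "p = pj j" by (auto simp: cs_def)
    have "bs ! j \<in> carrier K" using bs j by auto
    then show ?case
      using mult.IH \<Phi>_pj[OF j(1)] \<kappa> \<kappa>_pj[OF j(1)] \<Phi>_closed m_comm[of "bs ! j" "\<kappa> m"]
      by (simp add: j(2) flip: V.smult_assoc1)
  qed
  have \<Phi>_add: "\<Phi> (cAdd x y) m = \<Phi> x m \<oplus>\<^bsub>V\<^esub> \<Phi> y m" for x y m
    unfolding \<Phi>_def using V.twist_add[where h = "H x" and h' = "H y", OF es(1) H_closed H_closed]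
    by (simp flip: H_add)
  have \<Phi>_zero: "\<Phi> cZero m = \<zero>\<^bsub>V\<^esub>" for m
    unfolding \<Phi>_def using V.twist_zero[OF es(1)] H_zero by (metis (no_types, lifting) ext)
  have \<Phi>_eq: "\<Phi> x m = \<Phi> y m" if "name_eq pj chr eqs (length bs) x y" for x y m
  proof -
    have "H x = H y" using H_eq[OF that] by (rule ext)
    then show ?thesis by (simp add: \<Phi>_def)
  qed
  have \<Phi>_mul: "\<Phi> (cMul \<mu> x) m = \<Phi> x (m * \<mu>)" for \<mu> x m
  proof -
    have "H (cMul \<mu> x) = (\<lambda>m. H x (m * \<mu>))" by (rule ext) (rule H_mul)
    then show ?thesis by (simp add: \<Phi>_def V.twist_shift)
  qed
  have \<Phi>_frac: "\<Phi> (cFrac q x) m = prime_decode K q \<odot>\<^bsub>V\<^esub> \<Phi> x m" for q x m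
  proof -
    have "H (cFrac q x) = (\<lambda>m. prime_decode K q \<odot>\<^bsub>V\<^esub> H x m)" by (rule ext) (rule H_frac)
    then show ?thesis
      using V.twist_smult[where h = "H x", OF es(1) H_closed, of "prime_decode K q"] by (simp add: \<Phi>_def)
  qed
  have \<Phi>_brk: "\<Phi> (cBrk x y) 1 = bracket V (\<Phi> x 1) (\<Phi> y 1)" for x y
  proof -
    have "bracket V (\<Phi> x 1) (\<Phi> y 1) = twist V es (\<lambda>m. bracket V (H x m) (\<Phi> y 1)) 1"
      unfolding \<Phi>_def[of x] by (rule V.twist_bracket_left[OF es(1) H_closed \<Phi>_closed])
    also have "(\<lambda>m. bracket V (H x m) (\<Phi> y 1)) = \<Phi> (cBrk x y)"
    proof
      fix m
      have "bracket V (H x m) (\<Phi> y 1) = twist V es (\<lambda>m'. bracket V (H x m) (H y m')) 1"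
        unfolding \<Phi>_def by (rule V.twist_bracket_right[OF es(1) H_closed H_closed])
      also have "\<dots> = twist V es (\<lambda>m'. H (cBrk x y) (m' * m)) 1"
        by (simp add: H_brk mult.commute)
      finally show "bracket V (H x m) (\<Phi> y 1) = \<Phi> (cBrk x y) m"
        using V.twist_shift[of es "H (cBrk x y)" m 1] by (simp add: \<Phi>_def)
    qed
    \<comment> \<open>Here the average has been applied twice. On \<Phi>, which is linear at the
      monomials occurring in \<open>es\<close>, the second application is multiplication by the
      weight.\<close>
    also have "twist V es (\<Phi> (cBrk x y)) 1 = twist_weight K \<kappa> es \<odot>\<^bsub>V\<^esub> \<Phi> (cBrk x y) 1"
      by (intro V.twist_eigen[where \<kappa> = \<kappa>] es(1) \<Phi>_closed \<kappa>(1))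
        (use subsetD[OF es(2)] \<Phi>_mono in \<open>force simp del: One_nat_def\<close>)
    finally show ?thesis using es(3) \<Phi>_closed by simp
  qed
  have \<Phi>_comb: "\<Phi> (cComb j c x) 1 = combine (map (prime_decode K) (list_decode c)) (drop j bs) \<odot>\<^bsub>V\<^esub> \<Phi> x 1"
    for j c x
  proof (induction "list_decode c" arbitrary: j c)
    case Nil
    then have "c = 0" by (metis list_decode_inverse list_encode.simps(1))
    have "\<Phi> (cComb j 0 x) 1 = \<Phi> cZero 1" by (rule \<Phi>_eq) (rule name_eq.intros)
    then show ?case using \<open>c = 0\<close> \<Phi>_closed by (simp add: \<Phi>_zero)
  next
    case (Cons q l)
    define c' where "c' = list_encode l"
    have c: "c = Suc (pe q c')" "l = list_decode c'"
      using Cons.hyps(2) by (metis c'_def list_decode_inverse list_encode.simps(2), simp add: c'_def)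
    have "\<Phi> (cComb j c x) 1 = \<Phi> (cAdd (cFrac q (cMul (pj j) x)) (cComb (Suc j) c' x)) 1"
      unfolding c(1) by (rule \<Phi>_eq) (rule name_eq.intros)
    also have "\<dots> = prime_decode K q \<odot>\<^bsub>V\<^esub> \<Phi> x (pj j) \<oplus>\<^bsub>V\<^esub>
        combine (map (prime_decode K) l) (drop (Suc j) bs) \<odot>\<^bsub>V\<^esub> \<Phi> x 1"
      using Cons.hyps(1)[OF c(2), of "Suc j"] by (simp add: \<Phi>_add \<Phi>_frac \<Phi>_mul c(2))
    also have "\<dots> = combine (map (prime_decode K) (list_decode c)) (drop j bs) \<odot>\<^bsub>V\<^esub> \<Phi> x 1"
    proof (cases "j < length bs")
      case True
      then have "bs ! j \<in> carrier K" using bs by auto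
      then show ?thesis
        using True \<Phi>_pj[OF True, of x 1] \<Phi>_closed combine_decode_closed[of l "Suc j"]
        by (simp flip: Cons.hyps(2) Cons_nth_drop_Suc add: V.smult_l_distr V.smult_assoc1)
    next
      case False
      \<comment> \<open>Past the end of \<open>bs\<close> the coefficient multiplies
        \<open>\<Phi> x 0\<close>, which vanishes because of the padding by 0.\<close>
      have "\<Phi> x 0 = \<zero>\<^bsub>V\<^esub>"
        using V.twist_shift[of es "H x" 0 1] V.twist_zero[OF es(1)] by (simp add: \<Phi>_def H_at_zero)
      then show ?thesis using False pj_0[of j] \<Phi>_closed by simp
    qed
    finally show ?case .
  qed
  have \<Phi>_smult: "\<Phi> (cSmult c x) 1 = scalar_decode K bs c \<odot>\<^bsub>V\<^esub> \<Phi> x 1" for c x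
  proof -
    have "\<Phi> (cSmult c x) 1 = \<Phi> (cComb 0 c x) 1" by (rule \<Phi>_eq) (rule name_eq.intros)
    then show ?thesis by (simp add: \<Phi>_comb[simplified] scalar_decode_def)
  qed
  have "\<Phi> (term_encode t) 1 = lie_eval V (\<lambda>i. \<Phi> (pe 0 i) 1) (map_lie_term (scalar_decode K bs) t)" for t
    by (induction t) (simp_all add: \<Phi>_zero \<Phi>_add \<Phi>_smult[simplified] \<Phi>_brk[simplified])
  then show ?thesis using that[OF es(1,3)] by (simp add: \<Phi>_def)
qed

end

subsection \<open>Values of names\<close>

lemma pfst_le: "pfst z \<le> z" "psnd z \<le> z"
  using le_prod_encode_1[of "pfst z" "psnd z"] le_prod_encode_2[of "psnd z" "pfst z"] by simp_all

text \<open>In the Cantor pairing a nonzero tag makes the code exceed its payload. This is what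
  makes the recursion of \<open>name_val\<close> terminate, as it does not descend under tag
  0.\<close>

lemma psnd_less: "pfst z \<noteq> 0 \<Longrightarrow> psnd z < z"
proof -
  assume "pfst z \<noteq> 0"
  moreover have "z = triangle (pfst z + psnd z) + pfst z"
    using pfst_psnd(3)[of z] by (simp add: prod_encode_def)
  moreover have "n \<le> triangle n" for n by (induction n) auto
  then have "pfst z + psnd z \<le> triangle (pfst z + psnd z)" .
  ultimately show ?thesis by linarith
qed

lemma components_less:
  assumes "pfst z \<noteq> 0"
  shows "pfst (psnd z) < z" "psnd (psnd z) < z" "psnd (psnd (psnd z)) < z"
  using psnd_less[OF assms] pfst_le[of "psnd z"] pfst_le[of "psnd (psnd z)"] by linarith+

function name_val :: "('k, 'r) ring_scheme \<Rightarrow> 'k list \<Rightarrow> (nat \<Rightarrow> 'k) \<Rightarrow> ('k, 'v, 'm) lie_algebra_scheme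
    \<Rightarrow> (nat \<Rightarrow> 'v) \<Rightarrow> nat \<Rightarrow> 'v" where
  "name_val K bs \<kappa> V g z = (let w = psnd z in
    if pfst z = 0 then g w
    else if pfst z = 2 then name_val K bs \<kappa> V g (pfst w) \<oplus>\<^bsub>V\<^esub> name_val K bs \<kappa> V g (psnd w)
    else if pfst z = 3 then scalar_decode K bs (pfst w) \<odot>\<^bsub>V\<^esub> name_val K bs \<kappa> V g (psnd w)
    else if pfst z = 4 then bracket V (name_val K bs \<kappa> V g (pfst w)) (name_val K bs \<kappa> V g (psnd w))
    else if pfst z = 5 then \<kappa> (pfst w) \<odot>\<^bsub>V\<^esub> name_val K bs \<kappa> V g (psnd w)
    else if pfst z = 6 then ring.combine K (map (prime_decode K) (list_decode (pfst (psnd w)))) (drop (pfst w) bs)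
      \<odot>\<^bsub>V\<^esub> name_val K bs \<kappa> V g (psnd (psnd w))
    else if pfst z = 7 then prime_decode K (pfst w) \<odot>\<^bsub>V\<^esub> name_val K bs \<kappa> V g (psnd w)
    else if pfst z = 8 then int_scalar K (int (pfst w)) \<odot>\<^bsub>V\<^esub> name_val K bs \<kappa> V g (psnd w)
    else \<zero>\<^bsub>V\<^esub>)"
  by pat_completeness auto
termination
  by (relation "measure (\<lambda>(_, _, _, _, _, z). z)") (auto simp: components_less)

declare name_val.simps [simp del]

locale name_value = scalar_coding K bs \<kappa> pj chr eqs + V: lie_algebra K V
  for K :: "('k, 'r) ring_scheme" (structure) and bs \<kappa> pj chr eqs
    and V :: "('k, 'v, 'm) lie_algebra_scheme" +
  fixes g :: "nat \<Rightarrow> 'v"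
  assumes g_closed: "g i \<in> carrier V"
begin

abbreviation "val \<equiv> name_val K bs \<kappa> V g"

lemma val_simps:
  "val (pe 0 i) = g i"
  "val cZero = \<zero>\<^bsub>V\<^esub>"
  "val (cAdd x y) = val x \<oplus>\<^bsub>V\<^esub> val y"
  "val (cSmult c x) = scalar_decode K bs c \<odot>\<^bsub>V\<^esub> val x"
  "val (cBrk x y) = bracket V (val x) (val y)"
  "val (cMul m x) = \<kappa> m \<odot>\<^bsub>V\<^esub> val x"
  "val (cComb j c x) = combine (map (prime_decode K) (list_decode c)) (drop j bs) \<odot>\<^bsub>V\<^esub> val x"
  "val (cFrac q x) = prime_decode K q \<odot>\<^bsub>V\<^esub> val x"
  "val (cInt k x) = int_scalar K (int k) \<odot>\<^bsub>V\<^esub> val x"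
  by (simp_all add: Let_def
    name_val.simps[of K bs \<kappa> V g "pe 0 i"]
    name_val.simps[of K bs \<kappa> V g "cZero"]
    name_val.simps[of K bs \<kappa> V g "cAdd x y"]
    name_val.simps[of K bs \<kappa> V g "cSmult c x"]
    name_val.simps[of K bs \<kappa> V g "cBrk x y"]
    name_val.simps[of K bs \<kappa> V g "cMul m x"]
    name_val.simps[of K bs \<kappa> V g "cComb j c x"]
    name_val.simps[of K bs \<kappa> V g "cFrac q x"]
    name_val.simps[of K bs \<kappa> V g "cInt k x"])

lemma val_closed: "val z \<in> carrier V"
proof (induction z rule: less_induct)
  case (less z)
  show ?case
    by (subst name_val.simps)
      (auto simp: Let_def g_closed \<kappa> components_less
        intro!: less.IH V.bracket_closed V.smult_closed V.M.a_closed)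
qed

lemma val_lin:
  "val (cLin nat p as \<mu> x) =
    (\<kappa> \<mu> \<otimes> list_eval K (\<kappa> p) as) \<odot>\<^bsub>V\<^esub> val x \<oplus>\<^bsub>V\<^esub> val (cLin (\<lambda>a. nat (- a)) p as \<mu> x)"
proof (induction as arbitrary: \<mu>)
  case Nil
  show ?case using \<kappa>(1) by (simp add: val_simps val_closed)
next
  case (Cons a as)
  have "int_scalar K (int (nat a)) = int_scalar K (a + int (nat (- a)))"
    by (rule arg_cong[where f = "int_scalar K"]) simp
  then have "int_scalar K (int (nat a)) = int_scalar K a \<oplus> int_scalar K (int (nat (- a)))"
    by (simp add: int_scalar_add)
  moreover have "\<kappa> \<mu> \<otimes> list_eval K (\<kappa> p) (a # as) =
      int_scalar K a \<otimes> \<kappa> \<mu> \<oplus> \<kappa> (\<mu> * p) \<otimes> list_eval K (\<kappa> p) as"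
    using \<kappa>(1) by (simp add: \<kappa>(3) r_distr m_ac)
  ultimately show ?case
    using \<kappa>(1)
    by (simp add: val_simps val_closed Cons V.smult_l_distr V.smult_assoc1 V.M.a_ac
        del: int_nat_eq list_eval.simps)
qed

text \<open>Soundness: the equations imposed on names hold for their intended values, which later
  makes the relations hold in the model.\<close>

lemma val_name_eq:
  assumes "name_eq pj chr eqs (length bs) x y"
  shows "val x = val y"
  using assms
proof cases
  case (5 j q c x)
  show ?thesis
  proof (cases "j < length bs")
    case True
    then have "bs ! j \<in> carrier K" using bs by auto
    then show ?thesis
      using True combine_decode_closed[of "list_decode c" "Suc j"]
      by (simp add: 5 val_simps val_closed \<kappa>_pj V.smult_l_distr V.smult_assoc1 flip: Cons_nth_drop_Suc)
  next
    case False
    then show ?thesis by (simp add: 5 val_simps val_closed pj_0 \<kappa>_0)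
  qed
next
  case (7 k x)
  have "int_scalar K (int (Suc k)) = \<one> \<oplus> int_scalar K (int k)"
    using int_scalar_add[of 1 "int k"] by simp
  then show ?thesis by (simp add: 7 val_simps val_closed V.smult_l_distr del: of_nat_Suc)
next
  case (8 b v x)
  show ?thesis
    by (simp add: 8 val_simps val_closed prime_decode_even flip: V.smult_assoc1)
next
  case (9 b v x)
  show ?thesis
    using prime_decode_odd[of b v]
    by (simp add: 9 val_simps val_closed flip: V.smult_assoc1 V.smult_l_distr)
next
  case (10 j x)
  then show ?thesis
    using val_lin[of "pj j" "eqs j" 1 x] eqs[of j] \<kappa> by (simp add: \<kappa>_pj val_closed)
next
  case 1
  then show ?thesis by (simp add: val_simps)
next
  case (2 u)
  then show ?thesis by (simp add: val_simps val_closed \<kappa>_0)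
next
  case (3 c u)
  show ?thesis unfolding 3 val_simps by (simp add: scalar_decode_def)
next
  case (4 j u)
  then show ?thesis by (simp add: val_simps val_closed)
next
  case (6 u)
  then show ?thesis by (simp add: val_simps val_closed)
qed

lemma val_term:
  "val (term_encode t) = lie_eval V g (map_lie_term (scalar_decode K bs) t)"
  by (induction t)
    (simp_all only: term_encode.simps One_nat_def val_simps lie_term.map lie_eval.simps id_apply)

end


section \<open>The defining relations\<close>

text \<open>The generators 0, 1, 2, 3, 4 are alpha, beta, gamma, b, f.\<close>

primrec zWord :: "nat \<Rightarrow> 'c lie_term" where
  "zWord 0 = Gen 4"
| "zWord (Suc i) = Brk (Gen 3) (zWord i)"

abbreviation aWord :: "nat \<Rightarrow> nat \<Rightarrow> 'c lie_term" where "aWord a i \<equiv> Brk (Gen a) (zWord i)"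

text \<open>The index of \<open>zWord\<close> codes two names, and alpha extracts the first. The
  second is filled with 0 to obtain one canonical word for \<open>u\<close>.\<close>

definition nmWord :: "nat \<Rightarrow> 'c lie_term" where "nmWord u = aWord 0 (pe u 0)"

text \<open>The index \<open>pe u v\<close> couples two arbitrary names: \<open>left\<close> and
  \<open>right\<close> let alpha and beta extract them, and \<open>add\<close> declares the word
  with gamma to be the name of the sum. \<open>relator\<close> makes all scalar multiples of a
  relator equal to those of zero.\<close>

inductive word_eq :: "(nat \<Rightarrow> nat \<Rightarrow> bool) \<Rightarrow> nat set \<Rightarrow> 'c lie_term \<Rightarrow> 'c lie_term \<Rightarrow> bool"
  for Q C where
  relator: "t \<in> C \<Longrightarrow> word_eq Q C (nmWord (pe m t)) (nmWord (pe m cZero))"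
| left: "word_eq Q C (aWord 0 (pe u v)) (nmWord u)"
| right: "word_eq Q C (aWord (Suc 0) (pe u v)) (nmWord v)"
| add: "word_eq Q C (aWord 2 (pe (pe m x) (pe m y))) (nmWord (pe m (cAdd x y)))"
| brk: "word_eq Q C (Brk (nmWord (pe m x)) (nmWord (pe m' y))) (nmWord (pe (m * m') (cBrk x y)))"
| mul: "word_eq Q C (nmWord (pe m (cMul \<mu> x))) (nmWord (pe (m * \<mu>) x))"
| eq: "Q x y \<Longrightarrow> word_eq Q C (nmWord (pe m x)) (nmWord (pe m y))"

primrec is_word :: "nat \<Rightarrow> 'c lie_term \<Rightarrow> bool" where
  "is_word n (Gen i) \<longleftrightarrow> i < n"
| "is_word n Zero \<longleftrightarrow> False"
| "is_word n (Add s t) \<longleftrightarrow> False"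
| "is_word n (Smult c t) \<longleftrightarrow> False"
| "is_word n (Brk s t) \<longleftrightarrow> is_word n s \<and> is_word n t"

lemma is_word_z: "is_word 5 (zWord i)"
  by (induction i) auto

lemma is_word_nm: "is_word 5 (nmWord u)"
  by (simp add: nmWord_def is_word_z)

lemma word_eq_is_word: "word_eq Q C v w \<Longrightarrow> is_word 5 v \<and> is_word 5 w"
  by (induction rule: word_eq.induct) (auto simp: is_word_z is_word_nm)

lemma map_zWord [simp]: "map_lie_term d (zWord i) = zWord i"
  by (induction i) auto

lemma map_nmWord [simp]: "map_lie_term d (nmWord u) = nmWord u"
  by (simp add: nmWord_def)

lemma is_word_map: "is_word n (map_lie_term d t) \<longleftrightarrow> is_word n t"
  by (induction t) auto

lemma is_word_terms: "is_word n t \<Longrightarrow> t \<in> lie_terms K n"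
  by (induction t) (auto intro: lie_terms.intros)

lemma (in ring) is_word_class:
  "is_word n t \<Longrightarrow> lie_class R n t \<in> lie_words (free_lie R n) (free_gens R n)"
proof (induction t)
  case (Gen i)
  then show ?case by (auto simp: free_gens_def intro: lie_words.gen)
next
  case (Brk s t)
  then have "bracket (free_lie R n) (lie_class R n s) (lie_class R n t) \<in> lie_words (free_lie R n) (free_gens R n)"
    by (intro lie_words.bracket) auto
  moreover have "s \<in> lie_terms R n" "t \<in> lie_terms R n" using Brk.prems by (auto intro: is_word_terms)
  ultimately show ?case by (simp add: free_lie_bracket)
qed auto

subsection \<open>Recursive enumerability\<close>

text \<open>The rules of \<open>name_eq\<close> in order, each as a pair of functions of one number
  into which its variables are packed; enumerability thereby reduces to recursiveness of these
  functions.\<close>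

definition name_families :: "(nat \<Rightarrow> nat) \<Rightarrow> nat \<Rightarrow> (nat \<Rightarrow> int list) \<Rightarrow> nat
    \<Rightarrow> ((nat \<Rightarrow> nat) \<times> (nat \<Rightarrow> nat)) list" where
  "name_families pj chr eqs d =
    [(\<lambda>u. cAdd cZero cZero, \<lambda>u. cZero),
     (\<lambda>u. cMul 0 u, \<lambda>u. cZero),
     (\<lambda>u. cSmult (pfst u) (psnd u), \<lambda>u. cComb 0 (pfst u) (psnd u)),
     (\<lambda>u. cComb (pfst u) 0 (psnd u), \<lambda>u. cZero),
     (\<lambda>u. cComb (pfst (pfst u)) (Suc (pe (pfst (psnd u)) (psnd (psnd u)))) (psnd (pfst u)),
      \<lambda>u. cAdd (cFrac (pfst (psnd u)) (cMul (pj (pfst (pfst u))) (psnd (pfst u))))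
        (cComb (Suc (pfst (pfst u))) (psnd (psnd u)) (psnd (pfst u)))),
     (\<lambda>u. cInt 0 u, \<lambda>u. cZero),
     (\<lambda>u. cInt (Suc (pfst u)) (psnd u), \<lambda>u. cAdd (psnd u) (cInt (pfst u) (psnd u))),
     (\<lambda>u. cInt (den chr (psnd (pfst u))) (cFrac (pe (2 * pfst (pfst u)) (psnd (pfst u))) (psnd u)),
      \<lambda>u. cInt (num chr (psnd (pfst u)) (pfst (pfst u))) (psnd u)),
     (\<lambda>u. cAdd (cInt (den chr (psnd (pfst u))) (cFrac (pe (Suc (2 * pfst (pfst u))) (psnd (pfst u))) (psnd u)))
        (cInt (num chr (psnd (pfst u)) (Suc (pfst (pfst u)))) (psnd u)), \<lambda>u. cZero)]
    @ map (\<lambda>j. (cLin nat (pj j) (eqs j) 1, cLin (\<lambda>a. nat (- a)) (pj j) (eqs j) 1)) [0..<d]"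

lemma name_families_sound:
  assumes "(f, g) \<in> set (name_families pj chr eqs d)"
  shows "name_eq pj chr eqs d (f u) (g u)"
  using assms by (auto simp: name_families_def intro: name_eq.intros simp del: pfst_psnd(3) One_nat_def)

lemma name_families_complete:
  assumes "name_eq pj chr eqs d x y"
  shows "\<exists>f g u. (f, g) \<in> set (name_families pj chr eqs d) \<and> x = f u \<and> y = g u" (is ?thesis)
proof -
  let ?F = "name_families pj chr eqs d"
  have nth: "?F ! k \<in> set ?F" if "k < 9" for k
    using that by (intro nth_mem) (simp add: name_families_def)
  have *: ?thesis if "k < 9" "x = fst (?F ! k) u" "y = snd (?F ! k) u" for k u
    using nth[OF that(1)] that(2,3)
    by (intro exI[of _ "fst (?F ! k)"] exI[of _ "snd (?F ! k)"] exI[of _ u]) simp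
  show ?thesis
    using assms
  proof cases
    case 1
    then show ?thesis by (intro *[of 0]) (simp_all add: name_families_def)
  next
    case (2 z)
    then show ?thesis by (intro *[of 1 z]) (simp_all add: name_families_def)
  next
    case (3 c z)
    then show ?thesis by (intro *[of 2 "pe c z"]) (simp_all add: name_families_def)
  next
    case (4 j z)
    then show ?thesis by (intro *[of 3 "pe j z"]) (simp_all add: name_families_def)
  next
    case (5 j q c z)
    then show ?thesis by (intro *[of 4 "pe (pe j z) (pe q c)"]) (simp_all add: name_families_def)
  next
    case (6 z)
    then show ?thesis by (intro *[of 5 z]) (simp_all add: name_families_def)
  next
    case (7 k z)
    then show ?thesis by (intro *[of 6 "pe k z"]) (simp_all add: name_families_def)
  next
    case (8 b v z)
    then show ?thesis by (intro *[of 7 "pe (pe v b) z"]) (simp_all add: name_families_def)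
  next
    case (9 b v z)
    then show ?thesis by (intro *[of 8 "pe (pe v b) z"]) (simp_all add: name_families_def)
  next
    case (10 j z)
    then show ?thesis
      by (intro exI[of _ "cLin nat (pj j) (eqs j) 1"] exI[of _ "cLin (\<lambda>a. nat (- a)) (pj j) (eqs j) 1"] exI[of _ z])
        (simp add: name_families_def)
  qed
qed

lemma recursive_den [recursive_intros]: "recursive n F \<Longrightarrow> recursive n (\<lambda>xs. den chr (F xs))"
  unfolding den_def by (intro recursive_intros)

lemma recursive_num [recursive_intros]:
  "\<lbrakk>recursive n F; recursive n G\<rbrakk> \<Longrightarrow> recursive n (\<lambda>xs. num chr (F xs) (G xs))"
  unfolding num_def by (intro recursive_intros)

lemma recursive_cLin [recursive_intros]:
  "recursive n F \<Longrightarrow> recursive n (\<lambda>xs. cLin f p as \<mu> (F xs))"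
  by (induction as arbitrary: \<mu>) (auto intro!: recursive_intros)

lemma recursive_name_families:
  assumes pj: "recursive 1 (\<lambda>xs. pj (xs ! 0))" and fg: "(f, g) \<in> set (name_families pj chr eqs d)"
  shows "recursive 1 (\<lambda>xs. f (xs ! 0))" "recursive 1 (\<lambda>xs. g (xs ! 0))"
proof -
  note pj' = recursive_comp1[OF pj]
  have "recursive 1 (\<lambda>xs. f (xs ! 0)) \<and> recursive 1 (\<lambda>xs. g (xs ! 0))"
    using fg unfolding name_families_def
    by (simp del: One_nat_def, elim disjE conjE exE bexE imageE)
      (simp_all del: One_nat_def, (intro conjI recursive_intros pj'; simp)+)
  then show "recursive 1 (\<lambda>xs. f (xs ! 0))" "recursive 1 (\<lambda>xs. g (xs ! 0))" by auto
qed

text \<open>The rules of \<open>word_eq\<close> in order, again with packed variables. Index 0 holds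
  the relators, the only family whose parameter is restricted.\<close>

definition word_families :: "((nat \<Rightarrow> nat) \<times> (nat \<Rightarrow> nat)) list
    \<Rightarrow> ((nat \<Rightarrow> nat lie_term) \<times> (nat \<Rightarrow> nat lie_term)) list" where
  "word_families ns =
    [(\<lambda>r. nmWord (pe (pfst r) (psnd r)), \<lambda>r. nmWord (pe (pfst r) cZero)),
     (\<lambda>r. aWord 0 (pe (pfst r) (psnd r)), \<lambda>r. nmWord (pfst r)),
     (\<lambda>r. aWord (Suc 0) (pe (pfst r) (psnd r)), \<lambda>r. nmWord (psnd r)),
     (\<lambda>r. aWord 2 (pe (pe (pfst r) (pfst (psnd r))) (pe (pfst r) (psnd (psnd r)))),
      \<lambda>r. nmWord (pe (pfst r) (cAdd (pfst (psnd r)) (psnd (psnd r))))),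
     (\<lambda>r. Brk (nmWord (pe (pfst (pfst r)) (psnd (pfst r)))) (nmWord (pe (pfst (psnd r)) (psnd (psnd r)))),
      \<lambda>r. nmWord (pe (pfst (pfst r) * pfst (psnd r)) (cBrk (psnd (pfst r)) (psnd (psnd r))))),
     (\<lambda>r. nmWord (pe (pfst r) (cMul (pfst (psnd r)) (psnd (psnd r)))),
      \<lambda>r. nmWord (pe (pfst r * pfst (psnd r)) (psnd (psnd r))))]
    @ map (\<lambda>(f, g). (\<lambda>r. nmWord (pe (pfst r) (f (psnd r))), \<lambda>r. nmWord (pe (pfst r) (g (psnd r))))) ns"

lemma word_families_sound:
  assumes "i < length (word_families ns)" "i = 0 \<Longrightarrow> psnd r \<in> C"
    and Q: "\<And>f g u. (f, g) \<in> set ns \<Longrightarrow> Q (f u) (g u)"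
  shows "word_eq Q C (fst (word_families ns ! i) r) (snd (word_families ns ! i) r)"
proof (cases "i < 6")
  case True
  then consider "i = 0" | "i = 1" | "i = 2" | "i = 3" | "i = 4" | "i = 5" by linarith
  then show ?thesis
    by cases (use assms(2) in \<open>simp_all add: word_families_def word_eq.intros del: pfst_psnd(3)\<close>)
next
  case False
  define k where "k = i - 6"
  have i: "i = k + 6" "k < length ns" using False assms(1) by (auto simp: k_def word_families_def)
  have "word_families ns ! i = (\<lambda>(f, g). (\<lambda>r. nmWord (pe (pfst r) (f (psnd r))), \<lambda>r. nmWord (pe (pfst r) (g (psnd r))))) (ns ! k)"
    using i by (simp add: word_families_def nth_append)
  moreover obtain f g where fg: "ns ! k = (f, g)" by (cases "ns ! k")
  moreover have "Q (f (psnd r)) (g (psnd r))" using Q[of f g] fg nth_mem[OF i(2)] by simp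
  ultimately show ?thesis by (simp add: word_eq.eq)
qed

lemma word_families_complete:
  assumes vw: "word_eq Q C v w"
    and Q: "\<And>x y. Q x y \<Longrightarrow> \<exists>f g u. (f, g) \<in> set ns \<and> x = f u \<and> y = g u"
  shows "\<exists>i r. i < length (word_families ns) \<and> (i = 0 \<longrightarrow> psnd r \<in> C) \<and>
    v = fst (word_families ns ! i) r \<and> w = snd (word_families ns ! i) r"
  using vw
proof cases
  case (relator t m)
  then show ?thesis by (intro exI[of _ 0] exI[of _ "pe m t"]) (simp add: word_families_def)
next
  case (left u v)
  then show ?thesis by (intro exI[of _ 1] exI[of _ "pe u v"]) (simp add: word_families_def)
next
  case (right u v)
  then show ?thesis by (intro exI[of _ 2] exI[of _ "pe u v"]) (simp add: word_families_def)
next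
  case (add m x y)
  then show ?thesis by (intro exI[of _ 3] exI[of _ "pe m (pe x y)"]) (simp add: word_families_def)
next
  case (brk m x m' y)
  then show ?thesis by (intro exI[of _ 4] exI[of _ "pe (pe m x) (pe m' y)"]) (simp add: word_families_def)
next
  case (mul m \<mu> x)
  then show ?thesis by (intro exI[of _ 5] exI[of _ "pe m (pe \<mu> x)"]) (simp add: word_families_def)
next
  case (eq x y m)
  obtain f g u where fg: "(f, g) \<in> set ns" "x = f u" "y = g u" using Q[OF eq(3)] by blast
  obtain k where "k < length ns" "ns ! k = (f, g)" using fg(1) by (auto simp: in_set_conv_nth)
  then show ?thesis using eq fg
    by (intro exI[of _ "k + 6"] exI[of _ "pe m u"]) (simp add: word_families_def nth_append)
qed

lemma recursive_zWord [recursive_intros]: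
  "recursive n F \<Longrightarrow> recursive n (\<lambda>xs. term_encode (zWord (F xs)))"
  by (rule recursive_comp1[where G = "\<lambda>i. term_encode (zWord i)"],
      rule recursive_prim1[where G = "\<lambda>k r. pe 4 (pe (pe 0 3) r)"])
    (auto intro!: recursive_intros)

lemma recursive_nmWord [recursive_intros]:
  "recursive n F \<Longrightarrow> recursive n (\<lambda>xs. term_encode (nmWord (F xs)))"
  unfolding nmWord_def term_encode.simps by (intro recursive_intros)

lemma recursive_word_families:
  assumes ns: "\<And>f g. (f, g) \<in> set ns \<Longrightarrow> recursive 1 (\<lambda>xs. f (xs ! 0)) \<and> recursive 1 (\<lambda>xs. g (xs ! 0))"
    and F: "F \<in> set (word_families ns)"
  shows "recursive 1 (\<lambda>xs. term_encode (fst F (xs ! 0)))" "recursive 1 (\<lambda>xs. term_encode (snd F (xs ! 0)))"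
proof -
  have "recursive 1 (\<lambda>xs. term_encode (fst F (xs ! 0))) \<and> recursive 1 (\<lambda>xs. term_encode (snd F (xs ! 0)))"
  proof (cases "F \<in> set (word_families [])")
    case True
    then show ?thesis
      unfolding word_families_def
      by (simp del: One_nat_def, elim disjE)
        (simp_all del: One_nat_def, (intro conjI recursive_intros; simp)+)
  next
    case False
    then obtain f g where fg: "(f, g) \<in> set ns"
      "F = (\<lambda>r. nmWord (pe (pfst r) (f (psnd r))), \<lambda>r. nmWord (pe (pfst r) (g (psnd r))))"
      using F by (auto simp: word_families_def)
    note rec = ns[OF fg(1), THEN conjunct1] ns[OF fg(1), THEN conjunct2]
    show ?thesis unfolding fg(2) fst_conv snd_conv
      by (intro conjI recursive_intros recursive_comp1[OF rec(1)] recursive_comp1[OF rec(2)]; simp)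
  qed
  then show "recursive 1 (\<lambda>xs. term_encode (fst F (xs ! 0)))" "recursive 1 (\<lambda>xs. term_encode (snd F (xs ! 0)))"
    by auto
qed

text \<open>List lookup with a default, written as nested tests so that
  \<open>recursive_if_eq\<close> applies.\<close>

primrec select :: "'f list \<Rightarrow> 'f \<Rightarrow> nat \<Rightarrow> 'f" where
  "select [] d i = d"
| "select (f # fs) d i = (if i = 0 then f else select fs d (i - 1))"

lemma select_nth: "select fs d i = (if i < length fs then fs ! i else d)"
  by (induction fs arbitrary: i) (auto simp: nth_Cons split: nat.split)

lemma select_map: "select (map h fs) (h d) i = h (select fs d i)"
  by (induction fs arbitrary: i) auto

lemma recursive_select:
  assumes "\<And>f. f \<in> set (d # fs) \<Longrightarrow> recursive 1 (\<lambda>xs. f (xs ! 0))" "recursive n A" "recursive n B"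
  shows "recursive n (\<lambda>xs. select fs d (A xs) (B xs))"
  using assms(1,2)
proof (induction fs arbitrary: A)
  case Nil
  then show ?case using recursive_comp1[of d n B] assms(3) by simp
next
  case (Cons f fs)
  have "recursive n (\<lambda>xs. if A xs = 0 then f (B xs) else select fs d (A xs - 1) (B xs))"
    using Cons.prems assms(3)
    by (intro recursive_intros Cons.IH recursive_comp1[of f n B]) auto
  moreover have "(\<lambda>xs. select (f # fs) d (A xs) (B xs)) =
      (\<lambda>xs. if A xs = 0 then f (B xs) else select fs d (A xs - 1) (B xs))"
    by auto
  ultimately show ?case by simp
qed

text \<open>
  The summand \<open>Smult p Zero\<close> does not change the class of the relation \<open>v - w\<close>; it makes the
  parameter \<open>p\<close> part of the code, as required by \<open>re_set_image\<close>.
\<close>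

definition relation_term :: "((nat \<Rightarrow> nat) \<times> (nat \<Rightarrow> nat)) list \<Rightarrow> nat \<Rightarrow> nat \<Rightarrow> nat lie_term" where
  "relation_term ns c p = (let F = select (word_families ns) (\<lambda>r. Add (Gen 0) (Gen 1), \<lambda>r. Gen 2) (pfst p) in
    Add (Add (fst F (psnd p)) (Smult c (snd F (psnd p)))) (Smult p Zero))"

text \<open>The first component of \<open>p\<close> selects a family, the second is its parameter.
  Only in family 0 is it tested against \<open>C\<close>; an index beyond the list selects the
  default, alpha + beta - gamma.\<close>

definition admissible :: "nat set \<Rightarrow> nat set" where
  "admissible C = {p. pfst p \<noteq> 0 \<or> psnd (psnd p) \<in> C}"

lemma re_relation_terms:
  assumes ns: "\<And>f g. (f, g) \<in> set ns \<Longrightarrow> recursive 1 (\<lambda>xs. f (xs ! 0)) \<and> recursive 1 (\<lambda>xs. g (xs ! 0))"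
    and C: "re_set C"
  shows "re_set (term_encode ` relation_term ns c ` admissible C)"
proof -
  define d :: "(nat \<Rightarrow> nat lie_term) \<times> (nat \<Rightarrow> nat lie_term)" where "d = (\<lambda>r. Add (Gen 0) (Gen 1), \<lambda>r. Gen 2)"
  define fs gs where "fs = map (\<lambda>F r. term_encode (fst F r)) (word_families ns)"
    and "gs = map (\<lambda>F r. term_encode (snd F r)) (word_families ns)"
  have sel: "term_encode (fst (select (word_families ns) d i) r) = select fs (\<lambda>r. term_encode (fst d r)) i r"
    "term_encode (snd (select (word_families ns) d i) r) = select gs (\<lambda>r. term_encode (snd d r)) i r" for i r
    using select_map[of "\<lambda>F r. term_encode (fst F r)" "word_families ns" d i]
      select_map[of "\<lambda>F r. term_encode (snd F r)" "word_families ns" d i]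
    by (simp_all add: fs_def gs_def)
  have d: "recursive 1 (\<lambda>xs. term_encode (fst d (xs ! 0)))" "recursive 1 (\<lambda>xs. term_encode (snd d (xs ! 0)))"
    by (simp_all add: d_def recursive_const)
  have f: "recursive 1 (\<lambda>xs. f (xs ! 0))" if "f \<in> set ((\<lambda>r. term_encode (fst d r)) # fs)" for f
    using that d recursive_word_families(1)[OF ns] by (auto simp: fs_def)
  have g: "recursive 1 (\<lambda>xs. f (xs ! 0))" if "f \<in> set ((\<lambda>r. term_encode (snd d r)) # gs)" for f
    using that d recursive_word_families(2)[OF ns] by (auto simp: gs_def)
  define h where "h p = pe 2 (pe (pe 2 (pe (select fs (\<lambda>r. term_encode (fst d r)) (pfst p) (psnd p))
      (pe 3 (pe c (select gs (\<lambda>r. term_encode (snd d r)) (pfst p) (psnd p)))))) (pe 3 (pe p (pe 1 0))))" for p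
  have h: "term_encode (relation_term ns c p) = h p" for p
    unfolding relation_term_def d_def[symmetric] h_def sel[symmetric] by (simp add: Let_def)
  have "recursive 1 (\<lambda>xs. pfst (xs ! 0))" "recursive 1 (\<lambda>xs. psnd (xs ! 0))"
    by (intro recursive_intros; simp)+
  then have "recursive 1 (\<lambda>xs. select fs (\<lambda>r. term_encode (fst d r)) (pfst (xs ! 0)) (psnd (xs ! 0)))"
    "recursive 1 (\<lambda>xs. select gs (\<lambda>r. term_encode (snd d r)) (pfst (xs ! 0)) (psnd (xs ! 0)))"
    using recursive_select[OF f] recursive_select[OF g] by blast+
  then have "recursive 1 (\<lambda>xs. h (xs ! 0))"
    unfolding h_def by (intro recursive_intros) simp_all
  moreover have "inj h" by (auto simp: inj_def h_def)
  moreover have "recursive 1 (\<lambda>xs. if pfst (xs ! 0) = 0 then 1 else 0)"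
    by (intro recursive_intros) auto
  moreover have "recursive 1 (\<lambda>xs. psnd (psnd (xs ! 0)))"
    by (intro recursive_intros) auto
  ultimately have "re_set (h ` {p. (if pfst p = 0 then 1 else 0) = (0::nat) \<or> psnd (psnd p) \<in> C})"
    by (intro re_set_image[OF _ _ C]) auto
  moreover have "{p. (if pfst p = 0 then 1 else 0) = (0::nat) \<or> psnd (psnd p) \<in> C} = admissible C"
    by (auto simp: admissible_def)
  ultimately show ?thesis by (simp add: image_image h)
qed


section \<open>The embedding\<close>

context field
begin

lemma characteristic_exists: "\<exists>chr. \<forall>k. int_scalar R (int k) = \<zero> \<longleftrightarrow> k mod chr = 0"
proof (cases "\<exists>k > 0. int_scalar R (int k) = \<zero>")
  case False
  then have "int_scalar R (int k) \<noteq> \<zero>" if "k > 0" for k using that by blast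
  \<comment> \<open>Characteristic 0 is represented by the modulus 0, as
    \<open>k mod 0 = k\<close>.\<close>
  then have "int_scalar R (int k) = \<zero> \<longleftrightarrow> k mod 0 = 0" for k by (cases "k = 0") auto
  then show ?thesis by blast
next
  case True
  define p where "p = (LEAST k. k > 0 \<and> int_scalar R (int k) = \<zero>)"
  have p: "p > 0" "int_scalar R (int p) = \<zero>"
    using LeastI_ex[OF True] by (auto simp: p_def)
  have least: "int_scalar R (int k) \<noteq> \<zero>" if "0 < k" "k < p" for k
    using that not_less_Least[of k "\<lambda>k. k > 0 \<and> int_scalar R (int k) = \<zero>"] by (auto simp: p_def)
  have "int_scalar R (int k) = \<zero> \<longleftrightarrow> k mod p = 0" for k
  proof -
    have "int k = int p * int (k div p) + int (k mod p)"
      by (metis mult_div_mod_eq of_nat_add of_nat_mult)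
    then have "int_scalar R (int k) = int_scalar R (int (k mod p))"
      by (simp only: int_scalar_add int_scalar_mult p(2)) simp
    then show ?thesis using least[of "k mod p"] p(1) by (cases "k mod p = 0") auto
  qed
  then show ?thesis by blast
qed

text \<open>The positive integers are free on the primes as a commutative monoid, so values at
  primes can be prescribed; \<kappa> is built up by factors \<open>b\<close> to the multiplicity of
  a prime.\<close>

lemma monomial_values_exist:
  assumes "set bs \<subseteq> carrier R"
  obtains \<kappa> and pj :: "nat \<Rightarrow> nat" where "\<And>m :: nat. \<kappa> m \<in> carrier R" "\<kappa> 1 = \<one>"
    "\<And>m m'. \<kappa> (m * m') = \<kappa> m \<otimes> \<kappa> m'" "\<kappa> 0 = \<zero>"
    "\<And>j. j < length bs \<Longrightarrow> \<kappa> (pj j) = bs ! j"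
    "\<And>j. j \<ge> length bs \<Longrightarrow> pj j = 0"
proof -
  define pr where "pr = enumerate {p :: nat. Factorial_Ring.prime p}"
  have pr: "Factorial_Ring.prime (pr j)" for j
    using enumerate_in_set[OF primes_infinite] by (simp add: pr_def)
  have inj: "pr i = pr j \<longleftrightarrow> i = j" for i j
    using strict_mono_eq[OF strict_mono_enumerate[OF primes_infinite]] by (simp add: pr_def)
  \<comment> \<open>The last conjunct serves the induction: the prime reserved for the next scalar
    still has value 1, so the new factor sets its value exactly.\<close>
  have "\<exists>\<kappa>. (\<forall>m. \<kappa> m \<in> carrier R) \<and> \<kappa> 1 = \<one> \<and> (\<forall>m m'. \<kappa> (m * m') = \<kappa> m \<otimes> \<kappa> m') \<and> \<kappa> 0 = \<zero> \<and>
    (\<forall>j < length bs. \<kappa> (pr j) = bs ! j) \<and> (\<forall>j \<ge> length bs. \<kappa> (pr j) = \<one>)"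
    using assms
  proof (induction bs rule: rev_induct)
    case Nil
    have "pr j \<noteq> 0" for j using pr[of j] by (metis not_prime_0)
    then show ?case by (intro exI[of _ "\<lambda>m. if m = 0 then \<zero> else \<one>"]) auto
  next
    case (snoc b bs)
    then obtain \<kappa> where \<kappa>: "\<And>m. \<kappa> m \<in> carrier R" "\<kappa> 1 = \<one>" "\<And>m m'. \<kappa> (m * m') = \<kappa> m \<otimes> \<kappa> m'" "\<kappa> 0 = \<zero>"
      "\<And>j. j < length bs \<Longrightarrow> \<kappa> (pr j) = bs ! j" "\<And>j. j \<ge> length bs \<Longrightarrow> \<kappa> (pr j) = \<one>"
      by auto
    have b: "b \<in> carrier R" using snoc.prems by simp
    let ?q = "pr (length bs)"
    let ?\<kappa> = "\<lambda>m. \<kappa> m \<otimes> b [^] multiplicity ?q m"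
    have mult: "?\<kappa> (m * m') = ?\<kappa> m \<otimes> ?\<kappa> m'" for m m'
    proof (cases "m = 0 \<or> m' = 0")
      case True
      then show ?thesis using b \<kappa>(1) by (auto simp: \<kappa>(4))
    next
      case False
      then have "multiplicity ?q (m * m') = multiplicity ?q m + multiplicity ?q m'"
        using pr by (intro prime_elem_multiplicity_mult_distrib) auto
      then show ?thesis using b \<kappa>(1) by (simp add: \<kappa>(3) nat_pow_mult[symmetric] m_ac)
    qed
    have other: "multiplicity ?q (pr j) = (if j = length bs then 1 else 0)" for j
      using pr inj[of "length bs" j] by (auto simp: multiplicity_prime prime_multiplicity_other)
    have "?\<kappa> (pr j) = (bs @ [b]) ! j" if "j < length (bs @ [b])" for j
    proof (cases "j = length bs")
      case False
      then have j: "j < length bs" using that by simp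
      then have "bs ! j \<in> carrier R" using snoc.prems by auto
      then show ?thesis using j \<kappa>(5) by (simp add: other nth_append)
    qed (use b \<kappa> in \<open>simp add: other\<close>)
    moreover have "?\<kappa> (pr j) = \<one>" if "j \<ge> length (bs @ [b])" for j
      using that \<kappa> by (auto simp: other)
    ultimately show ?case
      using b \<kappa> mult by (intro exI[of _ ?\<kappa>]) auto
  qed
  then obtain \<kappa> where "\<And>m. \<kappa> m \<in> carrier R" "\<kappa> 1 = \<one>" "\<And>m m'. \<kappa> (m * m') = \<kappa> m \<otimes> \<kappa> m'" "\<kappa> 0 = \<zero>"
    "\<And>j. j < length bs \<Longrightarrow> \<kappa> (pr j) = bs ! j"
    by blast
  then show ?thesis using that[of \<kappa> "\<lambda>j. if j < length bs then pr j else 0"] by simp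
qed

lemma prime_decode_surj:
  assumes "x \<in> prime_subfield R"
  obtains q where "prime_decode R q = x"
proof -
  obtain a b where ab: "int_scalar R b \<noteq> \<zero>" "int_scalar R b \<otimes> x = int_scalar R a"
    using assms by (rule prime_subfield_fraction)
  have x: "x \<in> carrier R" using assms subfieldE(3)[OF prime_subfield_is_subfield] by blast
  obtain a' n where n: "int_scalar R (int (Suc n)) \<noteq> \<zero>" "int_scalar R (int (Suc n)) \<otimes> x = int_scalar R a'"
  proof (cases "b > 0")
    case True
    then show thesis using ab that[of "nat b - 1" a] by simp
  next
    case False
    then have "b < 0" using ab by (cases "b = 0") auto
    moreover have "int_scalar R (- b) \<otimes> x = int_scalar R (- a)"
      using x ab by (simp add: int_scalar_minus l_minus)
    moreover have "int_scalar R (- b) \<noteq> \<zero>"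
      using ab by (simp add: int_scalar_minus)
    ultimately show thesis using that[of "nat (- b) - 1" "- a"] by simp
  qed
  have u: "int_scalar R (int (Suc n)) \<in> Units R" using n(1) field_Units by auto
  have "prime_decode R (prod_encode (int_encode a', n)) = int_scalar R a' \<otimes> inv (int_scalar R (int (Suc n)))"
    using n(1) unfolding prime_decode_def int_scalar_nat[symmetric] by (simp add: Let_def del: of_nat_Suc)
  also have "\<dots> = x" using u x by (simp add: m_comm[of _ x] m_assoc flip: n(2))
  finally show thesis by (rule that)
qed

text \<open>Supplies a code for -1, by which the differences \<open>v - w\<close> are written as
  expressions.\<close>

lemma scalar_decode_surj:
  assumes bs: "set bs \<subseteq> carrier R" "Span (prime_subfield R) bs = carrier R" and x: "x \<in> carrier R"
  obtains c where "scalar_decode R bs c = x"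
proof -
  have "x \<in> {combine ks bs | ks. set ks \<subseteq> prime_subfield R}"
    using Span_eq_combine_set[OF prime_subfield_is_subfield bs(1)] bs(2) x by simp
  then obtain ks where ks: "set ks \<subseteq> prime_subfield R" "combine ks bs = x" by auto
  have "\<exists>qs. map (prime_decode R) qs = ks"
    using ks(1)
  proof (induction ks)
    case (Cons k ks)
    then obtain qs where "map (prime_decode R) qs = ks" by auto
    moreover obtain q where "prime_decode R q = k" using Cons.prems prime_decode_surj[of k] by auto
    ultimately show ?case by (intro exI[of _ "q # qs"]) simp
  qed simp
  then obtain qs where "map (prime_decode R) qs = ks" by blast
  then show ?thesis using ks(2) that[of "list_encode qs"] by (simp add: scalar_decode_def)
qed

lemma free_lie_minus:
  assumes "v \<in> lie_terms R n" "w \<in> lie_terms R n"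
  shows "lie_class R n v \<ominus>\<^bsub>free_lie R n\<^esub> lie_class R n w = lie_class R n (Add v (Smult (\<ominus> \<one>) w))"
proof -
  interpret F: lie_algebra R "free_lie R n" by (rule free_lie_algebra) (rule field_axioms)
  have "\<ominus>\<^bsub>free_lie R n\<^esub> lie_class R n w = (\<ominus> \<one>) \<odot>\<^bsub>free_lie R n\<^esub> lie_class R n w"
    using F.smult_l_minus[of \<one> "lie_class R n w"] assms by (simp add: lie_class_closed)
  then show ?thesis
    using assms by (simp add: a_minus_def free_lie_smult free_lie_add lie_terms.intros)
qed

end


lemma presented_relation_eq:
  assumes "lie_presentation K n R" "c \<in> carrier K"
    and vw: "v \<in> lie_terms K n" "w \<in> lie_terms K n"
    and rel: "lie_class K n (Add (Add v (Smult (\<ominus>\<^bsub>K\<^esub> \<one>\<^bsub>K\<^esub>) w)) (Smult c Zero)) \<in> R"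
  shows "presented_class K n R v = presented_class K n R w"
proof -
  interpret lie_presentation K n R by fact
  let ?c = "presented_class K n R"
  have cl: "?c v \<in> carrier (presented_lie K n R)" "?c w \<in> carrier (presented_lie K n R)"
    using vw by (auto intro: presented_class_closed)
  note tI = lie_terms.intros
  have "?c (Add (Add v (Smult (\<ominus>\<^bsub>K\<^esub> \<one>\<^bsub>K\<^esub>) w)) (Smult c Zero)) = \<zero>\<^bsub>presented_lie K n R\<^esub>"
    using assms by (intro presented_class_relation rel) (auto intro!: tI)
  moreover have "?c (Add (Add v (Smult (\<ominus>\<^bsub>K\<^esub> \<one>\<^bsub>K\<^esub>) w)) (Smult c Zero)) =
      (?c v \<oplus>\<^bsub>presented_lie K n R\<^esub> (\<ominus>\<^bsub>K\<^esub> \<one>\<^bsub>K\<^esub>) \<odot>\<^bsub>presented_lie K n R\<^esub> ?c w) \<oplus>\<^bsub>presented_lie K n R\<^esub>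
        c \<odot>\<^bsub>presented_lie K n R\<^esub> ?c Zero"
    using assms(2) vw by (simp add: presented_class_simps(2-4) tI)
  moreover have "\<dots> = ?c v \<ominus>\<^bsub>presented_lie K n R\<^esub> ?c w"
    using assms(2) cl by (simp add: P.smult_l_minus a_minus_def flip: presented_class_simps(1))
  ultimately have "?c v \<ominus>\<^bsub>presented_lie K n R\<^esub> ?c w = \<zero>\<^bsub>presented_lie K n R\<^esub>" by simp
  then show ?thesis using cl by (simp add: P.M.diff_simps)
qed

theorem theorem5p1:
  fixes K :: "('k, 'r) ring_scheme" and L :: "('k, 'a, 'm) lie_algebra_scheme"
  assumes "field K"
    and "ring.finite_dimension K (prime_subfield K) (carrier K)"
    and "lie_algebra K L"
    and "recursively_presented K L"
  shows "\<exists>n E \<alpha> \<beta> \<gamma>.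
    E \<subseteq> {v \<ominus>\<^bsub>free_lie K n\<^esub> w | v w.
          v \<in> lie_words (free_lie K n) (free_gens K n) \<and>
          w \<in> lie_words (free_lie K n) (free_gens K n)} \<and>
    \<alpha> \<in> free_gens K n \<and> \<beta> \<in> free_gens K n \<and> \<gamma> \<in> free_gens K n \<and>
    re_relations K n (E \<union> {\<alpha> \<oplus>\<^bsub>free_lie K n\<^esub> \<beta> \<ominus>\<^bsub>free_lie K n\<^esub> \<gamma>}) \<and>
    (\<exists>\<phi> \<in> lie_hom K L
        (presented_lie K n (E \<union> {\<alpha> \<oplus>\<^bsub>free_lie K n\<^esub> \<beta> \<ominus>\<^bsub>free_lie K n\<^esub> \<gamma>})).
      inj_on \<phi> (carrier L))"
proof -

  \<comment> \<open>Data extracted from the given presentation\<close>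
  interpret field K by fact
  obtain n R \<phi> where rer: "re_relations K n R" and \<phi>: "\<phi> \<in> lie_hom K L (presented_lie K n R)"
    "bij_betw \<phi> (carrier L) (carrier (presented_lie K n R))"
    using assms(4) unfolding recursively_presented_def by blast
  obtain bs T where bs: "set bs \<subseteq> carrier K" "Span (prime_subfield K) bs = carrier K"
    and re_T: "re_set (term_encode ` T)" and T: "map_lie_term (scalar_decode K bs) ` T \<subseteq> lie_terms K n"
    and R: "R = (\<lambda>t. lie_class K n (map_lie_term (scalar_decode K bs) t)) ` T"
    using rer unfolding re_relations_def by blast
  obtain \<kappa> :: "nat \<Rightarrow> 'k" and pj :: "nat \<Rightarrow> nat" where \<kappa>: "\<And>m. \<kappa> m \<in> carrier K" "\<kappa> 1 = \<one>\<^bsub>K\<^esub>"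
    "\<And>m m'. \<kappa> (m * m') = \<kappa> m \<otimes>\<^bsub>K\<^esub> \<kappa> m'" "\<kappa> 0 = \<zero>\<^bsub>K\<^esub>"
    "\<And>j. j < length bs \<Longrightarrow> \<kappa> (pj j) = bs ! j" "\<And>j. j \<ge> length bs \<Longrightarrow> pj j = 0"
    using monomial_values_exist[OF bs(1)] by metis
  obtain chr where chr: "\<And>k. int_scalar K (int k) = \<zero>\<^bsub>K\<^esub> \<longleftrightarrow> k mod chr = 0"
    using characteristic_exists by blast
  have "\<exists>as. list_eval K (bs ! j) as = \<zero>\<^bsub>K\<^esub> \<and> list_deriv K (bs ! j) as \<noteq> \<zero>\<^bsub>K\<^esub>" if "j < length bs" for j
  proof -
    have "bs ! j \<in> carrier K" using bs(1) that by auto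
    then show ?thesis using separable_equation[OF assms(2)] by metis
  qed
  then obtain eqs where eqs: "\<And>j. j < length bs \<Longrightarrow>
      list_eval K (bs ! j) (eqs j) = \<zero>\<^bsub>K\<^esub> \<and> list_deriv K (bs ! j) (eqs j) \<noteq> \<zero>\<^bsub>K\<^esub>"
    by metis
  interpret S: scalar_coding K bs \<kappa> pj chr eqs
    by unfold_locales (use bs(1) \<kappa> chr eqs in auto)
  define dec where "dec = scalar_decode K bs"
  have dec: "dec c \<in> carrier K" for c by (simp add: dec_def)
  obtain c0 where c0: "dec c0 = \<ominus>\<^bsub>K\<^esub> \<one>\<^bsub>K\<^esub>"
    using scalar_decode_surj[OF bs, of "\<ominus>\<^bsub>K\<^esub> \<one>\<^bsub>K\<^esub>"] by (auto simp: dec_def)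

  \<comment> \<open>The new presentation\<close>
  define Q where "Q = name_eq pj chr eqs (length bs)"
  define C where "C = term_encode ` T"
  define ns where "ns = name_families pj chr eqs (length bs)"
  define T' where "T' = relation_term ns c0 ` admissible C"
  define cls where "cls t = lie_class K 5 (map_lie_term dec t)" for t
  define E where "E = {cls v \<ominus>\<^bsub>free_lie K 5\<^esub> cls w | v w. word_eq Q C v w}"
  define R' where "R' = E \<union> {cls (Gen 0) \<oplus>\<^bsub>free_lie K 5\<^esub> cls (Gen 1) \<ominus>\<^bsub>free_lie K 5\<^esub> cls (Gen 2)}"
  note tI = lie_terms.intros
  have word: "map_lie_term dec v \<in> lie_terms K 5" "map_lie_term dec w \<in> lie_terms K 5"
    "cls v \<in> lie_words (free_lie K 5) (free_gens K 5)" "cls w \<in> lie_words (free_lie K 5) (free_gens K 5)"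
    if "word_eq Q C v w" for v w
    using word_eq_is_word[OF that]
    by (auto simp: cls_def is_word_map intro: is_word_terms is_word_class)
  have gen: "Gen i \<in> lie_terms K 5" if "i < 5" for i using that by (rule tI)

  \<comment> \<open>Recursive enumerability of the new relations\<close>
  have Q_ns: "Q x y \<longleftrightarrow> (\<exists>f g u. (f, g) \<in> set ns \<and> x = f u \<and> y = g u)" for x y
    unfolding Q_def ns_def using name_families_sound name_families_complete by blast
  have pj_rec: "recursive 1 (\<lambda>xs. pj (xs ! 0))"
    using \<kappa>(6) by (rule recursive_table)
  have rel_mem: "cls (Add (Add v (Smult c0 w)) (Smult p Zero)) = cls v \<ominus>\<^bsub>free_lie K 5\<^esub> cls w"
    if "map_lie_term dec v \<in> lie_terms K 5" "map_lie_term dec w \<in> lie_terms K 5" for v w p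
  proof -
    let ?u = "Add (map_lie_term dec v) (Smult (\<ominus>\<^bsub>K\<^esub> \<one>\<^bsub>K\<^esub>) (map_lie_term dec w))"
    interpret F: lie_algebra K "free_lie K 5" by (rule free_lie_algebra) (rule assms(1))
    have u: "?u \<in> lie_terms K 5" using that by (auto intro!: tI)
    have "cls (Add (Add v (Smult c0 w)) (Smult p Zero)) = lie_class K 5 ?u \<oplus>\<^bsub>free_lie K 5\<^esub>
        dec p \<odot>\<^bsub>free_lie K 5\<^esub> \<zero>\<^bsub>free_lie K 5\<^esub>"
      using u dec by (simp add: cls_def c0 free_lie_zero free_lie_smult free_lie_add tI)
    also have "\<dots> = cls v \<ominus>\<^bsub>free_lie K 5\<^esub> cls w"
      using dec lie_class_closed[OF u] by (simp add: cls_def free_lie_minus that)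
    finally show ?thesis .
  qed
  have T'_class: "cls ` T' = R'"
  proof (intro subset_antisym subsetI)
    fix A assume "A \<in> cls ` T'"
    then obtain p where p: "p \<in> admissible C" "A = cls (relation_term ns c0 p)" by (auto simp: T'_def)
    show "A \<in> R'"
    proof (cases "pfst p < length (word_families ns)")
      case True
      have "word_eq Q C (fst (word_families ns ! pfst p) (psnd p)) (snd (word_families ns ! pfst p) (psnd p))"
        by (rule word_families_sound[OF True]) (use p(1) Q_ns in \<open>auto simp: admissible_def\<close>)
      moreover from this have "A = cls (fst (word_families ns ! pfst p) (psnd p)) \<ominus>\<^bsub>free_lie K 5\<^esub>
          cls (snd (word_families ns ! pfst p) (psnd p))"
        using p(2) True word by (simp add: relation_term_def Let_def select_nth rel_mem)
      ultimately show ?thesis by (auto simp: R'_def E_def)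
    next
      case False
      then have "A = cls (Add (Gen 0) (Gen 1)) \<ominus>\<^bsub>free_lie K 5\<^esub> cls (Gen 2)"
        using p(2) by (simp add: relation_term_def Let_def select_nth rel_mem gen tI)
      then show ?thesis by (simp add: R'_def cls_def free_lie_add gen)
    qed
  next
    fix A assume "A \<in> R'"
    then consider v w where "word_eq Q C v w" "A = cls v \<ominus>\<^bsub>free_lie K 5\<^esub> cls w"
      | "A = cls (Gen 0) \<oplus>\<^bsub>free_lie K 5\<^esub> cls (Gen 1) \<ominus>\<^bsub>free_lie K 5\<^esub> cls (Gen 2)"
      by (auto simp: R'_def E_def)
    then show "A \<in> cls ` T'"
    proof cases
      case 1
      obtain i r where ir: "i < length (word_families ns)" "i = 0 \<longrightarrow> psnd r \<in> C"
        "v = fst (word_families ns ! i) r" "w = snd (word_families ns ! i) r"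
        using word_families_complete[OF 1(1), of ns] Q_ns by blast
      have "A = cls (relation_term ns c0 (pe i r))"
        using 1 ir(1) word[OF 1(1)] by (simp add: relation_term_def Let_def select_nth rel_mem flip: ir(3,4))
      moreover have "pe i r \<in> admissible C" using ir(2) by (auto simp: admissible_def)
      ultimately show ?thesis by (auto simp: T'_def)
    next
      case 2
      let ?p = "pe (length (word_families ns)) 0"
      have "A = cls (Add (Gen 0) (Gen 1)) \<ominus>\<^bsub>free_lie K 5\<^esub> cls (Gen 2)"
        using 2 by (simp add: cls_def free_lie_add gen)
      then have "A = cls (relation_term ns c0 ?p)"
        by (simp add: relation_term_def Let_def select_nth rel_mem gen tI)
      moreover have "?p \<in> admissible C" by (simp add: admissible_def word_families_def)
      ultimately show ?thesis by (auto simp: T'_def)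
    qed
  qed
  have T'_terms: "map_lie_term dec t \<in> lie_terms K 5" if "t \<in> T'" for t
  proof -
    obtain p where p: "p \<in> admissible C" "t = relation_term ns c0 p" using \<open>t \<in> T'\<close> by (auto simp: T'_def)
    show ?thesis
    proof (cases "pfst p < length (word_families ns)")
      case True
      have "word_eq Q C (fst (word_families ns ! pfst p) (psnd p)) (snd (word_families ns ! pfst p) (psnd p))"
        by (rule word_families_sound[OF True]) (use p(1) Q_ns in \<open>auto simp: admissible_def\<close>)
      then show ?thesis using p(2) True word dec
        by (auto simp: relation_term_def Let_def select_nth intro!: tI)
    next
      case False
      then show ?thesis using p(2) dec gen
        by (auto simp: relation_term_def Let_def select_nth intro!: tI)
    qed
  qed
  have re: "re_relations K 5 R'"
    unfolding re_relations_def
  proof (intro exI[of _ bs] exI[of _ T'] conjI)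
    have "recursive 1 (\<lambda>xs. f (xs ! 0)) \<and> recursive 1 (\<lambda>xs. g (xs ! 0))" if "(f, g) \<in> set ns" for f g
      using recursive_name_families[OF pj_rec] that by (auto simp: ns_def)
    then show "re_set (term_encode ` T')"
      unfolding T'_def using re_T by (intro re_relation_terms) (auto simp: C_def)
    show "map_lie_term (scalar_decode K bs) ` T' \<subseteq> lie_terms K 5"
      using T'_terms by (auto simp: dec_def)
    show "R' = (\<lambda>t. lie_class K 5 (map_lie_term (scalar_decode K bs) t)) ` T'"
      using T'_class by (simp add: cls_def dec_def)
  qed (use bs in auto)

  \<comment> \<open>The two presented algebras, and the map from the new one to the model\<close>
  have R'_mem: "cls t \<in> R'" if "t \<in> T'" for t using that T'_class by blast
  interpret P0: lie_presentation K n R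
    by unfold_locales (use T R in \<open>auto simp: free_lie_carrier\<close>)
  interpret P1: lie_presentation K 5 R'
    by unfold_locales (use T'_terms in \<open>auto simp: free_lie_carrier cls_def simp flip: T'_class\<close>)
  let ?L = "presented_lie K n R" and ?P = "presented_lie K 5 R'"
  let ?pc = "presented_class K 5 R'"

  \<comment> \<open>Generators beyond \<open>n\<close> are sent to zero so that every code has a
    value in the given algebra.\<close>
  define g where "g i = (if i < n then presented_class K n R (Gen i) else \<zero>\<^bsub>?L\<^esub>)" for i
  interpret W: name_value K bs \<kappa> pj chr eqs ?L g
    by unfold_locales (auto simp: g_def intro!: P0.presented_class_closed lie_terms.intros)
  have g_eval: "lie_eval ?L g t = presented_class K n R t" if "t \<in> lie_terms K n" for t
    using P0.presented_class_eval[OF that] lie_eval_gens_cong[OF that, of g "\<lambda>i. presented_class K n R (Gen i)" ?L]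
    by (simp add: g_def)
  have val_T: "W.val t = \<zero>\<^bsub>?L\<^esub>" if "t \<in> C" for t
  proof -
    obtain t' where t': "t' \<in> T" "t = term_encode t'" using \<open>t \<in> C\<close> by (auto simp: C_def)
    have "map_lie_term dec t' \<in> lie_terms K n" "lie_class K n (map_lie_term dec t') \<in> R"
      using t'(1) T R by (auto simp: dec_def)
    then show ?thesis
      using P0.presented_class_relation g_eval by (simp add: t'(2) W.val_term flip: dec_def)
  qed
  define vN where "vN u = \<kappa> (pfst u) \<odot>\<^bsub>?L\<^esub> W.val (psnd u)" for u
  have vN: "vN u \<in> carrier ?L" for u using W.val_closed \<kappa>(1) by (simp add: vN_def)
  \<comment> \<open>The prescribed elements at index \<open>pe u v\<close> are the values of the
    names \<open>u\<close> and \<open>v\<close>, as \<open>left\<close> and \<open>right\<close>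
    demand.\<close>
  obtain N \<alpha> \<beta> b f c where N: "lie_algebra K (N :: ('k, (nat list \<Rightarrow> 'k lie_term set set) \<times>
      ((nat list \<Rightarrow> 'k lie_term set set) \<Rightarrow> nat list \<Rightarrow> 'k lie_term set set)) lie_algebra)"
    and el: "\<alpha> \<in> carrier N" "\<beta> \<in> carrier N" "b \<in> carrier N" "f \<in> carrier N"
    and c: "c \<in> lie_hom K ?L N" "inj_on c (carrier ?L)"
    and left: "\<And>i. bracket N \<alpha> (iter_bracket N b f i) = c (vN (pfst i))"
    and right: "\<And>i. bracket N \<beta> (iter_bracket N b f i) = c (vN (psnd i))"
    using P0.P.prescribed_monomials[of "\<lambda>i. vN (pfst i)" "\<lambda>i. vN (psnd i)"] vN by metis
  interpret N: lie_algebra K N by (rule N)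
  have iter_closed: "iter_bracket N b f i \<in> carrier N" for i
    using el by (induction i) (auto intro: N.bracket_closed)
  \<comment> \<open>Sending gamma to the sum of the images of alpha and beta satisfies the linear
    relation by construction.\<close>
  define \<rho> where "\<rho> i = (if i = 0 then \<alpha> else if i = 1 then \<beta> else if i = 2 then \<alpha> \<oplus>\<^bsub>N\<^esub> \<beta>
    else if i = 3 then b else f)" for i :: nat
  have \<rho>: "\<rho> i \<in> carrier N" for i using el by (simp add: \<rho>_def)
  let ?ev = "lie_eval N \<rho>"
  have ev_z: "?ev (zWord i) = iter_bracket N b f i" for i
    by (induction i) (simp_all add: \<rho>_def)
  have ev_a: "?ev (aWord 0 i) = c (vN (pfst i))" "?ev (aWord (Suc 0) i) = c (vN (psnd i))"
    "?ev (aWord 2 i) = c (vN (pfst i)) \<oplus>\<^bsub>N\<^esub> c (vN (psnd i))" for i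
    using el iter_closed by (simp_all add: ev_z \<rho>_def left right N.bracket_add_left)
  have ev_nm: "?ev (nmWord u) = c (vN u)" for u
    unfolding nmWord_def ev_a by simp
  have ev_eq: "?ev (map_lie_term dec v) = ?ev (map_lie_term dec w)" if "word_eq Q C v w" for v w
    using that
  proof cases
    case (relator t m)
    have "W.val cZero = W.val t" using val_T[OF relator(3)] by (simp add: W.val_simps)
    then show ?thesis by (simp add: relator ev_nm vN_def)
  next
    case (left u v)
    then show ?thesis using ev_a(1)[of "pe u v"] by (simp add: ev_nm)
  next
    case (right u v)
    then show ?thesis using ev_a(2)[of "pe u v"] by (simp add: ev_nm)
  next
    case (add m x y)
    have "c (vN (pe m x)) \<oplus>\<^bsub>N\<^esub> c (vN (pe m y)) = c (vN (pe m x) \<oplus>\<^bsub>?L\<^esub> vN (pe m y))"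
      using lie_homD(2)[OF c(1)] vN by simp
    also have "vN (pe m x) \<oplus>\<^bsub>?L\<^esub> vN (pe m y) = vN (pe m (cAdd x y))"
      using \<kappa>(1) by (simp add: vN_def W.val_simps P0.P.smult_r_distr W.val_closed)
    finally show ?thesis using add ev_a(3)[of "pe (pe m x) (pe m y)"] by (simp add: ev_nm)
  next
    case (brk m x m' y)
    have "bracket N (c (vN (pe m x))) (c (vN (pe m' y))) = c (bracket ?L (vN (pe m x)) (vN (pe m' y)))"
      using lie_homD(4)[OF c(1)] vN by simp
    also have "bracket ?L (vN (pe m x)) (vN (pe m' y)) = vN (pe (m * m') (cBrk x y))"
      using \<kappa>(1) \<kappa>(3)[of m' m, unfolded mult.commute[of m' m]]
      by (simp add: vN_def W.val_simps P0.P.bracket_smult_left P0.P.bracket_smult_right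
        P0.P.bracket_closed W.val_closed P0.P.smult_assoc1)
    finally show ?thesis using brk by (simp add: ev_nm)
  next
    case (mul m \<mu> x)
    then show ?thesis
      using \<kappa>(1,3) by (simp add: ev_nm vN_def W.val_simps W.val_closed P0.P.smult_assoc1)
  next
    case (eq x y m)
    then show ?thesis using W.val_name_eq by (simp add: ev_nm vN_def Q_def)
  qed
  have ev_R': "?ev t = \<zero>\<^bsub>N\<^esub>" if t: "t \<in> lie_terms K 5" "lie_class K 5 t \<in> R'" for t
  proof -
    have zero: "?ev t = \<zero>\<^bsub>N\<^esub>"
      if vw: "v \<in> lie_terms K 5" "w \<in> lie_terms K 5" "?ev v = ?ev w"
        and cl: "lie_class K 5 t = lie_class K 5 v \<ominus>\<^bsub>free_lie K 5\<^esub> lie_class K 5 w" for v w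
    proof -
      have "lie_class K 5 t = lie_class K 5 (Add v (Smult (\<ominus>\<^bsub>K\<^esub> \<one>\<^bsub>K\<^esub>) w))"
        using cl vw by (simp add: free_lie_minus)
      then have "(t, Add v (Smult (\<ominus>\<^bsub>K\<^esub> \<one>\<^bsub>K\<^esub>) w)) \<in> lie_cong K 5"
        using t(1) vw by (subst (asm) lie_class_eq_iff) (auto intro!: tI)
      then have "?ev t = ?ev (Add v (Smult (\<ominus>\<^bsub>K\<^esub> \<one>\<^bsub>K\<^esub>) w))" using \<rho> by (intro N.lie_eval_cong)
      then show ?thesis
        using N.lie_eval_closed[OF vw(2), of \<rho>] \<rho> vw(3) by (simp add: N.smult_l_minus N.M.r_neg)
    qed
    from t(2) consider v w where "word_eq Q C v w" "lie_class K 5 t = cls v \<ominus>\<^bsub>free_lie K 5\<^esub> cls w"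
      | "lie_class K 5 t = cls (Gen 0) \<oplus>\<^bsub>free_lie K 5\<^esub> cls (Gen 1) \<ominus>\<^bsub>free_lie K 5\<^esub> cls (Gen 2)"
      by (auto simp: R'_def E_def)
    then show ?thesis
    proof cases
      case 1
      then show ?thesis using zero[OF word(1,2)[OF 1(1)] ev_eq[OF 1(1)]] by (simp add: cls_def)
    next
      case 2
      then show ?thesis
        using zero[of "Add (Gen 0) (Gen 1)" "Gen 2"] by (simp add: cls_def free_lie_add gen tI \<rho>_def)
    qed
  qed
  obtain \<pi> where \<pi>: "\<pi> \<in> lie_hom K ?P N" "\<And>t. t \<in> lie_terms K 5 \<Longrightarrow> \<pi> (?pc t) = ?ev t"
    using P1.presented_hom[OF N, of \<rho>] \<rho> ev_R' by metis

  \<comment> \<open>The linear map from the given algebra to the new one\<close>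
  have pc_eq: "?pc (map_lie_term dec v) = ?pc (map_lie_term dec w)" if vw: "word_eq Q C v w" for v w
  proof -
    have "cls v \<ominus>\<^bsub>free_lie K 5\<^esub> cls w \<in> R'" using vw by (auto simp: R'_def E_def)
    then have "cls (Add (Add v (Smult c0 w)) (Smult 0 Zero)) \<in> R'" using rel_mem[OF word(1,2)[OF vw]] by simp
    then show ?thesis
      using presented_relation_eq[OF P1.lie_presentation_axioms dec word(1,2)[OF vw]]
      by (simp add: cls_def c0)
  qed
  have pc_gamma: "?pc (Gen 2) = ?pc (Gen 0) \<oplus>\<^bsub>?P\<^esub> ?pc (Gen 1)"
  proof -
    have "cls (Add (Gen 0) (Gen 1)) \<ominus>\<^bsub>free_lie K 5\<^esub> cls (Gen 2) \<in> R'"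
      by (simp add: R'_def cls_def free_lie_add gen)
    then have "cls (Add (Add (Add (Gen 0) (Gen 1)) (Smult c0 (Gen 2))) (Smult 0 Zero)) \<in> R'"
      using rel_mem[of "Add (Gen 0) (Gen 1)" "Gen 2"] by (simp add: gen tI)
    then have "?pc (Add (Gen 0) (Gen 1)) = ?pc (Gen 2)"
      using presented_relation_eq[OF P1.lie_presentation_axioms dec, of "Add (Gen 0) (Gen 1)" "Gen 2"]
      by (simp add: cls_def c0 gen tI)
    then show ?thesis by (simp add: P1.presented_class_simps(2) gen)
  qed
  have zT: "zWord i \<in> lie_terms K 5" for i by (rule is_word_terms[OF is_word_z])
  have nmT: "nmWord i \<in> lie_terms K 5" for i by (rule is_word_terms[OF is_word_nm])
  define H where "H x m = ?pc (nmWord (pe m x))" for x m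
  have aC: "?pc (aWord 2 i) = ?pc (aWord 0 i) \<oplus>\<^bsub>?P\<^esub> ?pc (aWord (Suc 0) i)" for i
    using P1.P.bracket_add_left[of "?pc (Gen 0)" "?pc (Gen 1)" "?pc (zWord i)"] pc_gamma
    by (simp add: P1.presented_class_simps(4)[symmetric] P1.presented_class_closed gen zT)
  interpret H: name_system K bs \<kappa> pj chr eqs ?P H
  proof unfold_locales
    fix x y m m' \<mu>
    show "H x m \<in> carrier ?P" by (simp add: H_def P1.presented_class_closed nmT)
    have "H (cAdd x y) m = ?pc (aWord 2 (pe (pe m x) (pe m y)))"
      using pc_eq[OF word_eq.add[of Q C m x y]] by (simp add: H_def)
    then show "H (cAdd x y) m = H x m \<oplus>\<^bsub>?P\<^esub> H y m"
      using pc_eq[OF word_eq.left[of Q C "pe m x" "pe m y"]] pc_eq[OF word_eq.right[of Q C "pe m x" "pe m y"]]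
      by (simp add: H_def aC)
    show "bracket ?P (H x m) (H y m') = H (cBrk x y) (m * m')"
      using pc_eq[OF word_eq.brk[of Q C m x m' y]] by (simp add: H_def P1.presented_class_simps(4) nmT)
    show "H (cMul \<mu> x) m = H x (m * \<mu>)"
      using pc_eq[OF word_eq.mul[of Q C m \<mu> x]] by (simp add: H_def)
    show "H x m = H y m" if "name_eq pj chr eqs (length bs) x y"
      using pc_eq[OF word_eq.eq[of Q x y C m]] that by (simp add: H_def Q_def)
  qed
  obtain es where es: "fst ` set es \<subseteq> carrier K" "twist_weight K \<kappa> es = \<one>\<^bsub>K\<^esub>"
    and lin: "\<And>t. twist ?P es (H (term_encode t)) 1 =
      lie_eval ?P (\<lambda>i. twist ?P es (H (pe 0 i)) 1) (map_lie_term dec t)"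
    using H.linear_name_map unfolding dec_def by blast
  \<comment> \<open>A generator is not sent to its own name but to the average of the names of its
    scalar multiples.\<close>
  define \<sigma> where "\<sigma> i = twist ?P es (H (pe 0 i)) 1" for i
  have \<sigma>: "\<sigma> i \<in> carrier ?P" for i
    unfolding \<sigma>_def using es(1) H.H_closed by (rule P1.P.twist_closed)
  have \<sigma>_R: "lie_eval ?P \<sigma> t = \<zero>\<^bsub>?P\<^esub>" if t: "t \<in> lie_terms K n" "lie_class K n t \<in> R" for t
  proof -
    obtain t' where t': "t' \<in> T" "lie_class K n t = lie_class K n (map_lie_term dec t')"
      using t(2) R by (auto simp: dec_def)
    have t'T: "map_lie_term dec t' \<in> lie_terms K n" using t'(1) T by (auto simp: dec_def)
    have "(t, map_lie_term dec t') \<in> lie_cong K n" using t'(2) t(1) t'T by (simp add: lie_class_eq_iff)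
    then have "lie_eval ?P \<sigma> t = lie_eval ?P \<sigma> (map_lie_term dec t')" using \<sigma> by (intro P1.P.lie_eval_cong)
    also have "\<dots> = twist ?P es (H (term_encode t')) 1" unfolding \<sigma>_def[abs_def] by (rule lin[symmetric])
    also have "H (term_encode t') = (\<lambda>m. \<zero>\<^bsub>?P\<^esub>)"
    proof
      fix m
      have "word_eq Q C (nmWord (pe m (term_encode t'))) (nmWord (pe m cZero))"
        using t'(1) by (intro word_eq.relator) (auto simp: C_def)
      from pc_eq[OF this] show "H (term_encode t') m = \<zero>\<^bsub>?P\<^esub>"
        using H.H_zero[of m] by (simp add: H_def)
    qed
    finally show ?thesis using P1.P.twist_zero[OF es(1)] by simp
  qed
  obtain \<psi> where \<psi>: "\<psi> \<in> lie_hom K ?L ?P"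
    "\<And>t. t \<in> lie_terms K n \<Longrightarrow> \<psi> (presented_class K n R t) = lie_eval ?P \<sigma> t"
    using P0.presented_hom[OF P1.P.lie_algebra_axioms, of \<sigma>] \<sigma> \<sigma>_R by metis

  \<comment> \<open>Injectivity\<close>
  have \<pi>_\<sigma>: "\<pi> (\<sigma> i) = c (g i)" for i
  proof -
    have "\<pi> (\<sigma> i) = twist N es (\<lambda>m. \<pi> (H (pe 0 i) m)) 1"
      unfolding \<sigma>_def by (rule P1.P.twist_hom[OF N \<pi>(1) es(1) H.H_closed])
    \<comment> \<open>In the model the name \<open>pe m (pe 0 i)\<close> really is
      \<open>\<kappa> m\<close> times the image of the generator, so averaging with weight 1 returns
      that image.\<close>
    also have "\<dots> = twist_weight K \<kappa> es \<odot>\<^bsub>N\<^esub> c (g i)"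
    proof (rule N.twist_eigen[OF es(1) _ \<kappa>(1)])
      show "c (g i) \<in> carrier N" using lie_homD(1)[OF c(1)] W.g_closed by blast
      show "\<pi> (H (pe 0 i) (1 * snd e)) = \<kappa> (snd e) \<odot>\<^bsub>N\<^esub> c (g i)" for e :: "'k \<times> nat"
        using lie_homD(3)[OF c(1) \<kappa>(1) W.g_closed]
        by (simp add: H_def \<pi>(2)[OF nmT] ev_nm vN_def W.val_simps)
    qed
    finally show ?thesis using es(2) lie_homD(1)[OF c(1) W.g_closed] by simp
  qed
  have \<pi>\<psi>: "\<pi> (\<psi> x) = c x" if "x \<in> carrier ?L" for x
  proof -
    obtain t where t: "t \<in> lie_terms K n" "x = presented_class K n R t"
      using \<open>x \<in> carrier ?L\<close> by (auto simp: P0.presented_carrier)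
    have "\<pi> (\<psi> x) = \<pi> (lie_eval ?P \<sigma> t)" using \<psi>(2) t by simp
    also have "\<dots> = lie_eval N (\<lambda>i. c (g i)) t"
      using lie_eval_hom[OF P1.P.lie_algebra_axioms N \<pi>(1) t(1) \<sigma>] by (simp add: \<pi>_\<sigma>)
    also have "\<dots> = c (lie_eval ?L g t)"
      using lie_eval_hom[OF P0.P.lie_algebra_axioms N c(1) t(1) W.g_closed] by simp
    finally show ?thesis using g_eval t by simp
  qed
  have "inj_on \<psi> (carrier ?L)"
    using c(2) \<pi>\<psi> by (metis (no_types, lifting) inj_on_def)
  then have "inj_on (\<psi> \<circ> \<phi>) (carrier L)"
    using \<phi>(2) by (metis bij_betw_def comp_inj_on)
  moreover have "\<psi> \<circ> \<phi> \<in> lie_hom K L ?P" by (rule lie_hom_comp[OF \<phi>(1) \<psi>(1)])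
  moreover have "E \<subseteq> {v \<ominus>\<^bsub>free_lie K 5\<^esub> w | v w.
      v \<in> lie_words (free_lie K 5) (free_gens K 5) \<and> w \<in> lie_words (free_lie K 5) (free_gens K 5)}"
    using word(3,4) unfolding E_def by blast
  moreover have "cls (Gen i) \<in> free_gens K 5" if "i < 5" for i
    using that by (auto simp: cls_def free_gens_def)
  ultimately show ?thesis
    using re unfolding R'_def
    by (intro exI[of _ 5] exI[of _ E] exI[of _ "cls (Gen 0)"] exI[of _ "cls (Gen 1)"] exI[of _ "cls (Gen 2)"]
        conjI bexI[of _ "\<psi> \<circ> \<phi>"]) auto
qed

end
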